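(* Let $\mathbf{S}=(\{A_\sigma,K_\sigma,B_\sigma\}_{\sigma=1}^{n_\mu},C,D,F,\mathbf{v})$ be a sGLSS of $(\mathbf{y},\mathbf{u},\boldsymbol{\mu})$, and assume that the asGLSS $\mathbf{S}_s=(\{A_\sigma,K_\sigma\}_{\sigma=1}^{n_\mu},C,F,\mathbf{v})$ of $(\mathbf{y}^s,\boldsymbol{\mu})$ is observable and reachable. Then $\mathbf{S}$ is minimal dimensional among all the sGLSSs of $(\mathbf{y},\mathbf{u},\boldsymbol{\mu})$, i.e. every sGLSS of $(\mathbf{y},\mathbf{u},\boldsymbol{\mu})$ has dimension at least that of $\mathbf{S}$.
   Context: All random variables live on a fixed probability space; all processes are indexed by $t\in\mathbb{Z}$. Processes $\mathbf{u},\mathbf{y},\boldsymbol{\mu}=(\boldsymbol{\mu}_1,\dots,\boldsymbol{\mu}_{n_\mu})^T$ take values in $\mathbb{R}^{n_u},\mathbb{R}^{n_y},\mathbb{R}^{n_\mu}$. Words. $\Sigma=\{1,\dots,n_\mu\}$; $\Sigma^+$ is the set of nonempty finite words over $\Sigma$, $\epsilon$ is the empty word, $\Sigma^*=\Sigma^+\cup\{\epsilon\}$, $|w|$ is the length of $w$, and juxtaposition is concatenation. For square matrices $\{A_\sigma\}$ and $w=\sigma_1\cdots\sigma_k$, $A_w=A_{\sigma_k}\cdots A_{\sigma_1}$, $A_\epsilon=I$. For $w=\sigma_1\cdots\sigma_k\in\Sigma^+$, $\boldsymbol{\mu}_w(t)=\boldsymbol{\mu}_{\sigma_1}(t-k+1)\boldsymbol{\mu}_{\sigma_2}(t-k+2)\cdots\boldsymbol{\mu}_{\sigma_k}(t)$;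 $\boldsymbol{\mu}_\epsilon(t)=1$. Admissible switching. $\boldsymbol{\mu}$ is admissible if: (1) there is $\mathcal{E}\subseteq\Sigma\times\Sigma$ such that for each $\sigma\in\Sigma$ there is $\sigma'\in\Sigma$ with $(\sigma,\sigma')\in\mathcal{E}$, and, with $L$ the set of words $\sigma_1\cdots\sigma_k\in\Sigma^+$ with $(\sigma_i,\sigma_{i+1})\in\mathcal{E}$ for $i=1,\dots,k-1$, one has $\boldsymbol{\mu}_w=0$ for all $w\in\Sigma^+\setminus L$; (2) with $\mathcal{F}^{\boldsymbol{\mu},-}_t$ the $\sigma$-algebra generated by $\{\boldsymbol{\mu}(k)\}_{k<t}$, there are positive numbers $\{p_\sigma\}_{\sigma\in\Sigma}$ such that for all $w,v\in\Sigma^+$, $\sigma,\sigma'\in\Sigma$, $t\in\mathbb{Z}$: $E[\boldsymbol{\mu}_{w\sigma}(t)\boldsymbol{\mu}_{v\sigma'}(t)\mid\mathcal{F}^{\boldsymbol{\mu},-}_t]$ equals $p_\sigma\boldsymbol{\mu}_w(t-1)\boldsymbol{\mu}_v(t-1)$ if $\sigma=\sigma'$ and $w\sigma,v\sigma\in L$, and $0$ otherwise; $E[\boldsymbol{\mu}_{w\sigma}(t)\boldsymbol{\mu}_{\sigma'}(t)\mid\mathcal{F}^{\boldsymbol{\mu},-}_t]$ equals $p_\sigma\boldsymbol{\mu}_w(t-1)$ if $\sigma=\sigma'$ and $w\sigma\in L$, and $0$ otherwise; $E[\boldsymbol{\mu}_\sigma(t)\boldsymbol{\mu}_{\sigma'}(t)\mid\mathcal{F}^{\boldsymbol{\mu},-}_t]=0$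 if $\sigma\neq\sigma'$; (3) there are reals $\{\alpha_\sigma\}$ with $\sum_{\sigma}\alpha_\sigma\boldsymbol{\mu}_\sigma(t)=1$ for all $t$; (4) for all $w,v\in\Sigma^+$, $[\boldsymbol{\mu}_w,\boldsymbol{\mu}_v]^T$ is wide-sense stationary. Put $p_w=p_{\sigma_1}\cdots p_{\sigma_k}$ for $w=\sigma_1\cdots\sigma_k$. For a process $\mathbf{r}$ and $w\in\Sigma^+$: $\mathbf{z}^{\mathbf{r}}_w(t)=\mathbf{r}(t-|w|)\,\boldsymbol{\mu}_w(t-1)\frac{1}{\sqrt{p_w}}$. ZMWSSI. $\mathbf{r}$ is ZMWSSI (zero mean wide sense stationary w.r.t. $\boldsymbol{\mu}$) if (1) for every $t$ the $\sigma$-algebras generated by $\{\mathbf{r}(k)\}_{k\le t}$ and by $\{\boldsymbol{\mu}_\sigma(k)\}_{k\ge t,\sigma\in\Sigma}$ are conditionally independent given the one generated by $\{\boldsymbol{\mu}_\sigma(k)\}_{k<t,\sigma\in\Sigma}$; (2) the processes $\mathbf{r}$, $\mathbf{z}^{\mathbf{r}}_w$ ($w\in\Sigma^+$) are zero mean, square integrable and jointly wide-sense stationary. White noise w.r.t. $\boldsymbol{\mu}$: a ZMWSSI process $\mathbf{r}$ such that for all $w\in\Sigma^+$, $v\in\Sigma^*$, $\sigma\in\Sigma$: $E[\mathbf{z}^{\mathbf{r}}_w(t)(\mathbf{z}^{\mathbf{r}}_{\sigma v}(t))^T]=0$ if $w\ne\sigma v$, and $=E[\mathbf{z}^{\mathbf{r}}_\sigma(t)(\mathbf{z}^{\mathbf{r}}_\sigma(t))^T]$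 if $w=\sigma v\in L$; and $E[\mathbf{z}^{\mathbf{r}}_\sigma(t)(\mathbf{z}^{\mathbf{r}}_\sigma(t))^T]$ is nonsingular for all $\sigma\in\Sigma$. Standing assumptions: $\boldsymbol{\mu}$ is admissible; $\mathbf{u}$ is a white noise w.r.t. $\boldsymbol{\mu}$; $[\mathbf{y}^T,\mathbf{u}^T]^T$ is ZMWSSI. sGLSS. $\mathbf{S}=(\{A_\sigma,K_\sigma,B_\sigma\}_{\sigma=1}^{n_\mu},C,D,F,\mathbf{v})$, with $A_i\in\mathbb{R}^{n_x\times n_x}$, $B_i\in\mathbb{R}^{n_x\times n_u}$, $K_i\in\mathbb{R}^{n_x\times n_n}$, $C\in\mathbb{R}^{n_y\times n_x}$, $D\in\mathbb{R}^{n_y\times n_u}$, $F\in\mathbb{R}^{n_y\times n_n}$ and $\mathbf{v}$ an $\mathbb{R}^{n_n}$-valued (noise) process, is a stationary GLSS (sGLSS) of $(\mathbf{y},\mathbf{u},\boldsymbol{\mu})$ if there is an $\mathbb{R}^{n_x}$-valued (state) process $\mathbf{x}$ with $$\mathbf{x}(t+1)=\sum_{i=1}^{n_\mu}(A_i\mathbf{x}(t)+B_i\mathbf{u}(t)+K_i\mathbf{v}(t))\boldsymbol{\mu}_i(t),\qquad \mathbf{y}(t)=C\mathbf{x}(t)+D\mathbf{u}(t)+F\mathbf{v}(t)$$ for all $t\in\mathbb{Z}$, and: (1) $\boldsymbol{\omega}=[\mathbf{v}^T,\mathbf{u}^T]^T$ is a white noise w.r.t. $\boldsymbol{\mu}$,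 and $E[\mathbf{v}(t)\mathbf{u}(t)^T\boldsymbol{\mu}_\sigma^2(t)]=0$ for all $\sigma\in\Sigma$; (2) $[\mathbf{x}^T,\boldsymbol{\omega}^T]^T$ is ZMWSSI, and $E[\mathbf{z}^{\mathbf{x}}_\sigma(t)(\mathbf{z}^{\boldsymbol{\omega}}_\sigma(t))^T]=0$, $E[\mathbf{z}^{\mathbf{x}}_w(t)\boldsymbol{\omega}(t)^T]=0$ for all $\sigma\in\Sigma$, $w\in\Sigma^+$; (3) all eigenvalues of $\sum_{\sigma}p_\sigma A_\sigma\otimes A_\sigma$ lie in the open unit disc; (4) if $(\sigma_1,\sigma_2)\notin\mathcal{E}$ then $A_{\sigma_2}A_{\sigma_1}=0$ and $A_{\sigma_2}[K_{\sigma_1},B_{\sigma_1}]E[\mathbf{z}^{\boldsymbol{\omega}}_{\sigma_1}(t)(\mathbf{z}^{\boldsymbol{\omega}}_{\sigma_1}(t))^T]=0$. The dimension of $\mathbf{S}$ is $n_x$. asGLSS (autonomous case). A tuple $(\{A_\sigma,K_\sigma\}_{\sigma=1}^{n_\mu},C,F,\mathbf{v})$ is an asGLSS of $(\mathbf{y},\boldsymbol{\mu})$ (for a given output process $\mathbf{y}$) if there is a process $\mathbf{x}$ with $\mathbf{x}(t+1)=\sum_i(A_i\mathbf{x}(t)+K_i\mathbf{v}(t))\boldsymbol{\mu}_i(t)$, $\mathbf{y}(t)=C\mathbf{x}(t)+F\mathbf{v}(t)$ for all $t$, and (1)–(4) above hold with the input removed, i.e. with $\boldsymbol{\omega}=\mathbf{v}$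 and $[K_{\sigma_1},B_{\sigma_1}]$ replaced by $K_{\sigma_1}$. The state process $\mathbf{x}$ is uniquely determined by the tuple and $\boldsymbol{\mu}$. Reachability and observability of an asGLSS $(\{A_\sigma,K_\sigma\}_{\sigma=1}^{n_\mu},C,F,\mathbf{v})$ with state process $\mathbf{x}$ and dimension $n_x$: let $P_\sigma=E[\mathbf{x}(t)\mathbf{x}(t)^T\boldsymbol{\mu}_\sigma^2(t)]$, $Q_\sigma=E[\mathbf{v}(t)\mathbf{v}(t)^T\boldsymbol{\mu}_\sigma^2(t)]$ (independent of $t$) and $G_\sigma=\frac{1}{\sqrt{p_\sigma}}(A_\sigma P_\sigma C^T+K_\sigma Q_\sigma F^T)$. It is reachable if the columns of the matrices $A_wG_\sigma$, $w\in\Sigma^*$, $\sigma\in\Sigma$, span $\mathbb{R}^{n_x}$; it is observable if $\bigcap_{w\in\Sigma^*}\ker(CA_w)=\{0\}$. Projection. $\mathcal{H}_1$ is the Hilbert space of real square integrable random variables with $\langle \mathbf{a},\mathbf{b}\rangle=E[\mathbf{a}\mathbf{b}]$. For a square integrable random vector $\mathbf{z}$ and closed subspace $M\subseteq\mathcal{H}_1$, $E_l[\mathbf{z}\mid M]$ is the componentwise orthogonal projection onto $M$; for a set $\mathfrak{S}$ of square integrable random vectors, $E_l[\mathbf{z}\mid\mathfrak{S}]$ is the projection onto the closed subspace generated by the coordinates of the elements of $\mathfrak{S}$. Components of the output: $\mathbf{y}^d(t)=E_l[\mathbf{y}(t)\mid\{\mathbf{z}^{\mathbf{u}}_w(t)\}_{w\in\Sigma^+}\cup\{\mathbf{u}(t)\}]$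 and $\mathbf{y}^s(t)=\mathbf{y}(t)-\mathbf{y}^d(t)$. *)

theory Defs
  imports
    "HOL-Probability.Probability"
    "Jordan_Normal_Form.VS_Connect"
    "Jordan_Normal_Form.Matrix_Kernel"
    "Jordan_Normal_Form.Char_Poly"
begin

unbundle no vec_syntax
hide_type (open) Finite_Cartesian_Product.vec
hide_const (open) Finite_Cartesian_Product.vec

text \<open>
  The alphabet is a finite type \<open>'s\<close>, so words are lists over \<open>'s\<close>; the dimensions of all
  vectors and matrices are natural numbers. The switching process is given by its components
  \<open>mu \<sigma>\<close>. Equations between random variables are meant almost surely.
\<close>

type_synonym ('a, 's) switching = "'s \<Rightarrow> int \<Rightarrow> 'a \<Rightarrow> real"
type_synonym 'a process = "int \<Rightarrow> 'a \<Rightarrow> real vec"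

subsection \<open>Random variables, stationarity, conditional independence\<close>

definition square_integrable :: "'a measure \<Rightarrow> ('a \<Rightarrow> real) \<Rightarrow> bool" where
  "square_integrable M f \<longleftrightarrow> f \<in> borel_measurable M \<and> integrable M (\<lambda>\<omega>. (f \<omega>)\<^sup>2)"

definition gen_sigma :: "'a measure \<Rightarrow> ('a \<Rightarrow> real) set \<Rightarrow> 'a measure" where
  "gen_sigma M X = sigma (space M) {f -` B \<inter> space M | f B. f \<in> X \<and> B \<in> sets borel}"

definition cond_indep :: "'a measure \<Rightarrow> 'a measure \<Rightarrow> 'a measure \<Rightarrow> 'a measure \<Rightarrow> bool" where
  "cond_indep M F G H \<longleftrightarrow>
    (\<forall>A\<in>sets F. \<forall>B\<in>sets G. AE \<omega> in M.
       real_cond_exp M H (indicat_real (A \<inter> B)) \<omega> =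
       real_cond_exp M H (indicat_real A) \<omega> * real_cond_exp M H (indicat_real B) \<omega>)"

text \<open>A vector process, or a family of vector processes, is wide-sense stationary iff the set of
  all its scalar component processes is.\<close>

definition jointly_wss :: "'a measure \<Rightarrow> (int \<Rightarrow> 'a \<Rightarrow> real) set \<Rightarrow> bool" where
  "jointly_wss M X \<longleftrightarrow>
    (\<forall>f\<in>X. \<forall>t. square_integrable M (f t)) \<and>
    (\<forall>f\<in>X. \<forall>s t. (\<integral>\<omega>. f s \<omega> \<partial>M) = (\<integral>\<omega>. f t \<omega> \<partial>M)) \<and>
    (\<forall>f\<in>X. \<forall>g\<in>X. \<forall>s t k.
       (\<integral>\<omega>. f (s + k) \<omega> * g (t + k) \<omega> \<partial>M) = (\<integral>\<omega>. f s \<omega> * g t \<omega> \<partial>M))"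

definition zero_mean :: "'a measure \<Rightarrow> (int \<Rightarrow> 'a \<Rightarrow> real) set \<Rightarrow> bool" where
  "zero_mean M X \<longleftrightarrow> (\<forall>f\<in>X. \<forall>t. (\<integral>\<omega>. f t \<omega> \<partial>M) = 0)"

definition vector_process :: "'a measure \<Rightarrow> nat \<Rightarrow> 'a process \<Rightarrow> bool" where
  "vector_process M n r \<longleftrightarrow>
    (\<forall>t. \<forall>\<omega>\<in>space M. r t \<omega> \<in> carrier_vec n) \<and>
    (\<forall>t. \<forall>i<n. (\<lambda>\<omega>. r t \<omega> $ i) \<in> borel_measurable M)"

definition components :: "nat \<Rightarrow> 'a process \<Rightarrow> (int \<Rightarrow> 'a \<Rightarrow> real) set" where
  "components n r = {\<lambda>t \<omega>. r t \<omega> $ i | i. i < n}"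

text \<open>\<open>E_outer M n m X Y\<close> is $E[X Y^T]$ for an $n$-dimensional $X$ and an $m$-dimensional $Y$.\<close>

definition E_outer :: "'a measure \<Rightarrow> nat \<Rightarrow> nat \<Rightarrow> ('a \<Rightarrow> real vec) \<Rightarrow> ('a \<Rightarrow> real vec) \<Rightarrow> real mat" where
  "E_outer M n m X Y = mat n m (\<lambda>(i, j). \<integral>\<omega>. X \<omega> $ i * Y \<omega> $ j \<partial>M)"

definition stack :: "'a process \<Rightarrow> 'a process \<Rightarrow> 'a process" where
  "stack r q = (\<lambda>t \<omega>. r t \<omega> @\<^sub>v q t \<omega>)"

subsection \<open>Words and admissible switching\<close>

definition p_word :: "('s \<Rightarrow> real) \<Rightarrow> 's list \<Rightarrow> real" where
  "p_word p w = prod_list (map p w)"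

definition mu_word :: "('a, 's) switching \<Rightarrow> 's list \<Rightarrow> int \<Rightarrow> 'a \<Rightarrow> real" where
  "mu_word mu w t \<omega> = (\<Prod>i<length w. mu (w ! i) (t - int (length w) + 1 + int i) \<omega>)"

primrec mat_word :: "nat \<Rightarrow> ('s \<Rightarrow> real mat) \<Rightarrow> 's list \<Rightarrow> real mat" where
  "mat_word n A [] = 1\<^sub>m n"
| "mat_word n A (\<sigma> # w) = mat_word n A w * A \<sigma>"

definition admissible_words :: "('s \<times> 's) set \<Rightarrow> 's list set" where
  "admissible_words E = {w. w \<noteq> [] \<and> successively (\<lambda>\<sigma> \<sigma>'. (\<sigma>, \<sigma>') \<in> E) w}"

definition mu_past :: "'a measure \<Rightarrow> ('a, 's) switching \<Rightarrow> int \<Rightarrow> 'a measure" where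
  "mu_past M mu t = gen_sigma M {mu \<sigma> k | \<sigma> k. k < t}"

definition mu_future :: "'a measure \<Rightarrow> ('a, 's) switching \<Rightarrow> int \<Rightarrow> 'a measure" where
  "mu_future M mu t = gen_sigma M {mu \<sigma> k | \<sigma> k. t \<le> k}"

definition admissible_switching ::
  "'a measure \<Rightarrow> ('a, 's::finite) switching \<Rightarrow> ('s \<times> 's) set \<Rightarrow> ('s \<Rightarrow> real) \<Rightarrow> bool" where
  "admissible_switching M mu E p \<longleftrightarrow>
    (let L = admissible_words E in
      (\<forall>\<sigma> t. mu \<sigma> t \<in> borel_measurable M) \<and>
      (\<forall>\<sigma>. \<exists>\<sigma>'. (\<sigma>, \<sigma>') \<in> E) \<and>
      (\<forall>w t. w \<noteq> [] \<longrightarrow> w \<notin> L \<longrightarrow> (AE \<omega> in M. mu_word mu w t \<omega> = 0)) \<and>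
      (\<forall>\<sigma>. 0 < p \<sigma>) \<and>
      (\<forall>w v \<sigma> \<sigma>' t. w \<noteq> [] \<longrightarrow> v \<noteq> [] \<longrightarrow>
        (AE \<omega> in M.
          real_cond_exp M (mu_past M mu t)
            (\<lambda>\<omega>. mu_word mu (w @ [\<sigma>]) t \<omega> * mu_word mu (v @ [\<sigma>']) t \<omega>) \<omega> =
          (if \<sigma> = \<sigma>' \<and> w @ [\<sigma>] \<in> L \<and> v @ [\<sigma>] \<in> L
           then p \<sigma> * mu_word mu w (t - 1) \<omega> * mu_word mu v (t - 1) \<omega> else 0))) \<and>
      (\<forall>w \<sigma> \<sigma>' t. w \<noteq> [] \<longrightarrow>
        (AE \<omega> in M.
          real_cond_exp M (mu_past M mu t)
            (\<lambda>\<omega>. mu_word mu (w @ [\<sigma>]) t \<omega> * mu \<sigma>' t \<omega>) \<omega> =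
          (if \<sigma> = \<sigma>' \<and> w @ [\<sigma>] \<in> L then p \<sigma> * mu_word mu w (t - 1) \<omega> else 0))) \<and>
      (\<forall>\<sigma> \<sigma>' t. \<sigma> \<noteq> \<sigma>' \<longrightarrow>
        (AE \<omega> in M. real_cond_exp M (mu_past M mu t) (\<lambda>\<omega>. mu \<sigma> t \<omega> * mu \<sigma>' t \<omega>) \<omega> = 0)) \<and>
      (\<exists>\<alpha> :: 's \<Rightarrow> real. \<forall>t. AE \<omega> in M. (\<Sum>\<sigma>\<in>UNIV. \<alpha> \<sigma> * mu \<sigma> t \<omega>) = 1) \<and>
      (\<forall>w v. w \<noteq> [] \<longrightarrow> v \<noteq> [] \<longrightarrow> jointly_wss M {mu_word mu w, mu_word mu v}))"

subsection \<open>ZMWSSI and white noise processes\<close>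

definition z_proc ::
  "('a, 's) switching \<Rightarrow> ('s \<Rightarrow> real) \<Rightarrow> 'a process \<Rightarrow> 's list \<Rightarrow> 'a process" where
  "z_proc mu p r w =
    (\<lambda>t \<omega>. (mu_word mu w (t - 1) \<omega> / sqrt (p_word p w)) \<cdot>\<^sub>v r (t - int (length w)) \<omega>)"

definition ZMWSSI ::
  "'a measure \<Rightarrow> ('a, 's) switching \<Rightarrow> ('s \<Rightarrow> real) \<Rightarrow> nat \<Rightarrow> 'a process \<Rightarrow> bool" where
  "ZMWSSI M mu p n r \<longleftrightarrow>
    vector_process M n r \<and>
    (\<forall>t. cond_indep M (gen_sigma M {\<lambda>\<omega>. r k \<omega> $ i | k i. k \<le> t \<and> i < n})
           (mu_future M mu t) (mu_past M mu t)) \<and>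
    (let X = components n r \<union> (\<Union>w\<in>{w. w \<noteq> []}. components n (z_proc mu p r w))
     in zero_mean M X \<and> jointly_wss M X)"

definition white_noise ::
  "'a measure \<Rightarrow> ('a, 's) switching \<Rightarrow> ('s \<times> 's) set \<Rightarrow> ('s \<Rightarrow> real) \<Rightarrow> nat \<Rightarrow> 'a process \<Rightarrow> bool" where
  "white_noise M mu E p n r \<longleftrightarrow>
    ZMWSSI M mu p n r \<and>
    (\<forall>w v \<sigma> t. w \<noteq> [] \<longrightarrow>
      (w \<noteq> \<sigma> # v \<longrightarrow>
        E_outer M n n (z_proc mu p r w t) (z_proc mu p r (\<sigma> # v) t) = 0\<^sub>m n n) \<and>
      (w = \<sigma> # v \<and> w \<in> admissible_words E \<longrightarrow>
        E_outer M n n (z_proc mu p r w t) (z_proc mu p r (\<sigma> # v) t) =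
        E_outer M n n (z_proc mu p r [\<sigma>] t) (z_proc mu p r [\<sigma>] t))) \<and>
    (\<forall>\<sigma> t. invertible_mat (E_outer M n n (z_proc mu p r [\<sigma>] t) (z_proc mu p r [\<sigma>] t)))"

subsection \<open>Stationary generalized linear switched systems\<close>

record ('a, 's) asGLSS =
  xdim :: nat
  vdim :: nat
  Amat :: "'s \<Rightarrow> real mat"
  Kmat :: "'s \<Rightarrow> real mat"
  Cmat :: "real mat"
  Fmat :: "real mat"
  noise :: "'a process"

record ('a, 's) sGLSS = "('a, 's) asGLSS" +
  Bmat :: "'s \<Rightarrow> real mat"
  Dmat :: "real mat"

definition stochastic_part :: "('a, 's) sGLSS \<Rightarrow> ('a, 's) asGLSS" where
  "stochastic_part S =
    \<lparr>xdim = xdim S, vdim = vdim S, Amat = Amat S, Kmat = Kmat S,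
     Cmat = Cmat S, Fmat = Fmat S, noise = noise S\<rparr>"

definition kronecker :: "'b::times mat \<Rightarrow> 'b mat \<Rightarrow> 'b mat" where
  "kronecker A B = mat (dim_row A * dim_row B) (dim_col A * dim_col B)
    (\<lambda>(i, j). A $$ (i div dim_row B, j div dim_col B) * B $$ (i mod dim_row B, j mod dim_col B))"

definition append_cols :: "'b::zero mat \<Rightarrow> 'b mat \<Rightarrow> 'b mat" where
  "append_cols A B = four_block_mat A B (0\<^sub>m 0 (dim_col A)) (0\<^sub>m 0 (dim_col B))"

definition stable :: "('s::finite \<Rightarrow> real) \<Rightarrow> nat \<Rightarrow> ('s \<Rightarrow> real mat) \<Rightarrow> bool" where
  "stable p n A \<longleftrightarrow>
    (let T = mat (n * n) (n * n) (\<lambda>ij. \<Sum>\<sigma>\<in>UNIV. p \<sigma> * kronecker (A \<sigma>) (A \<sigma>) $$ ij)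
     in \<forall>l. eigenvalue (map_mat complex_of_real T) l \<longrightarrow> cmod l < 1)"

definition sGLSS_with_state ::
  "'a measure \<Rightarrow> ('a, 's::finite) switching \<Rightarrow> ('s \<times> 's) set \<Rightarrow> ('s \<Rightarrow> real) \<Rightarrow>
   nat \<Rightarrow> nat \<Rightarrow> 'a process \<Rightarrow> 'a process \<Rightarrow> ('a, 's) sGLSS \<Rightarrow> 'a process \<Rightarrow> bool" where
  "sGLSS_with_state M mu E p ny nu y u S x \<longleftrightarrow>
    (let nx = xdim S; nv = vdim S; A = Amat S; K = Kmat S; B = Bmat S;
         C = Cmat S; D = Dmat S; F = Fmat S; v = noise S;
         om = stack v u; zx = z_proc mu p x; zom = z_proc mu p om
     in
      (\<forall>\<sigma>. A \<sigma> \<in> carrier_mat nx nx \<and> K \<sigma> \<in> carrier_mat nx nv \<and> B \<sigma> \<in> carrier_mat nx nu) \<and>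
      C \<in> carrier_mat ny nx \<and> D \<in> carrier_mat ny nu \<and> F \<in> carrier_mat ny nv \<and>
      vector_process M nv v \<and> vector_process M nx x \<and>
      (\<forall>t. AE \<omega> in M. x (t + 1) \<omega> =
        vec nx (\<lambda>i. \<Sum>\<sigma>\<in>UNIV.
          ((A \<sigma> *\<^sub>v x t \<omega> + B \<sigma> *\<^sub>v u t \<omega> + K \<sigma> *\<^sub>v v t \<omega>) $ i) * mu \<sigma> t \<omega>)) \<and>
      (\<forall>t. AE \<omega> in M. y t \<omega> = C *\<^sub>v x t \<omega> + D *\<^sub>v u t \<omega> + F *\<^sub>v v t \<omega>) \<and>
      white_noise M mu E p (nv + nu) om \<and>
      (\<forall>\<sigma> t. E_outer M nv nu (v t) (\<lambda>\<omega>. (mu \<sigma> t \<omega>)\<^sup>2 \<cdot>\<^sub>v u t \<omega>) = 0\<^sub>m nv nu) \<and>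
      ZMWSSI M mu p (nx + (nv + nu)) (stack x om) \<and>
      (\<forall>\<sigma> t. E_outer M nx (nv + nu) (zx [\<sigma>] t) (zom [\<sigma>] t) = 0\<^sub>m nx (nv + nu)) \<and>
      (\<forall>w t. w \<noteq> [] \<longrightarrow> E_outer M nx (nv + nu) (zx w t) (om t) = 0\<^sub>m nx (nv + nu)) \<and>
      stable p nx A \<and>
      (\<forall>\<sigma>1 \<sigma>2. (\<sigma>1, \<sigma>2) \<notin> E \<longrightarrow>
        A \<sigma>2 * A \<sigma>1 = 0\<^sub>m nx nx \<and>
        (\<forall>t. A \<sigma>2 * append_cols (K \<sigma>1) (B \<sigma>1) *
             E_outer M (nv + nu) (nv + nu) (zom [\<sigma>1] t) (zom [\<sigma>1] t) = 0\<^sub>m nx (nv + nu))))"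

definition is_sGLSS ::
  "'a measure \<Rightarrow> ('a, 's::finite) switching \<Rightarrow> ('s \<times> 's) set \<Rightarrow> ('s \<Rightarrow> real) \<Rightarrow>
   nat \<Rightarrow> nat \<Rightarrow> 'a process \<Rightarrow> 'a process \<Rightarrow> ('a, 's) sGLSS \<Rightarrow> bool" where
  "is_sGLSS M mu E p ny nu y u S \<longleftrightarrow> (\<exists>x. sGLSS_with_state M mu E p ny nu y u S x)"

definition asGLSS_with_state ::
  "'a measure \<Rightarrow> ('a, 's::finite) switching \<Rightarrow> ('s \<times> 's) set \<Rightarrow> ('s \<Rightarrow> real) \<Rightarrow>
   nat \<Rightarrow> 'a process \<Rightarrow> ('a, 's) asGLSS \<Rightarrow> 'a process \<Rightarrow> bool" where
  "asGLSS_with_state M mu E p ny y S x \<longleftrightarrow>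
    (let nx = xdim S; nv = vdim S; A = Amat S; K = Kmat S;
         C = Cmat S; F = Fmat S; v = noise S;
         zx = z_proc mu p x; zv = z_proc mu p v
     in
      (\<forall>\<sigma>. A \<sigma> \<in> carrier_mat nx nx \<and> K \<sigma> \<in> carrier_mat nx nv) \<and>
      C \<in> carrier_mat ny nx \<and> F \<in> carrier_mat ny nv \<and>
      vector_process M nv v \<and> vector_process M nx x \<and>
      (\<forall>t. AE \<omega> in M. x (t + 1) \<omega> =
        vec nx (\<lambda>i. \<Sum>\<sigma>\<in>UNIV. ((A \<sigma> *\<^sub>v x t \<omega> + K \<sigma> *\<^sub>v v t \<omega>) $ i) * mu \<sigma> t \<omega>)) \<and>
      (\<forall>t. AE \<omega> in M. y t \<omega> = C *\<^sub>v x t \<omega> + F *\<^sub>v v t \<omega>) \<and>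
      white_noise M mu E p nv v \<and>
      ZMWSSI M mu p (nx + nv) (stack x v) \<and>
      (\<forall>\<sigma> t. E_outer M nx nv (zx [\<sigma>] t) (zv [\<sigma>] t) = 0\<^sub>m nx nv) \<and>
      (\<forall>w t. w \<noteq> [] \<longrightarrow> E_outer M nx nv (zx w t) (v t) = 0\<^sub>m nx nv) \<and>
      stable p nx A \<and>
      (\<forall>\<sigma>1 \<sigma>2. (\<sigma>1, \<sigma>2) \<notin> E \<longrightarrow>
        A \<sigma>2 * A \<sigma>1 = 0\<^sub>m nx nx \<and>
        (\<forall>t. A \<sigma>2 * K \<sigma>1 * E_outer M nv nv (zv [\<sigma>1] t) (zv [\<sigma>1] t) = 0\<^sub>m nx nv)))"

subsection \<open>Reachability and observability\<close>

definition cov_weighted ::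
  "'a measure \<Rightarrow> ('a, 's) switching \<Rightarrow> nat \<Rightarrow> 'a process \<Rightarrow> 's \<Rightarrow> int \<Rightarrow> real mat" where
  "cov_weighted M mu n r \<sigma> t = E_outer M n n (r t) (\<lambda>\<omega>. (mu \<sigma> t \<omega>)\<^sup>2 \<cdot>\<^sub>v r t \<omega>)"

text \<open>For an asGLSS the weighted covariances do not depend on time, so they are taken at time 0.\<close>

definition G_mat ::
  "'a measure \<Rightarrow> ('a, 's) switching \<Rightarrow> ('s \<Rightarrow> real) \<Rightarrow> ('a, 's) asGLSS \<Rightarrow> 'a process \<Rightarrow> 's \<Rightarrow> real mat" where
  "G_mat M mu p S x \<sigma> =
    (1 / sqrt (p \<sigma>)) \<cdot>\<^sub>m
      (Amat S \<sigma> * cov_weighted M mu (xdim S) x \<sigma> 0 * (Cmat S)\<^sup>T +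
       Kmat S \<sigma> * cov_weighted M mu (vdim S) (noise S) \<sigma> 0 * (Fmat S)\<^sup>T)"

definition reachable ::
  "'a measure \<Rightarrow> ('a, 's) switching \<Rightarrow> ('s \<Rightarrow> real) \<Rightarrow> ('a, 's) asGLSS \<Rightarrow> 'a process \<Rightarrow> bool" where
  "reachable M mu p S x \<longleftrightarrow>
    LinearCombinations.module.span class_ring (module_vec TYPE(real) (xdim S))
      (\<Union>w \<sigma>. set (cols (mat_word (xdim S) (Amat S) w * G_mat M mu p S x \<sigma>)))
    = carrier_vec (xdim S)"

definition observable :: "('a, 's) asGLSS \<Rightarrow> bool" where
  "observable S \<longleftrightarrow>
    (\<Inter>w. mat_kernel (Cmat S * mat_word (xdim S) (Amat S) w)) = {0\<^sub>v (xdim S)}"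

subsection \<open>Orthogonal projection in the space of square integrable random variables\<close>

definition L2_span :: "('a \<Rightarrow> real) set \<Rightarrow> ('a \<Rightarrow> real) set" where
  "L2_span X = {\<lambda>\<omega>. \<Sum>f\<in>I. c f * f \<omega> | I c. finite I \<and> I \<subseteq> X}"

definition L2_closed_span :: "'a measure \<Rightarrow> ('a \<Rightarrow> real) set \<Rightarrow> ('a \<Rightarrow> real) set" where
  "L2_closed_span M X =
    {f. square_integrable M f \<and>
        (\<forall>e>0. \<exists>g\<in>L2_span X. (\<integral>\<omega>. (f \<omega> - g \<omega>)\<^sup>2 \<partial>M) < e)}"

definition is_L2_projection ::
  "'a measure \<Rightarrow> ('a \<Rightarrow> real) set \<Rightarrow> ('a \<Rightarrow> real) \<Rightarrow> ('a \<Rightarrow> real) \<Rightarrow> bool" where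
  "is_L2_projection M N z q \<longleftrightarrow>
    q \<in> N \<and> (\<forall>g\<in>N. (\<integral>\<omega>. (z \<omega> - q \<omega>) * g \<omega> \<partial>M) = 0)"

text \<open>\<open>is_El M n Z m X Q\<close>: the random vector \<open>Q\<close> is a version of $E_l[Z \mid X]$, where \<open>Z\<close> is
  $n$-dimensional and \<open>X\<close> is a set of $m$-dimensional square integrable random vectors.
  Projections are unique up to almost sure equality only.\<close>

definition is_El ::
  "'a measure \<Rightarrow> nat \<Rightarrow> ('a \<Rightarrow> real vec) \<Rightarrow> nat \<Rightarrow> ('a \<Rightarrow> real vec) set \<Rightarrow> ('a \<Rightarrow> real vec) \<Rightarrow> bool" where
  "is_El M n Z m X Q \<longleftrightarrow>
    (\<forall>\<omega>\<in>space M. Q \<omega> \<in> carrier_vec n) \<and>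
    (\<forall>i<n. is_L2_projection M
       (L2_closed_span M {\<lambda>\<omega>. s \<omega> $ j | s j. s \<in> X \<and> j < m})
       (\<lambda>\<omega>. Z \<omega> $ i) (\<lambda>\<omega>. Q \<omega> $ i))"

definition is_deterministic_component ::
  "'a measure \<Rightarrow> ('a, 's) switching \<Rightarrow> ('s \<Rightarrow> real) \<Rightarrow> nat \<Rightarrow> nat \<Rightarrow>
   'a process \<Rightarrow> 'a process \<Rightarrow> 'a process \<Rightarrow> bool" where
  "is_deterministic_component M mu p ny nu y u yd \<longleftrightarrow>
    (\<forall>t. is_El M ny (y t) nu ({z_proc mu p u w t | w. w \<noteq> []} \<union> {u t}) (yd t))"

end

theory Submission
  imports Defs "Jordan_Normal_Form.Spectral_Radius"
begin

text \<open>
  Write $y = y^d + y^s$ and consider the correlations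
  $\Lambda_{\sigma w} = E[y^s(t)\, z^y_{\sigma w}(t)^T]$. They depend on $y$, $u$ and $\mu$ only, and they
  factor through the state space of every sGLSS of $(y, u, \mu)$: up to the scalar $\sqrt{p_w}$ they equal
  $C A_w H_\sigma$ for a matrix $H_\sigma$ that does not depend on $w$. For the given system $H_\sigma$ is the
  matrix $G_\sigma$ of the reachability condition; for a competitor with matrices $C', A'_\sigma$ it is some
  $H'_\sigma$. Hence $C A_{vw} G_\sigma = C' A'_{vw} H'_\sigma$ for all words, so every vector $g$ in the span
  of the columns of the $A_v G_\sigma$, that is, every vector, has a partner $h$ in the state space of the
  competitor with $C A_w g = C' A'_w h$ for all $w$. Choosing partners of the unit vectors gives a matrix $X$
  with $C A_w = C' A'_w X$ for all $w$. By observability $X$ is injective, and the dimensions compare.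
  This last, purely linear algebraic part is \<open>dim_le_of_common_responses\<close>.

  The factorization has an algebraic and an analytic ingredient. The algebraic one is the recursion
  \<open>ip_Z_snoc\<close>: conditional independence and the conditional moments of the switching process
  allow the last letter to be stripped from both words of a correlation, and correlations of words
  with different last letters vanish. Together with the state equation it yields
  $E[x(t) z^f_{w\sigma}(t)] = \sqrt{p_\sigma} A_\sigma E[x(t-1) z^f_w(t-1)]$ for every component $f$ of state and
  noise and every nonempty $w$ (\<open>corr_snoc\<close>), whence the powers $A_w$.

  The analytic ingredient is stability. Iterating the state equation $N$ times writes the state as a
  finite combination of noise words plus a residual (\<open>state_decomposition\<close>). Multiplied by
  $\mu_q$ for a nonempty word $q$, the residual tends to 0 in mean square (\<open>residual_tendsto_zero\<close>). The
  combination splits into a part driven by the input and a part driven by the remaining noise, and $y^s$ is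
  orthogonal to the former.

  For the competitor only correlations are needed. The stochastic part of its state is never
  constructed; instead the correlations of its finite approximations converge, because they are Cauchy
  (\<open>convergent_ip_innovation\<close>), and $H'_\sigma$ is their limit
  (\<open>output_correlation_factorization\<close>). For the given system the stochastic part comes with a state
  process of its own, whose expansion in the noise agrees with that of the full state up to input terms and
  residuals (\<open>ip_state_eq_ip_stochastic_state\<close>), so that $y$ may be replaced by $y^s$ in the second factor of
  $\Lambda$ and the correlations become $\sqrt{p_w}\, C A_w G_\sigma$.
\<close>

section \<open>Square integrable random variables\<close>

text \<open>
  The inner product of the space of square integrable random variables, as a plain function: functions that
  agree almost surely are not identified, and equations between inner products are transported
  along almost sure equality by \<open>ip_cong_AE\<close>.
\<close>
definition ip :: "'a measure \<Rightarrow> ('a \<Rightarrow> real) \<Rightarrow> ('a \<Rightarrow> real) \<Rightarrow> real" where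
  "ip M f g = (\<integral>\<omega>. f \<omega> * g \<omega> \<partial>M)"

lemma sq_int_measurable [measurable_dest]:
  "square_integrable M f \<Longrightarrow> f \<in> borel_measurable M"
  by (simp add: square_integrable_def)

lemma sq_int_mult:
  assumes "square_integrable M f" "square_integrable M g"
  shows "integrable M (\<lambda>\<omega>. f \<omega> * g \<omega>)"
proof (rule Bochner_Integration.integrable_bound)
  show "integrable M (\<lambda>\<omega>. (f \<omega>)\<^sup>2 + (g \<omega>)\<^sup>2)"
    using assms by (auto simp: square_integrable_def)
  show "(\<lambda>\<omega>. f \<omega> * g \<omega>) \<in> borel_measurable M"
    using assms by (auto simp: square_integrable_def)
  have "\<bar>a * b\<bar> \<le> a\<^sup>2 + b\<^sup>2" for a b :: real
  proof -
    have "2 * (\<bar>a\<bar> * \<bar>b\<bar>) \<le> a\<^sup>2 + b\<^sup>2"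
      using sum_squares_bound[of "\<bar>a\<bar>" "\<bar>b\<bar>"] by (simp add: mult.assoc)
    moreover have "0 \<le> \<bar>a\<bar> * \<bar>b\<bar>" by simp
    ultimately show ?thesis unfolding abs_mult by linarith
  qed
  then show "AE \<omega> in M. norm (f \<omega> * g \<omega>) \<le> norm ((f \<omega>)\<^sup>2 + (g \<omega>)\<^sup>2)" by simp
qed

lemma sq_int_cmult:
  "square_integrable M f \<Longrightarrow> square_integrable M (\<lambda>\<omega>. c * f \<omega>)"
  by (auto simp: square_integrable_def power_mult_distrib)

lemma sq_int_add:
  assumes "square_integrable M f" "square_integrable M g"
  shows "square_integrable M (\<lambda>\<omega>. f \<omega> + g \<omega>)"
proof -
  have "(\<lambda>\<omega>. (f \<omega> + g \<omega>)\<^sup>2) = (\<lambda>\<omega>. (f \<omega>)\<^sup>2 + (g \<omega>)\<^sup>2 + 2 * (f \<omega> * g \<omega>))"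
    by (auto simp: power2_sum mult.assoc)
  then show ?thesis
    using assms sq_int_mult[OF assms] by (auto simp: square_integrable_def)
qed

lemma sq_int_zero [simp]: "square_integrable M (\<lambda>\<omega>. 0)"
  by (auto simp: square_integrable_def)

lemma sq_int_sum:
  assumes "\<And>i. i \<in> I \<Longrightarrow> square_integrable M (F i)"
  shows "square_integrable M (\<lambda>\<omega>. \<Sum>i\<in>I. F i \<omega>)"
  using assms
  by (induction I rule: infinite_finite_induct) (auto intro!: sq_int_add)

lemma sq_int_diff:
  assumes "square_integrable M f" "square_integrable M g"
  shows "square_integrable M (\<lambda>\<omega>. f \<omega> - g \<omega>)"
  using sq_int_add[OF assms(1) sq_int_cmult[OF assms(2), of "-1"]] by simp

lemma sq_int_lincomb:
  assumes "\<And>i. i \<in> I \<Longrightarrow> square_integrable M (F i)"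
  shows "square_integrable M (\<lambda>\<omega>. \<Sum>i\<in>I. c i * F i \<omega>)"
  by (intro sq_int_sum sq_int_cmult assms)

lemma sq_int_cong_AE:
  assumes "square_integrable M f" "AE \<omega> in M. g \<omega> = f \<omega>" "g \<in> borel_measurable M"
  shows "square_integrable M g"
proof -
  have "integrable M (\<lambda>\<omega>. (f \<omega>)\<^sup>2)" using assms(1) by (simp add: square_integrable_def)
  then have "integrable M (\<lambda>\<omega>. (g \<omega>)\<^sup>2)"
    by (rule integrable_cong_AE_imp) (use assms in auto)
  then show ?thesis using assms by (simp add: square_integrable_def)
qed

lemma sq_int_cong:
  assumes "\<And>\<omega>. \<omega> \<in> space M \<Longrightarrow> f \<omega> = g \<omega>"
  shows "square_integrable M f \<longleftrightarrow> square_integrable M g"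
  unfolding square_integrable_def
  using assms
  by (intro conj_cong measurable_cong Bochner_Integration.integrable_cong) auto

lemma ip_cong:
  assumes "\<And>\<omega>. \<omega> \<in> space M \<Longrightarrow> f \<omega> = f' \<omega>" "\<And>\<omega>. \<omega> \<in> space M \<Longrightarrow> g \<omega> = g' \<omega>"
  shows "ip M f g = ip M f' g'"
  unfolding ip_def by (rule Bochner_Integration.integral_cong) (auto simp: assms)

lemma ip_commute: "ip M f g = ip M g f"
  by (simp add: ip_def mult.commute)

lemma ip_cong_AE:
  assumes "AE \<omega> in M. f \<omega> = f' \<omega>" "AE \<omega> in M. g \<omega> = g' \<omega>"
    "f \<in> borel_measurable M" "f' \<in> borel_measurable M"
    "g \<in> borel_measurable M" "g' \<in> borel_measurable M"
  shows "ip M f g = ip M f' g'"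
  unfolding ip_def by (rule integral_cong_AE) (use assms in auto)

lemma ip_zero_right [simp]: "ip M g (\<lambda>\<omega>. 0) = 0"
  by (simp add: ip_def)

lemma ip_AE_zero_right: "AE \<omega> in M. g \<omega> = 0 \<Longrightarrow> ip M f g = 0"
  unfolding ip_def by (rule integral_eq_zero_AE) auto

lemma ip_cmult_left: "ip M (\<lambda>\<omega>. c * f \<omega>) g = c * ip M f g"
  unfolding ip_def by (simp add: mult.assoc)

lemma ip_cmult_right: "ip M g (\<lambda>\<omega>. c * f \<omega>) = c * ip M g f"
  using ip_cmult_left[of M c f g] by (simp add: ip_commute)

lemma ip_add_left:
  assumes "square_integrable M f" "square_integrable M f'" "square_integrable M g"
  shows "ip M (\<lambda>\<omega>. f \<omega> + f' \<omega>) g = ip M f g + ip M f' g"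
  unfolding ip_def distrib_right
  by (rule Bochner_Integration.integral_add; rule sq_int_mult; rule assms)

lemma ip_add_right:
  assumes "square_integrable M f" "square_integrable M f'" "square_integrable M g"
  shows "ip M g (\<lambda>\<omega>. f \<omega> + f' \<omega>) = ip M g f + ip M g f'"
  using ip_add_left[OF assms] by (simp add: ip_commute)

lemma ip_diff_left:
  assumes "square_integrable M f" "square_integrable M f'" "square_integrable M g"
  shows "ip M (\<lambda>\<omega>. f \<omega> - f' \<omega>) g = ip M f g - ip M f' g"
  unfolding ip_def left_diff_distrib
  by (rule Bochner_Integration.integral_diff; rule sq_int_mult; rule assms)

lemma ip_diff_right:
  assumes "square_integrable M f" "square_integrable M f'" "square_integrable M g"
  shows "ip M g (\<lambda>\<omega>. f \<omega> - f' \<omega>) = ip M g f - ip M g f'"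
  using ip_diff_left[OF assms] by (simp add: ip_commute)

lemma ip_sum_left:
  assumes "\<And>i. i \<in> I \<Longrightarrow> square_integrable M (F i)" "square_integrable M g"
  shows "ip M (\<lambda>\<omega>. \<Sum>i\<in>I. F i \<omega>) g = (\<Sum>i\<in>I. ip M (F i) g)"
  unfolding ip_def sum_distrib_right
  by (rule Bochner_Integration.integral_sum) (use assms sq_int_mult in blast)

lemma ip_lincomb_left:
  assumes "\<And>i. i \<in> I \<Longrightarrow> square_integrable M (F i)" "square_integrable M g"
  shows "ip M (\<lambda>\<omega>. \<Sum>i\<in>I. c i * F i \<omega>) g = (\<Sum>i\<in>I. c i * ip M (F i) g)"
  by (subst ip_sum_left) (auto intro!: sq_int_cmult assms simp: ip_cmult_left)

lemma ip_lincomb_right: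
  assumes "\<And>i. i \<in> I \<Longrightarrow> square_integrable M (F i)" "square_integrable M g"
  shows "ip M g (\<lambda>\<omega>. \<Sum>i\<in>I. c i * F i \<omega>) = (\<Sum>i\<in>I. c i * ip M g (F i))"
  using ip_lincomb_left[OF assms] by (simp add: ip_commute)

lemma ip_lincomb2:
  assumes "\<And>i. i \<in> I \<Longrightarrow> square_integrable M (F i)" "\<And>j. j \<in> J \<Longrightarrow> square_integrable M (G j)"
  shows "ip M (\<lambda>\<omega>. \<Sum>i\<in>I. c i * F i \<omega>) (\<lambda>\<omega>. \<Sum>j\<in>J. d j * G j \<omega>) =
    (\<Sum>i\<in>I. \<Sum>j\<in>J. c i * d j * ip M (F i) (G j))"
proof -
  have "ip M (\<lambda>\<omega>. \<Sum>i\<in>I. c i * F i \<omega>) (\<lambda>\<omega>. \<Sum>j\<in>J. d j * G j \<omega>) =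
    (\<Sum>i\<in>I. c i * ip M (F i) (\<lambda>\<omega>. \<Sum>j\<in>J. d j * G j \<omega>))"
    by (rule ip_lincomb_left) (auto intro!: sq_int_lincomb assms)
  also have "\<dots> = (\<Sum>i\<in>I. c i * (\<Sum>j\<in>J. d j * ip M (F i) (G j)))"
    by (intro sum.cong refl arg_cong[of _ _ "(*) _"] ip_lincomb_right assms)
  finally show ?thesis by (simp add: sum_distrib_left mult.assoc)
qed

lemma ip_nonneg: "0 \<le> ip M f f"
  unfolding ip_def by (rule Bochner_Integration.integral_nonneg) simp

lemma ip_Cauchy_Schwarz:
  assumes f: "square_integrable M f" and g: "square_integrable M g"
  shows "\<bar>ip M f g\<bar> \<le> sqrt (ip M f f) * sqrt (ip M g g)"
proof (cases "ip M g g = 0")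
  case True
  have "AE \<omega> in M. g \<omega> * g \<omega> = 0"
    using True sq_int_mult[OF g g]
    unfolding ip_def by (subst (asm) integral_nonneg_eq_0_iff_AE) auto
  then have "ip M f g = 0" by (intro ip_AE_zero_right) auto
  then show ?thesis by (simp add: ip_nonneg)
next
  case False
  then have pos: "0 < ip M g g" using ip_nonneg[of M g] by simp
  define c where "c = ip M f g / ip M g g"
  have cg: "square_integrable M (\<lambda>\<omega>. c * g \<omega>)" by (rule sq_int_cmult[OF g])
  have "0 \<le> ip M (\<lambda>\<omega>. f \<omega> - c * g \<omega>) (\<lambda>\<omega>. f \<omega> - c * g \<omega>)" by (rule ip_nonneg)
  also have "\<dots> = ip M f f - 2 * c * ip M f g + c\<^sup>2 * ip M g g"
    using f g cg
    by (simp add: ip_diff_left ip_diff_right sq_int_diff ip_cmult_left ip_cmult_right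
        ip_commute[of M g f] power2_eq_square algebra_simps)
  also have "\<dots> = ip M f f - (ip M f g)\<^sup>2 / ip M g g"
    using False by (simp add: c_def power2_eq_square field_simps)
  finally have "(ip M f g)\<^sup>2 \<le> ip M f f * ip M g g"
    using pos by (simp add: field_simps)
  then have "sqrt ((ip M f g)\<^sup>2) \<le> sqrt (ip M f f * ip M g g)" by (rule real_sqrt_le_mono)
  then show ?thesis by (simp add: real_sqrt_mult)
qed

lemma in_L2_closed_span:
  assumes "f \<in> G" "square_integrable M f"
  shows "f \<in> L2_closed_span M G"
proof -
  have "f = (\<lambda>\<omega>. \<Sum>g\<in>{f}. 1 * g \<omega>)" by simp
  then have "f \<in> L2_span G"
    unfolding L2_span_def using assms(1) by (intro CollectI exI[of _ "{f}"] exI[of _ "\<lambda>_. 1"]) simp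
  then show ?thesis
    unfolding L2_closed_span_def using assms(2) by (auto intro!: bexI[of _ f])
qed

lemma L2_span_orthogonal:
  assumes "\<And>g. g \<in> G \<Longrightarrow> square_integrable M g" "\<And>g. g \<in> G \<Longrightarrow> ip M g h = 0"
    and h: "square_integrable M h" and f: "f \<in> L2_span G"
  shows "square_integrable M f" "ip M f h = 0"
proof -
  obtain I c where f: "f = (\<lambda>\<omega>. \<Sum>g\<in>I. c g * g \<omega>)" "finite I" "I \<subseteq> G"
    using f unfolding L2_span_def by blast
  show "square_integrable M f" unfolding f(1)
    by (rule sq_int_lincomb[where F = "\<lambda>g. g"]) (use assms f in auto)
  have "ip M f h = (\<Sum>g\<in>I. c g * ip M g h)" unfolding f(1)
    by (rule ip_lincomb_left[where F = "\<lambda>g. g"]) (use assms f in auto)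
  then show "ip M f h = 0" using assms f by (auto intro!: sum.neutral)
qed

text \<open>
  The inner product with \<open>h\<close> is continuous, so a value $c \neq 0$ at \<open>f\<close> contradicts the existence of an
  element \<open>g\<close> of the span with $\|f - g\|^2 < c^2 / (\|h\|^2 + 1)$.
\<close>
lemma L2_closed_span_orthogonal:
  assumes G: "\<And>g. g \<in> G \<Longrightarrow> square_integrable M g" "\<And>g. g \<in> G \<Longrightarrow> ip M g h = 0"
    and h: "square_integrable M h" and f: "f \<in> L2_closed_span M G"
  shows "ip M f h = 0"
proof (rule ccontr)
  assume ne: "ip M f h \<noteq> 0"
  have sqf: "square_integrable M f" using f by (simp add: L2_closed_span_def)
  define \<epsilon> where "\<epsilon> = (ip M f h)\<^sup>2 / (ip M h h + 1)"
  have pos: "0 < ip M h h + 1" using ip_nonneg[of M h] by simp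
  then have "0 < \<epsilon>" using ne by (simp add: \<epsilon>_def)
  then obtain g where g: "g \<in> L2_span G" "(\<integral>\<omega>. (f \<omega> - g \<omega>)\<^sup>2 \<partial>M) < \<epsilon>"
    using f unfolding L2_closed_span_def by blast
  note g' = L2_span_orthogonal[OF G h g(1)]
  have sqd: "square_integrable M (\<lambda>\<omega>. f \<omega> - g \<omega>)" by (intro sq_int_diff sqf g')
  have "ip M f h = ip M (\<lambda>\<omega>. f \<omega> - g \<omega>) h" using ip_diff_left[OF sqf g'(1) h] g'(2) by simp
  then have "\<bar>ip M f h\<bar> \<le> sqrt (ip M (\<lambda>\<omega>. f \<omega> - g \<omega>) (\<lambda>\<omega>. f \<omega> - g \<omega>)) * sqrt (ip M h h)"
    using ip_Cauchy_Schwarz[OF sqd h] by simp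
  then have "\<bar>ip M f h\<bar>\<^sup>2 \<le> (sqrt (ip M (\<lambda>\<omega>. f \<omega> - g \<omega>) (\<lambda>\<omega>. f \<omega> - g \<omega>)) * sqrt (ip M h h))\<^sup>2"
    by (rule power_mono) simp
  then have le: "(ip M f h)\<^sup>2 \<le> ip M (\<lambda>\<omega>. f \<omega> - g \<omega>) (\<lambda>\<omega>. f \<omega> - g \<omega>) * ip M h h"
    by (simp add: power_mult_distrib ip_nonneg)
  have "ip M (\<lambda>\<omega>. f \<omega> - g \<omega>) (\<lambda>\<omega>. f \<omega> - g \<omega>) < \<epsilon>"
    using g(2) by (simp add: ip_def power2_eq_square)
  then have "ip M (\<lambda>\<omega>. f \<omega> - g \<omega>) (\<lambda>\<omega>. f \<omega> - g \<omega>) * ip M h h \<le> \<epsilon> * ip M h h"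
    by (intro mult_right_mono ip_nonneg) simp
  also have "\<dots> < \<epsilon> * (ip M h h + 1)" using \<open>0 < \<epsilon>\<close> by simp
  also have "\<dots> = (ip M f h)\<^sup>2" using pos by (simp add: \<epsilon>_def)
  finally show False using le by simp
qed

section \<open>Conditional independence\<close>

text \<open>
  The hypothesis says that the conditional expectation of \<open>\<phi>\<close> given \<open>G\<close> vanishes. Stating the conclusion
  for all \<open>h\<close> with integrable product, not only for bounded ones, saves all later truncation arguments.
\<close>
lemma (in prob_space) orthogonal_to_indicators_imp_orthogonal:
  assumes sub: "subalgebra M G" and phi: "integrable M \<phi>"
    and ind: "\<And>B. B \<in> sets G \<Longrightarrow> (\<integral>x. indicat_real B x * \<phi> x \<partial>M) = 0"
    and h: "h \<in> borel_measurable G" and hphi: "integrable M (\<lambda>x. h x * \<phi> x)"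
  shows "(\<integral>x. h x * \<phi> x \<partial>M) = 0"
proof -
  interpret G: finite_measure_subalgebra M G by unfold_locales (rule sub)
  have "AE x in M. real_cond_exp M G \<phi> x = 0"
    by (rule G.real_cond_exp_charact) (auto simp: set_lebesgue_integral_def ind phi)
  then have "(\<integral>x. h x * real_cond_exp M G \<phi> x \<partial>M) = 0"
    by (intro integral_eq_zero_AE) auto
  then show ?thesis
    using G.real_cond_exp_intg(2)[OF hphi h] phi by auto
qed

text \<open>
  Conditional independence speaks of indicators only. With $a = P(A \mid H)$ it says that
  $1_C (1_A - a)$ is orthogonal to the indicators of \<open>G\<close>, hence to \<open>h\<close>; then \<open>h\<close> may be replaced by its
  conditional expectation, because the factor $1_C a$ is measurable with respect to \<open>H\<close>.
\<close>
lemma (in prob_space) cond_indep_integral_indicator: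
  assumes sub: "subalgebra M F" "subalgebra M G" "subalgebra M H"
    and ci: "cond_indep M F G H"
    and h: "h \<in> borel_measurable G" "integrable M h"
    and A: "A \<in> sets F" and C: "C \<in> sets H"
  shows "(\<integral>x. indicat_real (A \<inter> C) x * h x \<partial>M) =
    (\<integral>x. indicat_real (A \<inter> C) x * real_cond_exp M H h x \<partial>M)"
proof -
  interpret H: finite_measure_subalgebra M H by unfold_locales (rule sub)
  have [measurable]: "A \<in> sets M" "C \<in> sets M" "C \<in> sets H" "h \<in> borel_measurable M"
    using A C sub h(1) measurable_from_subalg[OF sub(2) h(1)] unfolding subalgebra_def by auto
  define a where "a = real_cond_exp M H (indicat_real A)"
  have [measurable]: "a \<in> borel_measurable H" "a \<in> borel_measurable M"
    unfolding a_def by (rule borel_measurable_cond_exp borel_measurable_cond_exp2)+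
  have intA: "integrable M (indicat_real D)" if "D \<in> sets M" for D
    using that by (simp add: integrable_indicator_iff less_top[symmetric])
  have bounds: "AE x in M. 0 \<le> a x" "AE x in M. a x \<le> 1"
    unfolding a_def by (auto intro!: H.real_cond_exp_ge_c H.real_cond_exp_le_c intA)
  define \<phi> where "\<phi> x = indicat_real C x * (indicat_real A x - a x)" for x
  have [measurable]: "\<phi> \<in> borel_measurable M" unfolding \<phi>_def by measurable
  have bphi: "AE x in M. \<bar>\<phi> x\<bar> \<le> 1"
    using bounds by eventually_elim (auto simp: \<phi>_def indicator_def)
  have intphi: "integrable M \<phi>" by (rule integrable_const_bound[OF _ \<open>\<phi> \<in> _\<close>]) (use bphi in auto)
  have intmult: "integrable M (\<lambda>x. b x * f x)"
    if "integrable M f" "AE x in M. \<bar>b x\<bar> \<le> 1" "b \<in> borel_measurable M" for b f :: "'a \<Rightarrow> real"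
  proof (rule Bochner_Integration.integrable_bound[OF that(1)])
    show "(\<lambda>x. b x * f x) \<in> borel_measurable M" using that by auto
    show "AE x in M. norm (b x * f x) \<le> norm (f x)"
      using that(2) by eventually_elim (simp add: abs_mult mult_left_le_one_le)
  qed
  have inth: "integrable M (\<lambda>x. h x * \<phi> x)"
    using intmult[OF h(2) bphi] by (simp add: mult.commute)
  have "AE x in M. \<bar>indicat_real C x * a x\<bar> \<le> 1"
    using bounds by eventually_elim (auto simp: indicator_def)
  then have intCa: "integrable M (\<lambda>x. (indicat_real C x * a x) * f x)"
    if "integrable M f" for f
    using intmult[OF that] by simp
  have intAC: "integrable M (\<lambda>x. indicat_real (A \<inter> C) x * f x)"
    if "integrable M f" for f :: "'a \<Rightarrow> real"
    using that by (intro intmult) auto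
  have ind: "(\<integral>x. indicat_real B x * \<phi> x \<partial>M) = 0" if B: "B \<in> sets G" for B
  proof -
    have [measurable]: "B \<in> sets M" using B sub unfolding subalgebra_def by auto
    have "(\<integral>x. indicat_real C x * indicat_real (A \<inter> B) x \<partial>M) =
        (\<integral>x. indicat_real C x * real_cond_exp M H (indicat_real (A \<inter> B)) x \<partial>M)"
      by (rule H.real_cond_exp_intg(2)[symmetric])
         (auto intro!: intmult intA)
    also have "\<dots> = (\<integral>x. (indicat_real C x * a x) * real_cond_exp M H (indicat_real B) x \<partial>M)"
    proof (rule integral_cong_AE)
      have "AE x in M. real_cond_exp M H (indicat_real (A \<inter> B)) x =
          a x * real_cond_exp M H (indicat_real B) x"
        using ci A B unfolding cond_indep_def a_def by blast
      then show "AE x in M. indicat_real C x * real_cond_exp M H (indicat_real (A \<inter> B)) x =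
          (indicat_real C x * a x) * real_cond_exp M H (indicat_real B) x"
        by eventually_elim simp
    qed auto
    also have "\<dots> = (\<integral>x. (indicat_real C x * a x) * indicat_real B x \<partial>M)"
      by (rule H.real_cond_exp_intg(2)) (auto intro!: intCa intA)
    finally have eq: "(\<integral>x. indicat_real C x * indicat_real (A \<inter> B) x \<partial>M) =
        (\<integral>x. (indicat_real C x * a x) * indicat_real B x \<partial>M)" .
    have "(\<integral>x. indicat_real B x * \<phi> x \<partial>M) =
      (\<integral>x. indicat_real C x * indicat_real (A \<inter> B) x -
        (indicat_real C x * a x) * indicat_real B x \<partial>M)"
      by (rule Bochner_Integration.integral_cong) (auto simp: \<phi>_def indicator_def right_diff_distrib algebra_simps)
    also have "\<dots> = 0"
      by (subst Bochner_Integration.integral_diff)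
         (auto intro!: intCa intmult intA simp: eq)
    finally show ?thesis .
  qed
  have "(\<integral>x. h x * \<phi> x \<partial>M) = 0"
    by (rule orthogonal_to_indicators_imp_orthogonal[OF sub(2) intphi ind h(1) inth])
  moreover have "(\<integral>x. h x * \<phi> x \<partial>M) =
     (\<integral>x. indicat_real (A \<inter> C) x * h x - (indicat_real C x * a x) * h x \<partial>M)"
    by (rule Bochner_Integration.integral_cong) (auto simp: \<phi>_def indicator_def right_diff_distrib algebra_simps)
  ultimately have "(\<integral>x. indicat_real (A \<inter> C) x * h x \<partial>M) = (\<integral>x. (indicat_real C x * a x) * h x \<partial>M)"
    using intAC[OF h(2)] intCa[OF h(2)] by simp
  also have "\<dots> = (\<integral>x. (indicat_real C x * a x) * real_cond_exp M H h x \<partial>M)"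
    by (rule H.real_cond_exp_intg(2)[symmetric]) (auto intro!: intCa h)
  also have "\<dots> = (\<integral>x. (indicat_real C x * real_cond_exp M H h x) * a x \<partial>M)"
    by (simp add: ac_simps)
  also have "\<dots> = (\<integral>x. (indicat_real C x * real_cond_exp M H h x) * indicat_real A x \<partial>M)"
    unfolding a_def
    using intAC[OF H.real_cond_exp_int(1)[OF h(2)]]
    by (intro H.real_cond_exp_intg(2)) (auto simp: indicator_inter_arith ac_simps)
  also have "\<dots> = (\<integral>x. indicat_real (A \<inter> C) x * real_cond_exp M H h x \<partial>M)"
    by (rule Bochner_Integration.integral_cong) (auto simp: indicator_def)
  finally show ?thesis .
qed

text \<open>
  The join of the two \<open>\<sigma>\<close>-algebras, generated by a set system that is closed under
  intersection.
\<close>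
definition joint_sigma :: "'a measure \<Rightarrow> 'a measure \<Rightarrow> 'a measure \<Rightarrow> 'a measure" where
  "joint_sigma M F H = sigma (space M) {A \<inter> C | A C. A \<in> sets F \<and> C \<in> sets H}"

lemma joint_sigma:
  assumes "subalgebra M F" "subalgebra M H"
  shows subalgebra_joint_sigma: "subalgebra M (joint_sigma M F H)"
    and subalgebra_joint_sigma_left: "subalgebra (joint_sigma M F H) F"
    and subalgebra_joint_sigma_right: "subalgebra (joint_sigma M F H) H"
proof -
  have sp: "space F = space M" "space H = space M" "sets F \<subseteq> sets M" "sets H \<subseteq> sets M"
    using assms by (auto simp: subalgebra_def)
  have sub: "{A \<inter> C | A C. A \<in> sets F \<and> C \<in> sets H} \<subseteq> sets M"
    using sp by blast
  then have sub': "{A \<inter> C | A C. A \<in> sets F \<and> C \<in> sets H} \<subseteq> Pow (space M)"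
    using sets.space_closed by blast
  have s: "sets (joint_sigma M F H) = sigma_sets (space M) {A \<inter> C | A C. A \<in> sets F \<and> C \<in> sets H}"
    "space (joint_sigma M F H) = space M"
    unfolding joint_sigma_def using sub' by (auto simp: sets_measure_of space_measure_of)
  show "subalgebra M (joint_sigma M F H)"
    unfolding subalgebra_def s using sets.sigma_sets_subset[OF sub] by simp
  have "A \<in> sigma_sets (space M) {A \<inter> C | A C. A \<in> sets F \<and> C \<in> sets H}" if "A \<in> sets F" for A
  proof -
    have "A = A \<inter> space M" using that sp sets.sets_into_space by fastforce
    moreover have "space M \<in> sets H" using sp by (metis sets.top)
    ultimately show ?thesis using that by (intro sigma_sets.Basic) auto
  qed
  then show "subalgebra (joint_sigma M F H) F" unfolding subalgebra_def s sp by auto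
  have "A \<in> sigma_sets (space M) {A \<inter> C | A C. A \<in> sets F \<and> C \<in> sets H}" if "A \<in> sets H" for A
  proof -
    have "A = space M \<inter> A" using that sp sets.sets_into_space by fastforce
    moreover have "space M \<in> sets F" using sp by (metis sets.top)
    ultimately show ?thesis using that by (intro sigma_sets.Basic) blast
  qed
  then show "subalgebra (joint_sigma M F H) H" unfolding subalgebra_def s sp by auto
qed

text \<open>
  In other words $E[h \mid F \vee H] = E[h \mid H]$. The indicator case extends from the generating sets to
  the join by Dynkin's theorem, and from there to all integrable products.
\<close>
lemma (in prob_space) cond_indep_integral:
  assumes sub: "subalgebra M F" "subalgebra M G" "subalgebra M H"
    and ci: "cond_indep M F G H"
    and h: "h \<in> borel_measurable G" "integrable M h"
    and Y: "Y \<in> borel_measurable (joint_sigma M F H)"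
    and Yh: "integrable M (\<lambda>x. Y x * h x)"
    and YEh: "integrable M (\<lambda>x. Y x * real_cond_exp M H h x)"
  shows "(\<integral>x. Y x * h x \<partial>M) = (\<integral>x. Y x * real_cond_exp M H h x \<partial>M)"
proof -
  interpret H: finite_measure_subalgebra M H by unfold_locales (rule sub)
  note [simp] = H.real_cond_exp_int(1)[OF h(2)]
  define \<psi> where "\<psi> x = h x - real_cond_exp M H h x" for x
  have intpsi: "integrable M \<psi>" unfolding \<psi>_def using h by simp
  let ?I = "{A \<inter> C | A C. A \<in> sets F \<and> C \<in> sets H}"
  have sp: "sets F \<subseteq> sets M" "sets H \<subseteq> sets M" "space F = space M" "space H = space M"
    using sub by (auto simp: subalgebra_def)
  have Isub: "?I \<subseteq> sets M" using sp by blast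
  have Ipow: "?I \<subseteq> Pow (space M)" using Isub sets.space_closed by blast
  have intind: "integrable M (\<lambda>x. indicat_real D x * f x)"
    if "D \<in> sets M" "integrable M f" for D and f :: "'a \<Rightarrow> real"
    using integrable_real_mult_indicator[OF that] by (simp add: mult.commute)
  have base: "(\<integral>x. indicat_real D x * \<psi> x \<partial>M) = 0" if "D \<in> ?I" for D
  proof -
    from that obtain A C where D: "D = A \<inter> C" "A \<in> sets F" "C \<in> sets H" by auto
    have [simp]: "D \<in> sets M" using that Isub by auto
    show ?thesis
      using cond_indep_integral_indicator[OF sub ci h D(2,3)] D(1)[symmetric]
      by (simp add: \<psi>_def right_diff_distrib intind h)
  qed
  have all: "(\<integral>x. indicat_real D x * \<psi> x \<partial>M) = 0" if "D \<in> sigma_sets (space M) ?I" for D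
  proof -
    have "Int_stable ?I"
    proof (rule Int_stableI)
      fix a b assume "a \<in> ?I" "b \<in> ?I"
      then obtain A C A' C' where "a = A \<inter> C" "b = A' \<inter> C'" "A \<in> sets F" "C \<in> sets H"
        "A' \<in> sets F" "C' \<in> sets H" by blast
      then have "a \<inter> b = (A \<inter> A') \<inter> (C \<inter> C')" "A \<inter> A' \<in> sets F" "C \<inter> C' \<in> sets H" by auto
      then show "a \<inter> b \<in> ?I" by blast
    qed
    from this Ipow that show ?thesis
    proof (induction rule: sigma_sets_induct_disjoint)
      case (basic A) then show ?case by (rule base)
    next
      case empty then show ?case by simp
    next
      case (compl A)
      have A: "A \<in> sets M" using compl(1) sets.sigma_sets_subset[OF Isub] by auto
      have "space M \<in> ?I"
      proof -
        have "space M = space F \<inter> space H" using sp by simp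
        then show ?thesis by blast
      qed
      then have "(\<integral>x. indicat_real (space M) x * \<psi> x \<partial>M) = 0" by (rule base)
      moreover have "(\<integral>x. indicat_real (space M - A) x * \<psi> x \<partial>M) =
        (\<integral>x. indicat_real (space M) x * \<psi> x - indicat_real A x * \<psi> x \<partial>M)"
        by (rule Bochner_Integration.integral_cong) (auto simp: indicator_def)
      ultimately show ?case
        using compl(2) A intpsi by (simp add: intind)
    next
      case (union A)
      have A: "A i \<in> sets M" for i using union(2) sets.sigma_sets_subset[OF Isub] by auto
      have "(\<integral>x\<in>(\<Union>i. A i). \<psi> x \<partial>M) = (\<Sum>i. (\<integral>x\<in>A i. \<psi> x \<partial>M))"
        using A union(1) intpsi
        by (intro lebesgue_integral_countable_add)
           (auto simp: disjoint_family_on_def set_integrable_def intro!: intind)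
      also have "\<dots> = 0" using union(3) by (simp add: set_lebesgue_integral_def)
      finally show ?case by (simp add: set_lebesgue_integral_def)
    qed
  qed
  have "(\<integral>x. Y x * \<psi> x \<partial>M) = 0"
  proof (rule orthogonal_to_indicators_imp_orthogonal[OF _ intpsi _ Y])
    show "subalgebra M (joint_sigma M F H)" by (rule subalgebra_joint_sigma[OF sub(1,3)])
    show "integrable M (\<lambda>x. Y x * \<psi> x)"
      using Yh YEh by (simp add: \<psi>_def right_diff_distrib)
    fix B assume "B \<in> sets (joint_sigma M F H)"
    then show "(\<integral>x. indicat_real B x * \<psi> x \<partial>M) = 0"
      using all Ipow by (simp add: joint_sigma_def)
  qed
  then show ?thesis using Yh YEh by (simp add: \<psi>_def right_diff_distrib)
qed

section \<open>Words and moments under admissible switching\<close>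

lemma mu_word_Nil [simp]: "mu_word mu [] t \<omega> = 1"
  by (simp add: mu_word_def)

lemma mu_word_snoc: "mu_word mu (w @ [\<sigma>]) t \<omega> = mu_word mu w (t - 1) \<omega> * mu \<sigma> t \<omega>"
proof -
  have "(\<Prod>i<length w. mu ((w @ [\<sigma>]) ! i) (t - int (length (w @ [\<sigma>])) + 1 + int i) \<omega>) =
      (\<Prod>i<length w. mu (w ! i) (t - 1 - int (length w) + 1 + int i) \<omega>)"
    by (rule prod.cong) (auto simp: nth_append algebra_simps)
  then show ?thesis by (simp add: mu_word_def)
qed

lemma mu_word_Cons: "mu_word mu (\<sigma> # w) t \<omega> = mu \<sigma> (t - int (length w)) \<omega> * mu_word mu w t \<omega>"
  by (simp add: mu_word_def prod.lessThan_Suc_shift algebra_simps del: prod.lessThan_Suc)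

lemma mu_word_singleton [simp]: "mu_word mu [\<sigma>] t \<omega> = mu \<sigma> t \<omega>"
  by (simp add: mu_word_Cons)

lemma p_word_simps [simp]: "p_word p [] = 1" "p_word p (\<sigma> # w) = p \<sigma> * p_word p w"
  "p_word p (w @ v) = p_word p w * p_word p v"
  by (simp_all add: p_word_def)

lemma admissible_words_singleton [simp]: "[\<sigma>] \<in> admissible_words E"
  by (simp add: admissible_words_def)

lemma admissible_words_snoc:
  "w @ [\<sigma>] \<in> admissible_words E \<longleftrightarrow> w = [] \<or> w \<in> admissible_words E \<and> (last w, \<sigma>) \<in> E"
  by (auto simp: admissible_words_def successively_append_iff)

lemma gen_sigma:
  assumes "\<And>f. f \<in> X \<Longrightarrow> f \<in> borel_measurable M"
  shows subalgebra_gen_sigma: "subalgebra M (gen_sigma M X)"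
    and measurable_gen_sigma: "f \<in> X \<Longrightarrow> f \<in> borel_measurable (gen_sigma M X)"
proof -
  let ?G = "{f -` B \<inter> space M | f B. f \<in> X \<and> B \<in> sets borel}"
  have G: "?G \<subseteq> sets M" using assms by (auto intro: measurable_sets)
  then have Gp: "?G \<subseteq> Pow (space M)" using sets.space_closed by blast
  have s: "sets (gen_sigma M X) = sigma_sets (space M) ?G" "space (gen_sigma M X) = space M"
    unfolding gen_sigma_def using Gp by (auto simp: sets_measure_of space_measure_of)
  show "subalgebra M (gen_sigma M X)"
    unfolding subalgebra_def s using sets.sigma_sets_subset[OF G] by simp
  show "f \<in> borel_measurable (gen_sigma M X)" if "f \<in> X"
    by (rule measurableI) (use that in \<open>auto simp: s intro!: sigma_sets.Basic\<close>)
qed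

lemma gen_sigma_mono:
  assumes "\<And>f. f \<in> X \<Longrightarrow> \<exists>g\<in>Y. \<forall>\<omega>\<in>space M. f \<omega> = g \<omega>"
  shows "sets (gen_sigma M X) \<subseteq> sets (gen_sigma M Y)"
proof -
  have "{f -` B \<inter> space M | f B. f \<in> X \<and> B \<in> sets borel} \<subseteq>
      {f -` B \<inter> space M | f B. f \<in> Y \<and> B \<in> sets borel}"
  proof
    fix A assume "A \<in> {f -` B \<inter> space M | f B. f \<in> X \<and> B \<in> sets borel}"
    then obtain f B where A: "A = f -` B \<inter> space M" "f \<in> X" "B \<in> sets borel" by blast
    obtain g where g: "g \<in> Y" "\<forall>\<omega>\<in>space M. f \<omega> = g \<omega>" using assms[OF A(2)] by blast
    have "A = g -` B \<inter> space M" using A g by auto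
    then show "A \<in> {f -` B \<inter> space M | f B. f \<in> Y \<and> B \<in> sets borel}" using g A by blast
  qed
  moreover have "{f -` B \<inter> space M | f B. f \<in> Z \<and> B \<in> sets borel} \<subseteq> Pow (space M)"
    for Z :: "('a \<Rightarrow> real) set" by auto
  ultimately show ?thesis
    unfolding gen_sigma_def by (simp add: sets_measure_of sigma_sets_mono')
qed

text \<open>
  The scalar version of \<^const>\<open>z_proc\<close>. For the empty word it is the process itself, so that statements about
  words cover both a process and its products with the switching words.
\<close>
definition zs ::
  "('a, 's) switching \<Rightarrow> ('s \<Rightarrow> real) \<Rightarrow> (int \<Rightarrow> 'a \<Rightarrow> real) \<Rightarrow> 's list \<Rightarrow> int \<Rightarrow> 'a \<Rightarrow> real" where
  "zs mu p f w t \<omega> = mu_word mu w (t - 1) \<omega> / sqrt (p_word p w) * f (t - int (length w)) \<omega>"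

lemma zs_Nil [simp]: "zs mu p f [] t = f t"
  by (auto simp: zs_def)

lemma zs_measurable:
  assumes "\<And>\<sigma> t. mu \<sigma> t \<in> borel_measurable M" "\<And>t. f t \<in> borel_measurable M"
  shows "zs mu p f w t \<in> borel_measurable M"
  unfolding zs_def[abs_def] mu_word_def
  by (intro borel_measurable_times borel_measurable_divide borel_measurable_prod borel_measurable_const assms)

locale switching = prob_space M for M :: "'a measure" +
  fixes mu :: "('a, 's::finite) switching" and E :: "('s \<times> 's) set" and p :: "'s \<Rightarrow> real"
  assumes adm: "admissible_switching M mu E p"
begin

abbreviation Z where "Z \<equiv> zs mu p"
abbreviation L where "L \<equiv> admissible_words E"

lemmas admissible = adm[unfolded admissible_switching_def Let_def]
lemmas admissible_mu_measurable = admissible[THEN conjunct1]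
lemmas admissible_dead = admissible[THEN conjunct2, THEN conjunct2, THEN conjunct1]
lemmas admissible_pos = admissible[THEN conjunct2, THEN conjunct2, THEN conjunct2, THEN conjunct1]
lemmas admissible_cond_exp_words = admissible[THEN conjunct2, THEN conjunct2, THEN conjunct2, THEN conjunct2, THEN conjunct1]
lemmas admissible_cond_exp_word_letter = admissible[THEN conjunct2, THEN conjunct2, THEN conjunct2, THEN conjunct2, THEN conjunct2, THEN conjunct1]
lemmas admissible_cond_exp_letters = admissible[THEN conjunct2, THEN conjunct2, THEN conjunct2, THEN conjunct2, THEN conjunct2, THEN conjunct2, THEN conjunct1]
lemmas admissible_alpha = admissible[THEN conjunct2, THEN conjunct2, THEN conjunct2, THEN conjunct2, THEN conjunct2, THEN conjunct2, THEN conjunct2, THEN conjunct1]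
lemmas admissible_wss = admissible[THEN conjunct2, THEN conjunct2, THEN conjunct2, THEN conjunct2, THEN conjunct2, THEN conjunct2, THEN conjunct2, THEN conjunct2]

lemma mu_measurable [measurable]: "mu \<sigma> t \<in> borel_measurable M"
  using admissible_mu_measurable by blast

lemma p_pos [simp]: "0 < p \<sigma>"
  using admissible_pos by blast

lemma p_word_pos [simp]: "0 < p_word p w"
  by (induction w) simp_all

lemma dead_word: "w \<noteq> [] \<Longrightarrow> w \<notin> L \<Longrightarrow> AE \<omega> in M. mu_word mu w t \<omega> = 0"
  using admissible_dead by blast

lemma mu_word_square_integrable: "w \<noteq> [] \<Longrightarrow> square_integrable M (mu_word mu w t)"
  using admissible_wss[rule_format, of w w] by (simp add: jointly_wss_def)

lemma mu_square_integrable: "square_integrable M (mu \<sigma> t)"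
proof -
  have "mu_word mu [\<sigma>] t = mu \<sigma> t" by auto
  then show ?thesis using mu_word_square_integrable[of "[\<sigma>]" t] by simp
qed

lemma subalgebra_past: "subalgebra M (mu_past M mu t)"
  unfolding mu_past_def by (rule subalgebra_gen_sigma) auto

lemma subalgebra_future: "subalgebra M (mu_future M mu t)"
  unfolding mu_future_def by (rule subalgebra_gen_sigma) auto

lemma mu_measurable_past: "k < t \<Longrightarrow> mu \<sigma> k \<in> borel_measurable (mu_past M mu t)"
  unfolding mu_past_def by (rule measurable_gen_sigma) auto

lemma mu_measurable_future: "t \<le> k \<Longrightarrow> mu \<sigma> k \<in> borel_measurable (mu_future M mu t)"
  unfolding mu_future_def by (rule measurable_gen_sigma) auto

lemma mu_word_measurable_past: "k < t \<Longrightarrow> mu_word mu w k \<in> borel_measurable (mu_past M mu t)"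
  unfolding mu_word_def by (intro borel_measurable_prod mu_measurable_past) auto

text \<open>
  The three moment conditions of admissible switching in one form. The case of two empty words and equal
  letters is excluded because no such condition determines the conditional second moment of a
  single letter.
\<close>
lemma cond_exp_mu_product:
  assumes "\<not> (w = [] \<and> v = [] \<and> \<sigma> = \<tau>)"
  shows "AE \<omega> in M. mu_word mu w (t - 1) \<omega> * mu_word mu v (t - 1) \<omega> *
      real_cond_exp M (mu_past M mu t) (\<lambda>\<omega>. mu \<sigma> t \<omega> * mu \<tau> t \<omega>) \<omega> =
    (if \<sigma> = \<tau> \<and> w @ [\<sigma>] \<in> L \<and> v @ [\<sigma>] \<in> L then p \<sigma> else 0) *
      (mu_word mu w (t - 1) \<omega> * mu_word mu v (t - 1) \<omega>)"
proof -
  interpret H: finite_measure_subalgebra M "mu_past M mu t"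
    by unfold_locales (rule subalgebra_past)
  have eq: "(\<lambda>\<omega>. (mu_word mu w (t - 1) \<omega> * mu_word mu v (t - 1) \<omega>) * (mu \<sigma> t \<omega> * mu \<tau> t \<omega>)) =
      (\<lambda>\<omega>. mu_word mu (w @ [\<sigma>]) t \<omega> * mu_word mu (v @ [\<tau>]) t \<omega>)"
    by (auto simp: mu_word_snoc)
  have "AE \<omega> in M. real_cond_exp M (mu_past M mu t)
      (\<lambda>\<omega>. (mu_word mu w (t - 1) \<omega> * mu_word mu v (t - 1) \<omega>) * (mu \<sigma> t \<omega> * mu \<tau> t \<omega>)) \<omega> =
      (mu_word mu w (t - 1) \<omega> * mu_word mu v (t - 1) \<omega>) *
        real_cond_exp M (mu_past M mu t) (\<lambda>\<omega>. mu \<sigma> t \<omega> * mu \<tau> t \<omega>) \<omega>"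
  proof (rule H.real_cond_exp_mult)
    show "(\<lambda>\<omega>. mu_word mu w (t - 1) \<omega> * mu_word mu v (t - 1) \<omega>) \<in> borel_measurable (mu_past M mu t)"
      by (intro borel_measurable_times mu_word_measurable_past) auto
    show "integrable M (\<lambda>\<omega>. mu_word mu w (t - 1) \<omega> * mu_word mu v (t - 1) \<omega> * (mu \<sigma> t \<omega> * mu \<tau> t \<omega>))"
      unfolding eq by (intro sq_int_mult mu_word_square_integrable) auto
  qed simp
  moreover have "AE \<omega> in M. real_cond_exp M (mu_past M mu t)
      (\<lambda>\<omega>. mu_word mu (w @ [\<sigma>]) t \<omega> * mu_word mu (v @ [\<tau>]) t \<omega>) \<omega> =
      (if \<sigma> = \<tau> \<and> w @ [\<sigma>] \<in> L \<and> v @ [\<sigma>] \<in> L then p \<sigma> else 0) *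
      (mu_word mu w (t - 1) \<omega> * mu_word mu v (t - 1) \<omega>)"
  proof (cases "w = []")
    case False
    show ?thesis
    proof (cases "v = []")
      case False
      have "AE \<omega> in M. real_cond_exp M (mu_past M mu t)
            (\<lambda>\<omega>. mu_word mu (w @ [\<sigma>]) t \<omega> * mu_word mu (v @ [\<tau>]) t \<omega>) \<omega> =
          (if \<sigma> = \<tau> \<and> w @ [\<sigma>] \<in> L \<and> v @ [\<sigma>] \<in> L
           then p \<sigma> * mu_word mu w (t - 1) \<omega> * mu_word mu v (t - 1) \<omega> else 0)"
        using admissible_cond_exp_words \<open>w \<noteq> []\<close> False by blast
      then show ?thesis by eventually_elim auto
    next
      case True
      have "AE \<omega> in M. real_cond_exp M (mu_past M mu t)
            (\<lambda>\<omega>. mu_word mu (w @ [\<sigma>]) t \<omega> * mu \<tau> t \<omega>) \<omega> =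
          (if \<sigma> = \<tau> \<and> w @ [\<sigma>] \<in> L then p \<sigma> * mu_word mu w (t - 1) \<omega> else 0)"
        using admissible_cond_exp_word_letter \<open>w \<noteq> []\<close> by blast
      then show ?thesis using True by (auto elim!: eventually_mono)
    qed
  next
    case w: True
    show ?thesis
    proof (cases "v = []")
      case False
      have "AE \<omega> in M. real_cond_exp M (mu_past M mu t)
            (\<lambda>\<omega>. mu_word mu (v @ [\<tau>]) t \<omega> * mu \<sigma> t \<omega>) \<omega> =
          (if \<tau> = \<sigma> \<and> v @ [\<tau>] \<in> L then p \<tau> * mu_word mu v (t - 1) \<omega> else 0)"
        using admissible_cond_exp_word_letter False by blast
      then show ?thesis using w by (auto elim!: eventually_mono simp: mult.commute)
    next
      case True
      then have "\<sigma> \<noteq> \<tau>" using w assms by auto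
      then have "AE \<omega> in M. real_cond_exp M (mu_past M mu t) (\<lambda>\<omega>. mu \<sigma> t \<omega> * mu \<tau> t \<omega>) \<omega> = 0"
        using admissible_cond_exp_letters by blast
      then show ?thesis using w True \<open>\<sigma> \<noteq> \<tau>\<close> by (auto elim!: eventually_mono)
    qed
  qed
  ultimately show ?thesis unfolding eq by eventually_elim (erule (1) trans[OF sym])
qed

text \<open>
  What is used of the ZMWSSI property of a vector process, for the set of its components: its members may
  be combined in one correlation.
\<close>
definition joint :: "(int \<Rightarrow> 'a \<Rightarrow> real) set \<Rightarrow> bool" where
  "joint X \<longleftrightarrow>
    (\<forall>t. cond_indep M (gen_sigma M {f k | f k. f \<in> X \<and> k \<le> t}) (mu_future M mu t) (mu_past M mu t)) \<and>
    (\<forall>f\<in>X. \<forall>w t. square_integrable M (Z f w t)) \<and>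
    (\<forall>f\<in>X. \<forall>g\<in>X. \<forall>w v s t k. ip M (Z f w (s + k)) (Z g v (t + k)) = ip M (Z f w s) (Z g v t))"

lemma joint_square_integrable: "joint X \<Longrightarrow> f \<in> X \<Longrightarrow> square_integrable M (Z f w t)"
  by (simp add: joint_def)

lemma joint_shift:
  assumes "joint X" "f \<in> X" "g \<in> X"
  shows "ip M (Z f w t) (Z g v t) = ip M (Z f w s) (Z g v s)"
proof -
  have "ip M (Z f w (s + k)) (Z g v (s + k)) = ip M (Z f w s) (Z g v s)" for k
    using assms unfolding joint_def by blast
  from this[of "t - s"] show ?thesis by simp
qed

text \<open>
  Strip the last letter. Up to a constant the integrand is $Y h$, where
  $h = \mu_\sigma(t-1)\mu_\tau(t-1)$ belongs to the future and $Y$ to the join of the history of the processes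
  and the past of $\mu$. By conditional independence $h$ may be replaced by its conditional expectation given
  the past of $\mu$, and the part of $Y$ that consists of switching words turns the latter into the
  constant $p_\sigma$ or 0.
\<close>
lemma ip_Z_snoc:
  assumes X: "joint X" "f \<in> X" "g \<in> X" and nontriv: "\<not> (w = [] \<and> v = [] \<and> \<sigma> = \<tau>)"
  shows "ip M (Z f (w @ [\<sigma>]) t) (Z g (v @ [\<tau>]) t) =
    (if \<sigma> = \<tau> \<and> w @ [\<sigma>] \<in> L \<and> v @ [\<sigma>] \<in> L then ip M (Z f w (t - 1)) (Z g v (t - 1)) else 0)"
proof -
  define s where "s = t - 1"
  define F where "F = gen_sigma M {f k | f k. f \<in> X \<and> k \<le> s}"
  define H where "H = mu_past M mu s"
  define h where "h \<omega> = mu \<sigma> s \<omega> * mu \<tau> s \<omega>" for \<omega>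
  define Y where "Y \<omega> = f (s - int (length w)) \<omega> * g (s - int (length v)) \<omega> *
    (mu_word mu w (s - 1) \<omega> * mu_word mu v (s - 1) \<omega>)" for \<omega>
  define c where "c = (if \<sigma> = \<tau> \<and> w @ [\<sigma>] \<in> L \<and> v @ [\<sigma>] \<in> L then p \<sigma> else 0)"
  have meas: "f k \<in> borel_measurable M" if "f \<in> X" for f k
    using joint_square_integrable[OF X(1) that, of "[]" k] by (auto simp: square_integrable_def)
  have sub: "subalgebra M F" "subalgebra M (mu_future M mu s)" "subalgebra M H"
    unfolding F_def H_def
    using meas by (auto intro!: subalgebra_gen_sigma subalgebra_future subalgebra_past)
  have ci: "cond_indep M F (mu_future M mu s) H"
    using X(1) unfolding joint_def F_def H_def by blast
  have h: "h \<in> borel_measurable (mu_future M mu s)" "integrable M h"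
    unfolding h_def
    by (auto intro!: borel_measurable_times mu_measurable_future sq_int_mult mu_square_integrable)
  have Ym: "Y \<in> borel_measurable (joint_sigma M F H)"
    unfolding Y_def
  proof (intro borel_measurable_times)
    have "f (s - int (length w)) \<in> borel_measurable F" "g (s - int (length v)) \<in> borel_measurable F"
      unfolding F_def using X meas by (intro measurable_gen_sigma; force)+
    then show "f (s - int (length w)) \<in> borel_measurable (joint_sigma M F H)"
      "g (s - int (length v)) \<in> borel_measurable (joint_sigma M F H)"
      using measurable_from_subalg[OF subalgebra_joint_sigma_left[OF sub(1,3)]] by auto
    have "mu_word mu w (s - 1) \<in> borel_measurable (joint_sigma M F H)" for w
      by (rule measurable_from_subalg[OF subalgebra_joint_sigma_right[OF sub(1,3)]])
         (simp add: H_def mu_word_measurable_past)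
    then show "mu_word mu w (s - 1) \<in> borel_measurable (joint_sigma M F H)"
      "mu_word mu v (s - 1) \<in> borel_measurable (joint_sigma M F H)" by auto
  qed
  have prod1: "Z f (w @ [\<sigma>]) t \<omega> * Z g (v @ [\<tau>]) t \<omega> =
      1 / (sqrt (p_word p w) * sqrt (p \<sigma>) * (sqrt (p_word p v) * sqrt (p \<tau>))) * (Y \<omega> * h \<omega>)" for \<omega>
    by (simp add: zs_def mu_word_snoc Y_def h_def s_def real_sqrt_mult algebra_simps)
  have prod2: "Z f w s \<omega> * Z g v s \<omega> = 1 / (sqrt (p_word p w) * sqrt (p_word p v)) * Y \<omega>" for \<omega>
    by (simp add: zs_def Y_def algebra_simps)
  have sq_ne: "sqrt (p_word p q) \<noteq> 0" "sqrt (p \<rho>) \<noteq> 0" for q \<rho>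
    using p_word_pos[of q] p_pos[of \<rho>] by (simp_all del: p_word_pos p_pos)
  have scale: "integrable M k" if "integrable M (\<lambda>\<omega>. a * k \<omega>)" "a \<noteq> 0" for a and k :: "'a \<Rightarrow> real"
    using integrable_mult_right[OF that(1), of "1 / a"] that(2) by simp
  have "integrable M (\<lambda>\<omega>. Z f (w @ [\<sigma>]) t \<omega> * Z g (v @ [\<tau>]) t \<omega>)"
    using X by (auto intro!: sq_int_mult joint_square_integrable)
  from scale[OF this[unfolded prod1]] have int1: "integrable M (\<lambda>\<omega>. Y \<omega> * h \<omega>)"
    using sq_ne by simp
  have "integrable M (\<lambda>\<omega>. Z f w s \<omega> * Z g v s \<omega>)"
    using X by (auto intro!: sq_int_mult joint_square_integrable)
  from scale[OF this[unfolded prod2]] have int2: "integrable M Y"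
    using sq_ne by simp
  note int = int1 int2
  have YE: "AE \<omega> in M. Y \<omega> * real_cond_exp M H h \<omega> = c * Y \<omega>"
    using cond_exp_mu_product[OF nontriv, of s] unfolding H_def h_def Y_def c_def
    by eventually_elim (auto simp: mult.assoc mult.left_commute split del: if_split)
  have [measurable]: "Y \<in> borel_measurable M" "h \<in> borel_measurable M" using int(2) h(2) by auto
  have "integrable M (\<lambda>\<omega>. Y \<omega> * real_cond_exp M H h \<omega>)"
    by (rule integrable_cong_AE_imp[OF integrable_mult_right[OF int(2), of c]])
       (use YE in \<open>auto elim!: eventually_mono\<close>)
  then have "(\<integral>\<omega>. Y \<omega> * h \<omega> \<partial>M) = (\<integral>\<omega>. Y \<omega> * real_cond_exp M H h \<omega> \<partial>M)"
    by (rule cond_indep_integral[OF sub ci h Ym int(1)])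
  also have "\<dots> = (\<integral>\<omega>. c * Y \<omega> \<partial>M)"
    by (rule integral_cong_AE) (use YE in auto)
  finally have Yh: "(\<integral>\<omega>. Y \<omega> * h \<omega> \<partial>M) = c * (\<integral>\<omega>. Y \<omega> \<partial>M)" by simp
  have key: "1 / (sqrt (p_word p w) * sqrt (p \<sigma>) * (sqrt (p_word p v) * sqrt (p \<sigma>))) * p \<sigma> =
      1 / (sqrt (p_word p w) * sqrt (p_word p v))"
  proof -
    have "sqrt (p \<sigma>) * sqrt (p \<sigma>) = p \<sigma>" using p_pos[of \<sigma>] by (simp del: p_pos)
    then have "sqrt (p_word p w) * sqrt (p \<sigma>) * (sqrt (p_word p v) * sqrt (p \<sigma>)) =
        sqrt (p_word p w) * sqrt (p_word p v) * p \<sigma>"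
      by (metis (no_types, lifting) mult.assoc mult.left_commute)
    moreover have "p \<sigma> \<noteq> 0" by (metis p_pos less_irrefl)
    ultimately show ?thesis
      by (simp only: times_divide_eq_left mult_1 nonzero_divide_mult_cancel_right not_False_eq_True)
  qed
  show ?thesis
  proof (cases "\<sigma> = \<tau> \<and> w @ [\<sigma>] \<in> L \<and> v @ [\<sigma>] \<in> L")
    case True
    then have "\<tau> = \<sigma>" "c = p \<sigma>" by (auto simp: c_def)
    then have "ip M (Z f (w @ [\<sigma>]) t) (Z g (v @ [\<tau>]) t) =
      1 / (sqrt (p_word p w) * sqrt (p \<sigma>) * (sqrt (p_word p v) * sqrt (p \<sigma>))) * (p \<sigma> * (\<integral>\<omega>. Y \<omega> \<partial>M))"
      unfolding ip_def prod1 integral_mult_right_zero Yh by simp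
    also have "\<dots> = 1 / (sqrt (p_word p w) * sqrt (p_word p v)) * (\<integral>\<omega>. Y \<omega> \<partial>M)"
      unfolding key[symmetric] by (simp only: mult.assoc)
    also have "\<dots> = ip M (Z f w s) (Z g v s)"
      unfolding ip_def prod2 integral_mult_right_zero by simp
    finally show ?thesis unfolding if_P[OF True] s_def .
  next
    case False
    then have "c = 0" unfolding c_def by (rule if_not_P)
    then have "ip M (Z f (w @ [\<sigma>]) t) (Z g (v @ [\<tau>]) t) = 0"
      unfolding ip_def prod1 integral_mult_right_zero Yh by simp
    then show ?thesis unfolding if_not_P[OF False] .
  qed
qed

lemma Z_dead: "w \<noteq> [] \<Longrightarrow> w \<notin> L \<Longrightarrow> AE \<omega> in M. Z f w t \<omega> = 0"
  using dead_word[of w "t - 1"] by (auto simp: zs_def elim!: eventually_mono)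

text \<open>
  Multiplication by $\sum_\sigma \alpha_\sigma \mu_\sigma(t) = 1$ makes every word longer by one letter. This transfers
  properties of nonempty words to the empty word.
\<close>
lemma obtain_lift:
  obtains \<alpha> :: "'s \<Rightarrow> real" where
    "\<And>f w t. AE \<omega> in M. Z f w t \<omega> = (\<Sum>\<sigma>\<in>UNIV. \<alpha> \<sigma> * Z f (w @ [\<sigma>]) (t + 1) \<omega>)"
proof -
  obtain \<alpha> :: "'s \<Rightarrow> real" where \<alpha>: "AE \<omega> in M. (\<Sum>\<sigma>\<in>UNIV. \<alpha> \<sigma> * mu \<sigma> t \<omega>) = 1" for t
    using admissible_alpha by blast
  have "AE \<omega> in M. Z f w t \<omega> = (\<Sum>\<sigma>\<in>UNIV. (\<alpha> \<sigma> * sqrt (p \<sigma>)) * Z f (w @ [\<sigma>]) (t + 1) \<omega>)" for f w t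
    using \<alpha>[of t]
  proof eventually_elim
    case (elim \<omega>)
    have sq: "p \<sigma> \<noteq> 0" "p_word p w \<noteq> 0" for \<sigma> by (metis p_pos less_irrefl, metis p_word_pos less_irrefl)
    have "(\<Sum>\<sigma>\<in>UNIV. (\<alpha> \<sigma> * sqrt (p \<sigma>)) * Z f (w @ [\<sigma>]) (t + 1) \<omega>) =
      (\<Sum>\<sigma>\<in>UNIV. Z f w t \<omega> * (\<alpha> \<sigma> * mu \<sigma> t \<omega>))"
      by (rule sum.cong) (auto simp: zs_def mu_word_snoc real_sqrt_mult sq field_simps)
    also have "\<dots> = Z f w t \<omega>" using elim by (simp flip: sum_distrib_left)
    finally show ?case by simp
  qed
  then show ?thesis by (rule that)
qed

text \<open>Strip common last letters until they differ.\<close>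
lemma ip_Z_same_length:
  assumes X: "joint X" "f \<in> X" "g \<in> X"
  shows "length w = length v \<Longrightarrow> w \<noteq> v \<Longrightarrow> ip M (Z f w t) (Z g v t) = 0"
proof (induction w arbitrary: v t rule: rev_induct)
  case Nil then show ?case by simp
next
  case (snoc \<sigma> w)
  then obtain v' \<tau> where v: "v = v' @ [\<tau>]" by (cases v rule: rev_cases) auto
  show ?case
  proof (cases "\<sigma> = \<tau>")
    case True
    then have "w \<noteq> v'" "length w = length v'" using snoc.prems v by auto
    then show ?thesis using snoc.IH[of v' "t - 1"] True
      unfolding v by (subst ip_Z_snoc[OF X]) auto
  next
    case False
    then show ?thesis unfolding v by (subst ip_Z_snoc[OF X]) auto
  qed
qed

text \<open>
  Letters are stripped down to the first one, where the recursion stops; \<open>s\<close> is arbitrary by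
  stationarity.
\<close>
lemma ip_Z_same_word:
  assumes X: "joint X" "f \<in> X" "g \<in> X"
  shows "ip M (Z f (\<sigma> # w) t) (Z g (\<sigma> # w) t) =
    (if \<sigma> # w \<in> L then ip M (Z f [\<sigma>] s) (Z g [\<sigma>] s) else 0)"
proof (induction w arbitrary: t rule: rev_induct)
  case Nil
  show ?case using joint_shift[OF X] by simp
next
  case (snoc \<tau> w)
  have "ip M (Z f ((\<sigma> # w) @ [\<tau>]) t) (Z g ((\<sigma> # w) @ [\<tau>]) t) =
    (if (\<sigma> # w) @ [\<tau>] \<in> L then ip M (Z f (\<sigma> # w) (t - 1)) (Z g (\<sigma> # w) (t - 1)) else 0)"
    by (subst ip_Z_snoc[OF X]) auto
  also have "\<dots> = (if (\<sigma> # w) @ [\<tau>] \<in> L then ip M (Z f [\<sigma>] s) (Z g [\<sigma>] s) else 0)"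
    using admissible_words_snoc[of "\<sigma> # w" \<tau> E] snoc.IH by simp
  finally show ?case by simp
qed

end

section \<open>Stability\<close>

text \<open>
  Scaling \<open>T\<close> by $1/c$ with $c$ between the spectral radius and 1 leaves the spectral radius below 1, so
  the powers of the scaled matrix are bounded and those of \<open>T\<close> are $O(c^N)$.
\<close>
lemma powers_tendsto_zero:
  fixes T :: "real mat"
  assumes T: "T \<in> carrier_mat m m"
    and ev: "\<And>l. eigenvalue (map_mat complex_of_real T) l \<Longrightarrow> cmod l < 1"
    and ij: "i < m" "j < m"
  shows "(\<lambda>N. (T ^\<^sub>m N) $$ (i, j)) \<longlonglongrightarrow> 0"
proof -
  define TC where "TC = map_mat complex_of_real T"
  have TC: "TC \<in> carrier_mat m m" using T by (simp add: TC_def)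
  have m: "0 < m" using ij by simp
  define \<rho> where "\<rho> = spectral_radius TC"
  have "\<rho> \<in> norm ` spectrum TC" unfolding \<rho>_def by (rule spectral_radius_mem_max(1)[OF TC m])
  then have \<rho>: "0 \<le> \<rho>" "\<rho> < 1" using ev by (auto simp: spectrum_def TC_def)
  define c where "c = (\<rho> + 1) / 2"
  have c: "\<rho> < c" "c < 1" "0 < c" using \<rho> by (auto simp: c_def)
  define B where "B = complex_of_real (1 / c) \<cdot>\<^sub>m TC"
  have B: "B \<in> carrier_mat m m" using TC by (simp add: B_def)
  have "spectral_radius B < 1"
  proof -
    have "spectral_radius B \<in> norm ` spectrum B" by (rule spectral_radius_mem_max(1)[OF B m])
    then obtain l v where l: "spectral_radius B = cmod l" "eigenvector B v l"
      by (auto simp: spectrum_def eigenvalue_def)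
    have v: "v \<in> carrier_vec m" "v \<noteq> 0\<^sub>v m" "B *\<^sub>v v = l \<cdot>\<^sub>v v"
      using l(2) B by (auto simp: eigenvector_def)
    have "TC = complex_of_real c \<cdot>\<^sub>m B"
      using c TC by (intro eq_matI) (auto simp: B_def)
    then have "TC *\<^sub>v v = complex_of_real c \<cdot>\<^sub>v (B *\<^sub>v v)"
      using B v(1) by (intro eq_vecI) auto
    also have "\<dots> = (complex_of_real c * l) \<cdot>\<^sub>v v" by (simp add: v(3) smult_smult_assoc)
    finally have "eigenvalue TC (complex_of_real c * l)"
      using v TC unfolding eigenvalue_def eigenvector_def by auto
    then have "cmod (complex_of_real c * l) \<le> \<rho>"
      unfolding \<rho>_def by (intro spectral_radius_mem_max(2)[OF TC m]) (auto simp: spectrum_def)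
    moreover have "cmod (complex_of_real c * l) = c * cmod l" using c by (simp add: norm_mult)
    ultimately have "c * cmod l < c * 1" using c by linarith
    then show ?thesis using c l by simp
  qed
  then obtain b where b: "norm_bound (B ^\<^sub>m N) b" for N
    using spectral_radius_jnf_norm_bound_less_1_upper_triangular[OF B] by blast
  have pow: "B ^\<^sub>m N = complex_of_real (1 / c) ^ N \<cdot>\<^sub>m (TC ^\<^sub>m N)" for N
  proof (induction N)
    case 0
    show ?case using TC B by (intro eq_matI) auto
  next
    case (Suc N)
    have P: "TC ^\<^sub>m N \<in> carrier_mat m m" using TC by simp
    have "B ^\<^sub>m Suc N = (complex_of_real (1 / c) ^ N \<cdot>\<^sub>m (TC ^\<^sub>m N)) * (complex_of_real (1 / c) \<cdot>\<^sub>m TC)"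
      unfolding pow_mat.simps Suc by (simp add: B_def)
    also have "\<dots> = complex_of_real (1 / c) ^ N \<cdot>\<^sub>m (complex_of_real (1 / c) \<cdot>\<^sub>m (TC ^\<^sub>m N * TC))"
      using P TC by (simp add: mult_smult_assoc_mat[OF P smult_carrier_mat[OF TC]] mult_smult_distrib[OF P TC])
    also have "\<dots> = complex_of_real (1 / c) ^ Suc N \<cdot>\<^sub>m (TC ^\<^sub>m Suc N)"
      using P TC by (intro eq_matI) auto
    finally show ?case .
  qed
  have TCpow: "TC ^\<^sub>m N = map_mat complex_of_real (T ^\<^sub>m N)" for N
    unfolding TC_def by (rule of_real_hom.mat_hom_pow[OF T, symmetric])
  have bound: "\<bar>(T ^\<^sub>m N) $$ (i, j)\<bar> \<le> b * c ^ N" for N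
  proof -
    have P: "T ^\<^sub>m N \<in> carrier_mat m m" using T by simp
    have "cmod ((B ^\<^sub>m N) $$ (i, j)) \<le> b"
      using b[of N] ij B unfolding norm_bound_def by auto
    then have "(1 / c) ^ N * \<bar>(T ^\<^sub>m N) $$ (i, j)\<bar> \<le> b"
    proof -
      have "(B ^\<^sub>m N) $$ (i, j) = complex_of_real (1 / c) ^ N * complex_of_real ((T ^\<^sub>m N) $$ (i, j))"
        unfolding pow TCpow using ij carrier_matD[OF P] by simp
      then show ?thesis
        using \<open>cmod ((B ^\<^sub>m N) $$ (i, j)) \<le> b\<close> c by (simp add: norm_mult norm_power norm_divide)
    qed
    then show ?thesis using c by (simp add: power_divide field_simps)
  qed
  have "(\<lambda>N. b * c ^ N) \<longlonglongrightarrow> 0"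
    using LIMSEQ_power_zero[of c] c by (intro tendsto_mult_right_zero) auto
  then show ?thesis
    by (rule Lim_null_comparison[rotated]) (simp add: bound)
qed

text \<open>
  The map $P \mapsto \sum_\sigma p_\sigma A_\sigma P A_\sigma^T$ on covariances; in coordinates it is the Kronecker sum
  whose eigenvalues enter the stability condition.
\<close>
definition lyapunov ::
  "('s::finite \<Rightarrow> real) \<Rightarrow> nat \<Rightarrow> ('s \<Rightarrow> real mat) \<Rightarrow> (nat \<Rightarrow> nat \<Rightarrow> real) \<Rightarrow> nat \<Rightarrow> nat \<Rightarrow> real" where
  "lyapunov p n A P k l =
    (\<Sum>\<sigma>\<in>UNIV. p \<sigma> * (\<Sum>a<n. \<Sum>b<n. A \<sigma> $$ (k, a) * A \<sigma> $$ (l, b) * P a b))"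

lemma stable_lyapunov_tendsto_zero:
  fixes p :: "'s::finite \<Rightarrow> real"
  assumes st: "stable p n A" and A: "\<And>\<sigma>. A \<sigma> \<in> carrier_mat n n" and kl: "k < n" "l < n"
  shows "(\<lambda>N. (lyapunov p n A ^^ N) P k l) \<longlonglongrightarrow> 0"
proof -
  define T where "T = mat (n * n) (n * n) (\<lambda>ij. \<Sum>\<sigma>\<in>UNIV. p \<sigma> * kronecker (A \<sigma>) (A \<sigma>) $$ ij)"
  have T: "T \<in> carrier_mat (n * n) (n * n)" by (simp add: T_def)
  have ev: "cmod l < 1" if "eigenvalue (map_mat complex_of_real T) l" for l
    using st that by (simp add: stable_def T_def Let_def)
  have n: "0 < n" using kl by simp
  have idx: "b + a * n < n * n" if "a < n" "b < n" for a b
  proof -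
    have "b + a * n < n + a * n" using that by simp
    also have "\<dots> = Suc a * n" by simp
    also have "\<dots> \<le> n * n" using that by (intro mult_right_mono) auto
    finally show ?thesis .
  qed
  have dm: "(b + a * n) div n = a" "(b + a * n) mod n = b" if "b < n" for a b
    using that by auto
  have Tent: "T $$ (l + k * n, b + a * n) = (\<Sum>\<sigma>\<in>UNIV. p \<sigma> * (A \<sigma> $$ (k, a) * A \<sigma> $$ (l, b)))"
    if "k < n" "l < n" "a < n" "b < n" for k l a b
  proof -
    have "kronecker (A \<sigma>) (A \<sigma>) $$ (l + k * n, b + a * n) = A \<sigma> $$ (k, a) * A \<sigma> $$ (l, b)" for \<sigma>
    proof -
      have d: "dim_row (A \<sigma>) = n" "dim_col (A \<sigma>) = n" using A[of \<sigma>] by auto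
      have "kronecker (A \<sigma>) (A \<sigma>) $$ (l + k * n, b + a * n) =
         (\<lambda>(i, j). A \<sigma> $$ (i div n, j div n) * A \<sigma> $$ (i mod n, j mod n)) (l + k * n, b + a * n)"
        unfolding kronecker_def d by (rule index_mat(1)) (intro idx that)+
      then show ?thesis by (simp only: prod.case dm that)
    qed
    moreover have "T $$ (l + k * n, b + a * n) =
        (\<Sum>\<sigma>\<in>UNIV. p \<sigma> * kronecker (A \<sigma>) (A \<sigma>) $$ (l + k * n, b + a * n))"
      unfolding T_def by (rule index_mat(1)) (intro idx that)+
    ultimately show ?thesis by simp
  qed
  have sumT: "(\<Sum>j<n * n. F j) = (\<Sum>a<n. \<Sum>b<n. F (b + a * n))" for F :: "nat \<Rightarrow> real"
    by (rule sum_mult_product)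
  have "(lyapunov p n A ^^ N) P k l = (\<Sum>j<n * n. (T ^\<^sub>m N) $$ (l + k * n, j) * P (j div n) (j mod n))"
    if "k < n" "l < n" for k l N
    using that
  proof (induction N arbitrary: P)
    case 0
    have "(\<Sum>j<n * n. (T ^\<^sub>m 0) $$ (l + k * n, j) * P (j div n) (j mod n)) =
       (\<Sum>j<n * n. if j = l + k * n then P (j div n) (j mod n) else 0)"
      using 0 idx T by (intro sum.cong) auto
    also have "\<dots> = P k l" using 0 idx dm by (simp add: sum.delta)
    finally show ?case by simp
  next
    case (Suc N)
    have step: "lyapunov p n A P (i div n) (i mod n) = (\<Sum>j<n * n. T $$ (i, j) * P (j div n) (j mod n))"
      if "i < n * n" for i
    proof -
      define a' b' where "a' = i div n" and "b' = i mod n"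
      have i: "i = b' + a' * n" "a' < n" "b' < n"
        using that n by (auto simp: a'_def b'_def less_mult_imp_div_less)
      have "(\<Sum>j<n * n. T $$ (i, j) * P (j div n) (j mod n)) =
          (\<Sum>a<n. \<Sum>b<n. \<Sum>\<sigma>\<in>UNIV. p \<sigma> * (A \<sigma> $$ (a', a) * A \<sigma> $$ (b', b)) * P a b)"
        unfolding sumT using i by (intro sum.cong refl) (simp add: dm Tent sum_distrib_right)
      also have "\<dots> = (\<Sum>a<n. \<Sum>\<sigma>\<in>UNIV. \<Sum>b<n. p \<sigma> * (A \<sigma> $$ (a', a) * A \<sigma> $$ (b', b)) * P a b)"
        by (intro sum.cong refl sum.swap)
      also have "\<dots> = (\<Sum>\<sigma>\<in>UNIV. \<Sum>a<n. \<Sum>b<n. p \<sigma> * (A \<sigma> $$ (a', a) * A \<sigma> $$ (b', b)) * P a b)"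
        by (rule sum.swap)
      also have "\<dots> = lyapunov p n A P a' b'"
        by (simp add: lyapunov_def sum_distrib_left mult.assoc)
      finally show ?thesis by (simp add: a'_def b'_def)
    qed
    have TN: "T ^\<^sub>m N \<in> carrier_mat (n * n) (n * n)" using T by simp
    have "(lyapunov p n A ^^ Suc N) P k l = (lyapunov p n A ^^ N) (lyapunov p n A P) k l"
      by (simp add: funpow_Suc_right del: funpow.simps)
    also have "\<dots> = (\<Sum>i<n * n. (T ^\<^sub>m N) $$ (l + k * n, i) * (\<Sum>j<n * n. T $$ (i, j) * P (j div n) (j mod n)))"
      using Suc by (simp add: step)
    also have "\<dots> = (\<Sum>i<n * n. \<Sum>j<n * n. (T ^\<^sub>m N) $$ (l + k * n, i) * T $$ (i, j) * P (j div n) (j mod n))"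
      by (simp add: sum_distrib_left mult.assoc)
    also have "\<dots> = (\<Sum>j<n * n. \<Sum>i<n * n. (T ^\<^sub>m N) $$ (l + k * n, i) * T $$ (i, j) * P (j div n) (j mod n))"
      by (rule sum.swap)
    also have "\<dots> = (\<Sum>j<n * n. (T ^\<^sub>m Suc N) $$ (l + k * n, j) * P (j div n) (j mod n))"
    proof (intro sum.cong refl)
      fix j assume "j \<in> {..<n * n}"
      then show "(\<Sum>i<n * n. (T ^\<^sub>m N) $$ (l + k * n, i) * T $$ (i, j) * P (j div n) (j mod n)) =
          (T ^\<^sub>m Suc N) $$ (l + k * n, j) * P (j div n) (j mod n)"
        using TN T idx Suc.prems
        by (simp add: scalar_prod_def sum_distrib_right atLeast0LessThan)
    qed
    finally show ?case .
  qed
  moreover have "(\<lambda>N. \<Sum>j<n * n. (T ^\<^sub>m N) $$ (l + k * n, j) * P (j div n) (j mod n)) \<longlonglongrightarrow>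
      (\<Sum>j<n * n. 0 * P (j div n) (j mod n))"
    by (intro tendsto_sum tendsto_mult tendsto_const powers_tendsto_zero[OF T ev])
       (use idx kl in auto)
  ultimately show ?thesis using kl by simp
qed

section \<open>Dimensions of factorizations\<close>

lemma mat_word_carrier [simp]: "(\<And>\<sigma>. A \<sigma> \<in> carrier_mat n n) \<Longrightarrow> mat_word n A w \<in> carrier_mat n n"
  by (induction w) (auto intro: mult_carrier_mat)

lemma mat_word_append:
  assumes A: "\<And>\<sigma>. A \<sigma> \<in> carrier_mat n n"
  shows "mat_word n A (v @ w) = mat_word n A w * mat_word n A v"
proof (induction v)
  case Nil
  show ?case using mat_word_carrier[of A n w, OF A] by simp
next
  case (Cons \<sigma> v)
  then show ?case
    using assoc_mult_mat[OF mat_word_carrier[of A n, OF A] mat_word_carrier[of A n, OF A] A] by simp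
qed

lemma mat_word_append_vec:
  assumes A: "\<And>\<sigma>. A \<sigma> \<in> carrier_mat n n" and g: "g \<in> carrier_vec n"
  shows "mat_word n A w *\<^sub>v (mat_word n A v *\<^sub>v g) = mat_word n A (v @ w) *\<^sub>v g"
  unfolding mat_word_append[of A n, OF A]
  using assoc_mult_mat_vec[OF mat_word_carrier[of A n, OF A] mat_word_carrier[of A n, OF A] g] by simp

lemma mult_mat_vec_unit_vec:
  assumes "(A :: 'b :: comm_semiring_1 mat) \<in> carrier_mat m n" "i < n"
  shows "A *\<^sub>v unit_vec n i = col A i"
  using assms by (intro eq_vecI) auto

lemma mult_mat_vec_zero:
  assumes "(A :: 'b :: comm_semiring_1 mat) \<in> carrier_mat m n"
  shows "A *\<^sub>v 0\<^sub>v n = 0\<^sub>v m"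
  using assms by (intro eq_vecI) auto

text \<open>Padding a wide matrix with zero rows gives a square matrix of determinant 0.\<close>
lemma injective_mat_dim_le:
  fixes X :: "real mat"
  assumes X: "X \<in> carrier_mat m n"
    and inj: "\<And>v. v \<in> carrier_vec n \<Longrightarrow> X *\<^sub>v v = 0\<^sub>v m \<Longrightarrow> v = 0\<^sub>v n"
  shows "n \<le> m"
proof (rule ccontr)
  assume "\<not> n \<le> m"
  then have mn: "m < n" by simp
  define Y where "Y = mat n n (\<lambda>(i, j). if i < m then X $$ (i, j) else 0)"
  have Y: "Y \<in> carrier_mat n n" by (simp add: Y_def)
  have "Y\<^sup>T *\<^sub>v unit_vec n m = col Y\<^sup>T m"
    using Y mn by (intro mult_mat_vec_unit_vec) auto
  also have "\<dots> = 0\<^sub>v n" using mn by (intro eq_vecI) (auto simp: Y_def)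
  finally have "det Y\<^sup>T = 0"
    using Y mn by (subst det_0_iff_vec_prod_zero_field[of _ n]) (auto intro!: exI[of _ "unit_vec n m"])
  then have "det Y = 0" using det_transpose[OF Y] by simp
  then obtain v where v: "v \<in> carrier_vec n" "v \<noteq> 0\<^sub>v n" "Y *\<^sub>v v = 0\<^sub>v n"
    using det_0_iff_vec_prod_zero_field[OF Y] by auto
  have "X *\<^sub>v v = 0\<^sub>v m"
  proof (rule eq_vecI)
    fix i assume "i < dim_vec (0\<^sub>v m :: real vec)"
    then have i: "i < m" by simp
    have "row Y i = row X i" using i mn X by (intro eq_vecI) (auto simp: Y_def)
    then have "(X *\<^sub>v v) $ i = (Y *\<^sub>v v) $ i" using i mn X Y by simp
    then show "(X *\<^sub>v v) $ i = 0\<^sub>v m $ i" using v(3) i mn by simp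
  qed (use X in simp)
  then show False using inj v by auto
qed

text \<open>
  The vectors \<open>g\<close> that have a partner \<open>h\<close> with the same responses form a subspace, which contains the
  columns of all \<open>A_v G_\<sigma>\<close> and so is everything. Working with all vectors instead of a basis chosen among the
  columns leaves nothing to select but partners of the unit vectors.
\<close>
lemma dim_le_of_common_responses:
  fixes A A' :: "'s \<Rightarrow> real mat"
  assumes C: "C \<in> carrier_mat ny n" and A: "\<And>\<sigma>. A \<sigma> \<in> carrier_mat n n"
    and C': "C' \<in> carrier_mat ny n'" and A': "\<And>\<sigma>. A' \<sigma> \<in> carrier_mat n' n'"
    and G: "\<And>\<sigma>. G \<sigma> \<in> carrier_mat n q"
    and resp: "\<And>\<sigma> j. j < q \<Longrightarrow> \<exists>h\<in>carrier_vec n'. \<forall>w.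
      C *\<^sub>v (mat_word n A w *\<^sub>v col (G \<sigma>) j) = C' *\<^sub>v (mat_word n' A' w *\<^sub>v h)"
    and reach: "LinearCombinations.module.span class_ring (module_vec TYPE(real) n)
      (\<Union>w \<sigma>. set (cols (mat_word n A w * G \<sigma>))) = carrier_vec n"
    and obs: "(\<Inter>w. mat_kernel (C * mat_word n A w)) = {0\<^sub>v n}"
  shows "n \<le> n'"
proof -
  interpret vec_space "TYPE(real)" n .
  note W = mat_word_carrier[of A n, OF A] and W' = mat_word_carrier[of A' n', OF A']
  define R where "R g h \<longleftrightarrow> (\<forall>w. C *\<^sub>v (mat_word n A w *\<^sub>v g) = C' *\<^sub>v (mat_word n' A' w *\<^sub>v h))" for g h
  define U where "U = {g \<in> carrier_vec n. \<exists>h\<in>carrier_vec n'. R g h}"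
  have "submodule class_ring U V"
  proof (unfold_locales, goal_cases)
    case 1 then show ?case by (auto simp: U_def)
  next
    case (2 g g')
    then obtain h h' where h: "g \<in> carrier_vec n" "g' \<in> carrier_vec n" "h \<in> carrier_vec n'" "h' \<in> carrier_vec n'"
      "R g h" "R g' h'" by (auto simp: U_def)
    have "R (g + g') (h + h')"
      unfolding R_def
    proof
      fix w
      show "C *\<^sub>v (mat_word n A w *\<^sub>v (g + g')) = C' *\<^sub>v (mat_word n' A' w *\<^sub>v (h + h'))"
        using h(5,6) h(1-4) unfolding R_def
        by (simp add: mult_add_distrib_mat_vec[OF W] mult_add_distrib_mat_vec[OF W']
            mult_add_distrib_mat_vec[OF C mult_mat_vec_carrier[OF W] mult_mat_vec_carrier[OF W]]
            mult_add_distrib_mat_vec[OF C' mult_mat_vec_carrier[OF W'] mult_mat_vec_carrier[OF W']])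
    qed
    then show ?case using h by (auto simp: U_def intro!: bexI[of _ "h + h'"])
  next
    case 3
    have "C *\<^sub>v (mat_word n A w *\<^sub>v 0\<^sub>v n) = C' *\<^sub>v (mat_word n' A' w *\<^sub>v 0\<^sub>v n')" for w
      unfolding mult_mat_vec_zero[OF W] mult_mat_vec_zero[OF W'] mult_mat_vec_zero[OF C] mult_mat_vec_zero[OF C'] ..
    then have "R (0\<^sub>v n) (0\<^sub>v n')" unfolding R_def by blast
    then show ?case by (auto simp: U_def)
  next
    case (4 c g)
    then obtain h where h: "g \<in> carrier_vec n" "h \<in> carrier_vec n'" "R g h" by (auto simp: U_def)
    have "R (c \<cdot>\<^sub>v g) (c \<cdot>\<^sub>v h)"
      unfolding R_def
    proof
      fix w
      show "C *\<^sub>v (mat_word n A w *\<^sub>v (c \<cdot>\<^sub>v g)) = C' *\<^sub>v (mat_word n' A' w *\<^sub>v (c \<cdot>\<^sub>v h))"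
        using h unfolding R_def
        by (simp add: mult_mat_vec[OF W] mult_mat_vec[OF W']
            mult_mat_vec[OF C mult_mat_vec_carrier[OF W]] mult_mat_vec[OF C' mult_mat_vec_carrier[OF W']])
    qed
    then show ?case using h by (auto simp: U_def intro!: bexI[of _ "c \<cdot>\<^sub>v h"])
  qed
  moreover have "(\<Union>w \<sigma>. set (cols (mat_word n A w * G \<sigma>))) \<subseteq> U"
  proof clarify
    fix x v \<sigma> assume "x \<in> set (cols (mat_word n A v * G \<sigma>))"
    then obtain j where j: "j < q" "x = col (mat_word n A v * G \<sigma>) j"
      using G[of \<sigma>] by (auto simp: cols_def)
    have g: "col (G \<sigma>) j \<in> carrier_vec n" using G[of \<sigma>] by auto
    have x: "x = mat_word n A v *\<^sub>v col (G \<sigma>) j" unfolding j(2) by (rule col_mult2[OF W G j(1)])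
    obtain h where h: "h \<in> carrier_vec n'" "R (col (G \<sigma>) j) h"
      using resp[OF j(1)] unfolding R_def by blast
    have Rx: "R x (mat_word n' A' v *\<^sub>v h)"
      using h unfolding R_def x
      by (simp add: mat_word_append_vec[of A n, OF A g] mat_word_append_vec[of A' n', OF A'])
    have "x \<in> carrier_vec n" unfolding x by (rule mult_mat_vec_carrier[OF W g])
    then show "x \<in> U"
      unfolding U_def using Rx mult_mat_vec_carrier[OF W' h(1), of v] by (intro CollectI conjI bexI)
  qed
  ultimately have "span (\<Union>w \<sigma>. set (cols (mat_word n A w * G \<sigma>))) \<subseteq> U"
    by (rule span_is_subset[rotated])
  then have all: "\<exists>h\<in>carrier_vec n'. R g h" if "g \<in> carrier_vec n" for g
    using reach that unfolding U_def by blast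
  have "\<forall>i\<in>{..<n}. \<exists>h. h \<in> carrier_vec n' \<and> R (unit_vec n i) h"
    using all[OF unit_vec_carrier] by blast
  from bchoice[OF this] obtain h where
    "\<forall>i\<in>{..<n}. h i \<in> carrier_vec n' \<and> R (unit_vec n i) (h i)" ..
  then have h: "h i \<in> carrier_vec n' \<and> R (unit_vec n i) (h i)" if "i < n" for i
    using that by simp
  define X where "X = mat n' n (\<lambda>(r, i). h i $ r)"
  have X: "X \<in> carrier_mat n' n" by (simp add: X_def)
  have colX: "col X i = h i" if "i < n" for i
    using that h[OF that] by (intro eq_vecI) (auto simp: X_def)
  have CA: "C * mat_word n A w = C' * mat_word n' A' w * X" for w
  proof (rule mat_col_eqI)
    have CW: "C * mat_word n A w \<in> carrier_mat ny n" "C' * mat_word n' A' w \<in> carrier_mat ny n'"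
      using C W C' W' by auto
    fix i assume "i < dim_col (C' * mat_word n' A' w * X)"
    then have i: "i < n" using X by simp
    have "col (C * mat_word n A w) i = (C * mat_word n A w) *\<^sub>v unit_vec n i"
      by (rule mult_mat_vec_unit_vec[OF CW(1) i, symmetric])
    also have "\<dots> = C *\<^sub>v (mat_word n A w *\<^sub>v unit_vec n i)"
      by (rule assoc_mult_mat_vec[OF C W]) simp
    also have "\<dots> = C' *\<^sub>v (mat_word n' A' w *\<^sub>v h i)"
      using h[OF i] unfolding R_def by blast
    also have "\<dots> = (C' * mat_word n' A' w) *\<^sub>v col X i"
      using assoc_mult_mat_vec[OF C' W', of "h i"] h[OF i] colX[OF i] by simp
    also have "\<dots> = col (C' * mat_word n' A' w * X) i"
      by (rule col_mult2[OF CW(2) X i, symmetric])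
    finally show "col (C * mat_word n A w) i = col (C' * mat_word n' A' w * X) i" .
  qed (use C W C' W' X in auto)
  show ?thesis
  proof (rule injective_mat_dim_le[OF X])
    fix v assume v: "v \<in> carrier_vec n" "X *\<^sub>v v = 0\<^sub>v n'"
    have "v \<in> mat_kernel (C * mat_word n A w)" for w
    proof (rule mat_kernelI[of _ ny n])
      show "C * mat_word n A w \<in> carrier_mat ny n" using C W by auto
      have CW': "C' * mat_word n' A' w \<in> carrier_mat ny n'" using C' W' by auto
      show "(C * mat_word n A w) *\<^sub>v v = 0\<^sub>v ny"
        unfolding CA assoc_mult_mat_vec[OF CW' X v(1)] v(2) by (rule mult_mat_vec_zero[OF CW'])
    qed (rule v)
    then show "v = 0\<^sub>v n" using obs by blast
  qed
qed

section \<open>State processes\<close>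

text \<open>
  The terms of depth less than \<open>N\<close> in the expansion of the state, multiplied by the switching word \<open>q\<close>, that
  come from the noise components in \<open>J\<close>. The recursion prepends letters to \<open>q\<close>, because each use
  of the state equation goes one step further into the past.
\<close>
primrec innov ::
  "('a, 's::finite) switching \<Rightarrow> ('s \<Rightarrow> real) \<Rightarrow> nat \<Rightarrow> ('s \<Rightarrow> real mat) \<Rightarrow> ('s \<Rightarrow> nat \<Rightarrow> nat \<Rightarrow> real) \<Rightarrow>
   (nat \<Rightarrow> int \<Rightarrow> 'a \<Rightarrow> real) \<Rightarrow> nat set \<Rightarrow> nat \<Rightarrow> 's list \<Rightarrow> int \<Rightarrow> nat \<Rightarrow> 'a \<Rightarrow> real" where
  "innov mu p n A B e J 0 q t k = (\<lambda>\<omega>. 0)"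
| "innov mu p n A B e J (Suc N) q t k = (\<lambda>\<omega>. \<Sum>\<sigma>\<in>UNIV. sqrt (p \<sigma>) *
    ((\<Sum>l<n. A \<sigma> $$ (k, l) * innov mu p n A B e J N (\<sigma> # q) t l \<omega>) +
     (\<Sum>l\<in>J. B \<sigma> k l * zs mu p (e l) (\<sigma> # q) t \<omega>)))"

text \<open>What remains of the state after \<open>N\<close> substitutions of the state equation.\<close>
primrec resid ::
  "('a, 's::finite) switching \<Rightarrow> ('s \<Rightarrow> real) \<Rightarrow> nat \<Rightarrow> ('s \<Rightarrow> real mat) \<Rightarrow>
   (nat \<Rightarrow> int \<Rightarrow> 'a \<Rightarrow> real) \<Rightarrow> nat \<Rightarrow> 's list \<Rightarrow> int \<Rightarrow> nat \<Rightarrow> 'a \<Rightarrow> real" where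
  "resid mu p n A x 0 q t k = zs mu p (x k) q t"
| "resid mu p n A x (Suc N) q t k = (\<lambda>\<omega>. \<Sum>\<sigma>\<in>UNIV. sqrt (p \<sigma>) *
    (\<Sum>l<n. A \<sigma> $$ (k, l) * resid mu p n A x N (\<sigma> # q) t l \<omega>))"

lemma innov_cong:
  assumes "\<And>\<sigma> k l. k < n \<Longrightarrow> l \<in> J \<Longrightarrow> B \<sigma> k l = B' \<sigma> k l"
    "\<And>l t. l \<in> J \<Longrightarrow> e l t \<omega> = e' l t \<omega>" "k < n"
  shows "innov mu p n A B e J N q t k \<omega> = innov mu p n A B' e' J N q t k \<omega>"
  using assms(3)
proof (induction N arbitrary: q k)
  case (Suc N)
  then show ?case using assms(1,2)
    by (auto simp: zs_def intro!: sum.cong arg_cong2[of _ _ _ _ "(+)"] arg_cong[of _ _ "(*) _"])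
qed simp

lemma innov_Un:
  assumes "finite J" "finite J'" "J \<inter> J' = {}"
  shows "innov mu p n A B e (J \<union> J') N q t k \<omega> =
    innov mu p n A B e J N q t k \<omega> + innov mu p n A B e J' N q t k \<omega>"
proof (induction N arbitrary: q k)
  case (Suc N)
  then show ?case
    by (simp add: sum.union_disjoint[OF assms] ring_distribs sum.distrib)
qed simp

text \<open>
  A stationary state process in scalar form. It is used three times: for the given system and for
  the competitor, both with noise $[v^T, u^T]^T$, and for the stochastic part of the given system, with noise \<open>v\<close>.
  \<open>B\<close> collects the matrices of all noise components. The condition on transitions outside \<open>E\<close> carries no covariance factor, since
  the covariance of a white noise is nonsingular.
\<close>
locale state_process = switching M mu E p
  for M :: "'a measure" and mu :: "('a, 's::finite) switching" and E p +
  fixes nx m :: nat and A :: "'s \<Rightarrow> real mat" and B :: "'s \<Rightarrow> nat \<Rightarrow> nat \<Rightarrow> real"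
    and x e :: "nat \<Rightarrow> int \<Rightarrow> 'a \<Rightarrow> real"
  assumes joint: "joint (x ` {..<nx} \<union> e ` {..<m})"
    and A_carrier: "A \<sigma> \<in> carrier_mat nx nx"
    and state: "k < nx \<Longrightarrow> AE \<omega> in M. x k (t + 1) \<omega> =
      (\<Sum>\<sigma>\<in>UNIV. ((\<Sum>l<nx. A \<sigma> $$ (k, l) * x l t \<omega>) + (\<Sum>l<m. B \<sigma> k l * e l t \<omega>)) * mu \<sigma> t \<omega>)"
    and white: "k < m \<Longrightarrow> l < m \<Longrightarrow> w \<noteq> [] \<Longrightarrow> v \<noteq> [] \<Longrightarrow> w \<noteq> v \<Longrightarrow>
      ip M (zs mu p (e k) w t) (zs mu p (e l) v t) = 0"
    and state_noise_letter: "k < nx \<Longrightarrow> l < m \<Longrightarrow> ip M (zs mu p (x k) [\<sigma>] t) (zs mu p (e l) [\<sigma>] t) = 0"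
    and state_noise: "k < nx \<Longrightarrow> l < m \<Longrightarrow> w \<noteq> [] \<Longrightarrow> ip M (zs mu p (x k) w t) (e l t) = 0"
    and stable: "stable p nx A"
    and dead_AA: "(\<sigma>, \<tau>) \<notin> E \<Longrightarrow> A \<tau> * A \<sigma> = 0\<^sub>m nx nx"
    and dead_AB: "(\<sigma>, \<tau>) \<notin> E \<Longrightarrow> i < nx \<Longrightarrow> l < m \<Longrightarrow> (\<Sum>k<nx. A \<tau> $$ (i, k) * B \<sigma> k l) = 0"
begin

abbreviation "X \<equiv> x ` {..<nx} \<union> e ` {..<m}"
abbreviation "innovation \<equiv> innov mu p nx A B e"
abbreviation "residual \<equiv> resid mu p nx A x"

lemma sq_X: "f \<in> X \<Longrightarrow> square_integrable M (Z f w t)"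
  by (rule joint_square_integrable[OF joint])

lemma sq_X': "f \<in> X \<Longrightarrow> square_integrable M (f t)"
  using sq_X[of f "[]"] by simp

lemma sq_x: "k < nx \<Longrightarrow> square_integrable M (Z (x k) w t)"
  and sq_e: "l < m \<Longrightarrow> square_integrable M (Z (e l) w t)"
  by (auto intro!: sq_X)

text \<open>The state equation multiplied by the switching word \<open>q\<close>.\<close>
lemma state_Z:
  assumes "k < nx"
  shows "AE \<omega> in M. Z (x k) q t \<omega> = (\<Sum>\<sigma>\<in>UNIV. sqrt (p \<sigma>) *
    ((\<Sum>l<nx. A \<sigma> $$ (k, l) * Z (x l) (\<sigma> # q) t \<omega>) + (\<Sum>l<m. B \<sigma> k l * Z (e l) (\<sigma> # q) t \<omega>)))"
  using state[OF assms, of "t - int (length q) - 1"]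
proof eventually_elim
  case (elim \<omega>)
  define s where "s = t - int (length q) - 1"
  define c where "c = mu_word mu q (t - 1) \<omega> / sqrt (p_word p q)"
  have Zq: "Z (x k) q t \<omega> = c * x k (s + 1) \<omega>" by (simp add: zs_def c_def s_def)
  have Zc: "sqrt (p \<sigma>) * Z f (\<sigma> # q) t \<omega> = c * (f s \<omega> * mu \<sigma> s \<omega>)" for f \<sigma>
  proof -
    have "sqrt (p \<sigma>) \<noteq> 0" using p_pos[of \<sigma>] by (simp del: p_pos)
    moreover have "mu_word mu (\<sigma> # q) (t - 1) \<omega> = mu \<sigma> s \<omega> * mu_word mu q (t - 1) \<omega>"
      by (simp add: mu_word_Cons s_def algebra_simps)
    moreover have "t - (1 + int (length q)) = s" by (simp add: s_def)
    ultimately show ?thesis by (simp add: zs_def c_def real_sqrt_mult)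
  qed
  have "(\<Sum>\<sigma>\<in>UNIV. sqrt (p \<sigma>) *
    ((\<Sum>l<nx. A \<sigma> $$ (k, l) * Z (x l) (\<sigma> # q) t \<omega>) + (\<Sum>l<m. B \<sigma> k l * Z (e l) (\<sigma> # q) t \<omega>))) =
    (\<Sum>\<sigma>\<in>UNIV. (\<Sum>l<nx. A \<sigma> $$ (k, l) * (sqrt (p \<sigma>) * Z (x l) (\<sigma> # q) t \<omega>)) +
       (\<Sum>l<m. B \<sigma> k l * (sqrt (p \<sigma>) * Z (e l) (\<sigma> # q) t \<omega>)))"
    by (simp add: distrib_left sum_distrib_left mult.left_commute)
  also have "\<dots> = (\<Sum>\<sigma>\<in>UNIV. c * (((\<Sum>l<nx. A \<sigma> $$ (k, l) * x l s \<omega>) + (\<Sum>l<m. B \<sigma> k l * e l s \<omega>)) * mu \<sigma> s \<omega>))"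
    unfolding Zc by (simp add: distrib_left distrib_right sum_distrib_left sum_distrib_right mult.left_commute mult.assoc)
  also have "\<dots> = c * x k (s + 1) \<omega>"
    using elim by (simp add: s_def sum_distrib_left)
  finally show ?case using Zq by simp
qed

lemma sq_innovation:
  assumes "J \<subseteq> {..<m}"
  shows "k < nx \<Longrightarrow> square_integrable M (innovation J N q t k)"
proof (induction N arbitrary: q k)
  case (Suc N)
  show ?case using assms
    by (auto intro!: sq_int_sum sq_int_cmult sq_int_add Suc.IH sq_e)
qed simp

lemma sq_residual: "k < nx \<Longrightarrow> square_integrable M (residual N q t k)"
proof (induction N arbitrary: q k)
  case 0 then show ?case by (simp add: sq_x)
next
  case (Suc N)
  show ?case by (auto intro!: sq_int_sum sq_int_cmult Suc.IH)
qed

lemma state_decomposition: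
  assumes "k < nx"
  shows "AE \<omega> in M. Z (x k) q t \<omega> = innovation {..<m} N q t k \<omega> + residual N q t k \<omega>"
  using assms
proof (induction N arbitrary: q k)
  case 0 then show ?case by simp
next
  case (Suc N)
  have "AE \<omega> in M. \<forall>\<sigma>\<in>UNIV. \<forall>l\<in>{..<nx}. Z (x l) (\<sigma> # q) t \<omega> =
      innovation {..<m} N (\<sigma> # q) t l \<omega> + residual N (\<sigma> # q) t l \<omega>"
    using Suc.IH by (simp add: AE_ball_countable AE_all_countable)
  then show ?case using state_Z[OF Suc.prems, of q t]
  proof eventually_elim
    case (elim \<omega>)
    show ?case unfolding elim(2) using elim(1)
      by (simp add: sum.distrib distrib_left)
  qed
qed

lemma ip_innovation_zero:
  assumes J: "J \<subseteq> {..<m}" and f: "square_integrable M f"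
    and orth: "\<And>l q. l \<in> J \<Longrightarrow> q \<noteq> [] \<Longrightarrow> ip M f (Z (e l) q t) = 0"
  shows "k < nx \<Longrightarrow> ip M f (innovation J N q t k) = 0"
proof (induction N arbitrary: q k)
  case (Suc N)
  have sq: "square_integrable M (\<lambda>\<omega>. \<Sum>l<nx. A \<sigma> $$ (k, l) * innovation J N (\<sigma> # q) t l \<omega>)"
    "square_integrable M (\<lambda>\<omega>. \<Sum>l\<in>J. B \<sigma> k l * Z (e l) (\<sigma> # q) t \<omega>)" for \<sigma>
    using J by (auto intro!: sq_int_lincomb sq_innovation sq_e)
  have "ip M f (\<lambda>\<omega>. (\<Sum>l<nx. A \<sigma> $$ (k, l) * innovation J N (\<sigma> # q) t l \<omega>) +
        (\<Sum>l\<in>J. B \<sigma> k l * Z (e l) (\<sigma> # q) t \<omega>)) = 0" for \<sigma>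
  proof -
    have "ip M f (\<lambda>\<omega>. \<Sum>l<nx. A \<sigma> $$ (k, l) * innovation J N (\<sigma> # q) t l \<omega>) = 0"
      by (subst ip_lincomb_right) (use J f Suc.IH in \<open>auto intro!: sq_innovation\<close>)
    moreover have "ip M f (\<lambda>\<omega>. \<Sum>l\<in>J. B \<sigma> k l * Z (e l) (\<sigma> # q) t \<omega>) = 0"
      by (subst ip_lincomb_right) (use J f orth in \<open>auto intro!: sq_e\<close>)
    ultimately show ?thesis by (simp add: ip_add_right[OF sq f])
  qed
  then show ?case
    using sq by (simp add: ip_lincomb_right f sq_int_add)
qed simp

subsection \<open>The residual vanishes\<close>

text \<open>
  Fixed linear combinations of the residual components. Their variances as quadratic forms in \<open>f\<close> carry the
  order of positive semidefinite matrices, in which the covariances are compared.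
\<close>
definition res_comb :: "nat \<Rightarrow> 's list \<Rightarrow> int \<Rightarrow> (nat \<Rightarrow> real) \<Rightarrow> 'a \<Rightarrow> real" where
  "res_comb N q t f \<omega> = (\<Sum>k<nx. f k * residual N q t k \<omega>)"

lemma sq_res_comb: "square_integrable M (res_comb N q t f)"
  unfolding res_comb_def[abs_def] by (auto intro!: sq_int_lincomb sq_residual)

lemma res_comb_Suc:
  "res_comb (Suc N) q t f \<omega> =
    (\<Sum>\<sigma>\<in>UNIV. sqrt (p \<sigma>) * res_comb N (\<sigma> # q) t (\<lambda>l. \<Sum>k<nx. f k * A \<sigma> $$ (k, l)) \<omega>)"
proof -
  have "res_comb (Suc N) q t f \<omega> =
    (\<Sum>k<nx. \<Sum>\<sigma>\<in>UNIV. \<Sum>l<nx. sqrt (p \<sigma>) * (f k * A \<sigma> $$ (k, l) * residual N (\<sigma> # q) t l \<omega>))"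
    unfolding res_comb_def by (simp add: sum_distrib_left ac_simps)
  also have "\<dots> = (\<Sum>\<sigma>\<in>UNIV. \<Sum>k<nx. \<Sum>l<nx. sqrt (p \<sigma>) * (f k * A \<sigma> $$ (k, l) * residual N (\<sigma> # q) t l \<omega>))"
    by (rule sum.swap)
  also have "\<dots> = (\<Sum>\<sigma>\<in>UNIV. \<Sum>l<nx. \<Sum>k<nx. sqrt (p \<sigma>) * (f k * A \<sigma> $$ (k, l) * residual N (\<sigma> # q) t l \<omega>))"
    by (intro sum.cong refl sum.swap)
  also have "\<dots> = (\<Sum>\<sigma>\<in>UNIV. sqrt (p \<sigma>) * res_comb N (\<sigma> # q) t (\<lambda>l. \<Sum>k<nx. f k * A \<sigma> $$ (k, l)) \<omega>)"
    unfolding res_comb_def by (simp add: sum_distrib_left sum_distrib_right)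
  finally show ?thesis .
qed

text \<open>
  Residuals for different words of equal length are combinations of state words that are again
  different and of equal length.
\<close>
lemma res_comb_orthogonal:
  "length q = length q' \<Longrightarrow> q \<noteq> q' \<Longrightarrow> ip M (res_comb N q t f) (res_comb N q' t g) = 0"
proof (induction N arbitrary: q q' f g)
  case 0
  have "ip M (Z (x k) q t) (Z (x l) q' t) = 0" if "k < nx" "l < nx" for k l
    using 0 that by (intro ip_Z_same_length[OF joint]) auto
  then show ?case
    unfolding res_comb_def[abs_def] resid.simps by (subst ip_lincomb2) (auto intro!: sq_x)
next
  case (Suc N)
  have "ip M (res_comb N (\<sigma> # q) t f) (res_comb N (\<tau> # q') t g) = 0" for \<sigma> \<tau> f g
    using Suc.prems by (intro Suc.IH) auto
  then show ?case
    unfolding res_comb_Suc[abs_def]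
    by (simp add: ip_lincomb_left ip_lincomb_right sq_int_lincomb sq_res_comb)
qed

definition quad :: "(nat \<Rightarrow> real) \<Rightarrow> (nat \<Rightarrow> nat \<Rightarrow> real) \<Rightarrow> real" where
  "quad f P = (\<Sum>k<nx. \<Sum>l<nx. f k * f l * P k l)"

lemma quad_lyapunov:
  "quad f (lyapunov p nx A P) = (\<Sum>\<sigma>\<in>UNIV. p \<sigma> * quad (\<lambda>l. \<Sum>k<nx. f k * A \<sigma> $$ (k, l)) P)"
proof -
  have "quad f (lyapunov p nx A P) = (\<Sum>k<nx. \<Sum>l<nx. \<Sum>\<sigma>\<in>UNIV. p \<sigma> *
      (\<Sum>a<nx. \<Sum>b<nx. (f k * A \<sigma> $$ (k, a)) * (f l * A \<sigma> $$ (l, b)) * P a b))"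
    unfolding quad_def lyapunov_def by (simp add: sum_distrib_left ac_simps)
  also have "\<dots> = (\<Sum>\<sigma>\<in>UNIV. \<Sum>k<nx. \<Sum>l<nx. p \<sigma> *
      (\<Sum>a<nx. \<Sum>b<nx. (f k * A \<sigma> $$ (k, a)) * (f l * A \<sigma> $$ (l, b)) * P a b))"
    by (subst (2) sum.swap, subst sum.swap) simp
  also have "\<dots> = (\<Sum>\<sigma>\<in>UNIV. p \<sigma> * (\<Sum>k<nx. \<Sum>l<nx. \<Sum>a<nx. \<Sum>b<nx.
      (f k * A \<sigma> $$ (k, a)) * (f l * A \<sigma> $$ (l, b)) * P a b))"
    by (simp add: sum_distrib_left)
  also have "\<dots> = (\<Sum>\<sigma>\<in>UNIV. p \<sigma> * (\<Sum>a<nx. \<Sum>b<nx. \<Sum>k<nx. \<Sum>l<nx.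
      (f k * A \<sigma> $$ (k, a)) * (f l * A \<sigma> $$ (l, b)) * P a b))"
  proof (rule sum.cong[OF refl], rule arg_cong[of _ _ "(*) _"])
    fix \<sigma>
    let ?T = "\<lambda>k l a b. (f k * A \<sigma> $$ (k, a)) * (f l * A \<sigma> $$ (l, b)) * P a b"
    have "(\<Sum>k<nx. \<Sum>l<nx. \<Sum>a<nx. \<Sum>b<nx. ?T k l a b) = (\<Sum>k<nx. \<Sum>a<nx. \<Sum>l<nx. \<Sum>b<nx. ?T k l a b)"
      by (intro sum.cong refl sum.swap)
    also have "\<dots> = (\<Sum>a<nx. \<Sum>k<nx. \<Sum>l<nx. \<Sum>b<nx. ?T k l a b)" by (rule sum.swap)
    also have "\<dots> = (\<Sum>a<nx. \<Sum>k<nx. \<Sum>b<nx. \<Sum>l<nx. ?T k l a b)"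
      by (intro sum.cong refl sum.swap)
    also have "\<dots> = (\<Sum>a<nx. \<Sum>b<nx. \<Sum>k<nx. \<Sum>l<nx. ?T k l a b)"
      by (intro sum.cong refl sum.swap)
    finally show "(\<Sum>k<nx. \<Sum>l<nx. \<Sum>a<nx. \<Sum>b<nx. ?T k l a b) = (\<Sum>a<nx. \<Sum>b<nx. \<Sum>k<nx. \<Sum>l<nx. ?T k l a b)" .
  qed
  also have "\<dots> = (\<Sum>\<sigma>\<in>UNIV. p \<sigma> * quad (\<lambda>l. \<Sum>k<nx. f k * A \<sigma> $$ (k, l)) P)"
  proof -
    have "(\<Sum>k<nx. f k * A \<sigma> $$ (k, a)) * (\<Sum>l<nx. f l * A \<sigma> $$ (l, b)) * P a b =
      (\<Sum>k<nx. \<Sum>l<nx. (f k * A \<sigma> $$ (k, a)) * (f l * A \<sigma> $$ (l, b)) * P a b)" for \<sigma> a b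
      by (simp only: sum_product) (simp only: sum_distrib_right)
    then show ?thesis by (simp only: quad_def)
  qed
  finally show ?thesis .
qed

text \<open>
  A common upper bound for the state covariances that \<open>ip_Z_same_word\<close> attaches to the different nonempty words:
  the sum over all first letters.
\<close>
definition letter_cov :: "nat \<Rightarrow> nat \<Rightarrow> real" where
  "letter_cov k l = (\<Sum>\<sigma>\<in>UNIV. ip M (Z (x k) [\<sigma>] 0) (Z (x l) [\<sigma>] 0))"

text \<open>
  By orthogonality the covariance for \<open>q\<close> at depth \<open>Suc N\<close> is the sum of those for \<open>\<sigma> # q\<close> at depth \<open>N\<close>,
  transformed as in \<^const>\<open>lyapunov\<close>. These depend on the word, which is why they are bounded by the iterates
  of a single matrix.
\<close>
lemma res_comb_bound:
  "q \<noteq> [] \<Longrightarrow> ip M (res_comb N q t f) (res_comb N q t f) \<le> quad f ((lyapunov p nx A ^^ N) letter_cov)"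
proof (induction N arbitrary: q f)
  case 0
  have exp: "ip M (\<lambda>\<omega>. \<Sum>k<nx. f k * Z (x k) w s \<omega>) (\<lambda>\<omega>. \<Sum>k<nx. f k * Z (x k) w s \<omega>) =
      (\<Sum>k<nx. \<Sum>l<nx. f k * f l * ip M (Z (x k) w s) (Z (x l) w s))" for w s
    by (rule ip_lincomb2) (auto intro!: sq_x)
  obtain \<sigma> w where q: "q = \<sigma> # w" using 0 by (cases q) auto
  define I where "I \<tau> = ip M (\<lambda>\<omega>. \<Sum>k<nx. f k * Z (x k) [\<tau>] 0 \<omega>) (\<lambda>\<omega>. \<Sum>k<nx. f k * Z (x k) [\<tau>] 0 \<omega>)" for \<tau>
  have "ip M (res_comb 0 q t f) (res_comb 0 q t f) =
      (\<Sum>k<nx. \<Sum>l<nx. f k * f l * ip M (Z (x k) q t) (Z (x l) q t))"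
    unfolding res_comb_def[abs_def] by (simp add: exp)
  also have "\<dots> = (\<Sum>k<nx. \<Sum>l<nx. f k * f l * (if q \<in> L then ip M (Z (x k) [\<sigma>] 0) (Z (x l) [\<sigma>] 0) else 0))"
    unfolding q by (intro sum.cong refl arg_cong[of _ _ "(*) _"] ip_Z_same_word[OF joint]) auto
  also have "\<dots> = (if q \<in> L then I \<sigma> else 0)" unfolding I_def exp by simp
  also have "\<dots> \<le> I \<sigma>" by (simp add: I_def ip_nonneg)
  also have "\<dots> \<le> (\<Sum>\<tau>\<in>UNIV. I \<tau>)"
    by (rule member_le_sum) (auto simp: I_def ip_nonneg)
  also have "\<dots> = quad f letter_cov"
  proof -
    let ?T = "\<lambda>\<tau> k l. f k * f l * ip M (Z (x k) [\<tau>] 0) (Z (x l) [\<tau>] 0)"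
    have "(\<Sum>\<tau>\<in>UNIV. \<Sum>k<nx. \<Sum>l<nx. ?T \<tau> k l) = (\<Sum>k<nx. \<Sum>\<tau>\<in>UNIV. \<Sum>l<nx. ?T \<tau> k l)"
      by (rule sum.swap)
    also have "\<dots> = (\<Sum>k<nx. \<Sum>l<nx. \<Sum>\<tau>\<in>UNIV. ?T \<tau> k l)"
      by (intro sum.cong refl sum.swap)
    finally show ?thesis unfolding I_def exp quad_def letter_cov_def by (simp add: sum_distrib_left)
  qed
  finally show ?case by simp
next
  case (Suc N)
  define g where "g \<sigma> = (\<lambda>l. \<Sum>k<nx. f k * A \<sigma> $$ (k, l))" for \<sigma>
  define I where "I \<sigma> \<tau> = ip M (res_comb N (\<sigma> # q) t (g \<sigma>)) (res_comb N (\<tau> # q) t (g \<tau>))" for \<sigma> \<tau>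
  have I0: "I \<sigma> \<tau> = 0" if "\<sigma> \<noteq> \<tau>" for \<sigma> \<tau>
    unfolding I_def using that by (intro res_comb_orthogonal) auto
  have "ip M (res_comb (Suc N) q t f) (res_comb (Suc N) q t f) =
      (\<Sum>\<sigma>\<in>UNIV. sqrt (p \<sigma>) * (\<Sum>\<tau>\<in>UNIV. sqrt (p \<tau>) * I \<sigma> \<tau>))"
    unfolding res_comb_Suc[abs_def] I_def g_def
    by (simp add: ip_lincomb_left ip_lincomb_right sq_int_lincomb sq_res_comb)
  also have "\<dots> = (\<Sum>\<sigma>\<in>UNIV. sqrt (p \<sigma>) * (\<Sum>\<tau>\<in>UNIV. if \<tau> = \<sigma> then sqrt (p \<sigma>) * I \<sigma> \<sigma> else 0))"
    by (intro sum.cong refl arg_cong[of _ _ "(*) _"]) (auto simp: I0)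
  also have "\<dots> = (\<Sum>\<sigma>\<in>UNIV. p \<sigma> * I \<sigma> \<sigma>)"
  proof (intro sum.cong refl)
    fix \<sigma>
    have "sqrt (p \<sigma>) * sqrt (p \<sigma>) = p \<sigma>" using p_pos[of \<sigma>] by (simp del: p_pos)
    then show "sqrt (p \<sigma>) * (\<Sum>\<tau>\<in>UNIV. if \<tau> = \<sigma> then sqrt (p \<sigma>) * I \<sigma> \<sigma> else 0) = p \<sigma> * I \<sigma> \<sigma>"
      by (simp add: mult.assoc[symmetric])
  qed
  also have "\<dots> \<le> (\<Sum>\<sigma>\<in>UNIV. p \<sigma> * quad (g \<sigma>) ((lyapunov p nx A ^^ N) letter_cov))"
    unfolding I_def by (intro sum_mono mult_left_mono Suc.IH) (simp_all add: less_imp_le)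
  also have "\<dots> = quad f ((lyapunov p nx A ^^ Suc N) letter_cov)"
    by (simp add: quad_lyapunov g_def)
  finally show ?case .
qed

lemma residual_tendsto_zero:
  assumes "k < nx" "q \<noteq> []"
  shows "(\<lambda>N. ip M (residual N q t k) (residual N q t k)) \<longlonglongrightarrow> 0"
proof (rule tendsto_sandwich[OF _ _ tendsto_const])
  show "(\<lambda>N. (lyapunov p nx A ^^ N) letter_cov k k) \<longlonglongrightarrow> 0"
    by (rule stable_lyapunov_tendsto_zero[OF stable A_carrier assms(1) assms(1)])
  have "ip M (residual N q t k) (residual N q t k) \<le> (lyapunov p nx A ^^ N) letter_cov k k" for N
  proof -
    have "res_comb N q t (\<lambda>l. if l = k then 1 else 0) = residual N q t k"
      using assms(1) by (auto simp: res_comb_def if_distrib[of "\<lambda>c. c * _"] cong: if_cong)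
    moreover have "quad (\<lambda>l. if l = k then 1 else 0) P = P k k" for P
    proof -
      have "quad (\<lambda>l. if l = k then 1 else 0) P =
          (\<Sum>a<nx. if a = k then \<Sum>b<nx. if b = k then P k k else 0 else 0)"
        unfolding quad_def
        by (intro sum.cong) (auto simp: if_distrib[of "\<lambda>c. c * _"] cong: if_cong)
      then show ?thesis using assms(1) by simp
    qed
    ultimately show ?thesis
      using res_comb_bound[OF assms(2), of N t "\<lambda>l. if l = k then 1 else 0"] by simp
  qed
  then show "\<forall>\<^sub>F N in sequentially. ip M (residual N q t k) (residual N q t k) \<le> (lyapunov p nx A ^^ N) letter_cov k k"
    by simp
qed (simp add: ip_nonneg)

lemma ip_residual_tendsto_zero:
  assumes "k < nx" "q \<noteq> []" and f: "square_integrable M f"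
  shows "(\<lambda>N. ip M f (residual N q t k)) \<longlonglongrightarrow> 0"
proof (rule Lim_null_comparison)
  show "\<forall>\<^sub>F N in sequentially. norm (ip M f (residual N q t k)) \<le>
      sqrt (ip M f f) * sqrt (ip M (residual N q t k) (residual N q t k))"
    using ip_Cauchy_Schwarz[OF f sq_residual[OF assms(1)]] by simp
  show "(\<lambda>N. sqrt (ip M f f) * sqrt (ip M (residual N q t k) (residual N q t k))) \<longlonglongrightarrow> 0"
    using tendsto_mult_right_zero[OF tendsto_real_sqrt[OF residual_tendsto_zero[OF assms(1,2)], simplified]]
    by simp
qed

subsection \<open>Correlations of the state with its past\<close>

text \<open>
  For noise components this follows from the white noise property after lifting the empty word to
  one letter and \<open>w\<close> to a word of at least two letters.
\<close>
lemma noise_orthogonal_past: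
  assumes "l < m" "f \<in> X" "w \<noteq> []"
  shows "ip M (e l t) (Z f w t) = 0"
proof -
  consider k where "k < nx" "f = x k" | k where "k < m" "f = e k" using assms(2) by auto
  then show ?thesis
  proof cases
    case 1
    then show ?thesis using state_noise[OF 1(1) assms(1,3)] by (simp add: ip_commute)
  next
    case 2
    obtain \<alpha> where \<alpha>: "AE \<omega> in M. Z f w t \<omega> = (\<Sum>\<sigma>\<in>UNIV. \<alpha> \<sigma> * Z f (w @ [\<sigma>]) (t + 1) \<omega>)" for f w t
      using obtain_lift by blast
    have "ip M (Z (e l) [] t) (Z (e k) w t) =
       ip M (\<lambda>\<omega>. \<Sum>\<sigma>\<in>UNIV. \<alpha> \<sigma> * Z (e l) ([] @ [\<sigma>]) (t + 1) \<omega>) (\<lambda>\<omega>. \<Sum>\<sigma>\<in>UNIV. \<alpha> \<sigma> * Z (e k) (w @ [\<sigma>]) (t + 1) \<omega>)"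
      by (intro ip_cong_AE \<alpha> sq_int_measurable sq_int_lincomb)
         (use 2 assms(1) in \<open>auto intro!: sq_e simp del: zs_Nil\<close>)
    also have "\<dots> = 0"
    proof -
      have "ip M (Z (e l) [\<sigma>] (t + 1)) (Z (e k) (w @ [\<tau>]) (t + 1)) = 0" for \<sigma> \<tau>
        using 2 assms by (intro white) auto
      then show ?thesis using 2 assms(1)
        by (subst ip_lincomb2) (auto intro!: sq_e)
    qed
    finally show ?thesis using 2 by simp
  qed
qed

lemma ip_state_snoc:
  assumes k: "k < nx" and f: "f \<in> X"
  shows "ip M (x k t) (Z f (w @ [\<sigma>]) t) = sqrt (p \<sigma>) *
    ((\<Sum>l<nx. A \<sigma> $$ (k, l) * ip M (Z (x l) [\<sigma>] t) (Z f (w @ [\<sigma>]) t)) +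
     (\<Sum>l<m. B \<sigma> k l * ip M (Z (e l) [\<sigma>] t) (Z f (w @ [\<sigma>]) t)))"
proof -
  let ?F = "Z f (w @ [\<sigma>]) t"
  have sqF: "square_integrable M ?F" by (rule sq_X[OF f])
  have sqs: "square_integrable M (\<lambda>\<omega>. \<Sum>l<nx. A \<tau> $$ (k, l) * Z (x l) [\<tau>] t \<omega>)"
    "square_integrable M (\<lambda>\<omega>. \<Sum>l<m. B \<tau> k l * Z (e l) [\<tau>] t \<omega>)" for \<tau>
    by (auto intro!: sq_int_lincomb sq_x sq_e)
  have "ip M (Z (x k) [] t) ?F = ip M (\<lambda>\<omega>. \<Sum>\<tau>\<in>UNIV. sqrt (p \<tau>) *
    ((\<Sum>l<nx. A \<tau> $$ (k, l) * Z (x l) [\<tau>] t \<omega>) + (\<Sum>l<m. B \<tau> k l * Z (e l) [\<tau>] t \<omega>))) ?F"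
  proof (rule ip_cong_AE)
    show "AE \<omega> in M. Z (x k) [] t \<omega> = (\<Sum>\<tau>\<in>UNIV. sqrt (p \<tau>) *
      ((\<Sum>l<nx. A \<tau> $$ (k, l) * Z (x l) [\<tau>] t \<omega>) + (\<Sum>l<m. B \<tau> k l * Z (e l) [\<tau>] t \<omega>)))"
      by (rule state_Z[OF k])
    have "square_integrable M (\<lambda>\<omega>. \<Sum>\<tau>\<in>UNIV. sqrt (p \<tau>) *
      ((\<Sum>l<nx. A \<tau> $$ (k, l) * Z (x l) [\<tau>] t \<omega>) + (\<Sum>l<m. B \<tau> k l * Z (e l) [\<tau>] t \<omega>)))"
      by (intro sq_int_sum sq_int_cmult sq_int_add sqs)
    then show "(\<lambda>\<omega>. \<Sum>\<tau>\<in>UNIV. sqrt (p \<tau>) *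
      ((\<Sum>l<nx. A \<tau> $$ (k, l) * Z (x l) [\<tau>] t \<omega>) + (\<Sum>l<m. B \<tau> k l * Z (e l) [\<tau>] t \<omega>))) \<in> borel_measurable M"
      by (rule sq_int_measurable)
  qed (use k sqF sq_x sq_int_measurable in blast)+
  also have "\<dots> = (\<Sum>\<tau>\<in>UNIV. sqrt (p \<tau>) *
    ((\<Sum>l<nx. A \<tau> $$ (k, l) * ip M (Z (x l) [\<tau>] t) ?F) + (\<Sum>l<m. B \<tau> k l * ip M (Z (e l) [\<tau>] t) ?F)))"
  proof -
    have "ip M (\<lambda>\<omega>. \<Sum>l<nx. A \<tau> $$ (k, l) * Z (x l) [\<tau>] t \<omega>) ?F =
        (\<Sum>l<nx. A \<tau> $$ (k, l) * ip M (Z (x l) [\<tau>] t) ?F)"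
      "ip M (\<lambda>\<omega>. \<Sum>l<m. B \<tau> k l * Z (e l) [\<tau>] t \<omega>) ?F =
        (\<Sum>l<m. B \<tau> k l * ip M (Z (e l) [\<tau>] t) ?F)" for \<tau>
      by (rule ip_lincomb_left; use sqF in \<open>auto intro!: sq_x sq_e\<close>)+
    then show ?thesis
      using sqF sqs by (subst ip_lincomb_left) (auto intro!: sq_int_add simp: ip_add_left)
  qed
  also have "\<dots> = (\<Sum>\<tau>\<in>UNIV. if \<tau> = \<sigma> then sqrt (p \<tau>) *
    ((\<Sum>l<nx. A \<tau> $$ (k, l) * ip M (Z (x l) [\<tau>] t) ?F) + (\<Sum>l<m. B \<tau> k l * ip M (Z (e l) [\<tau>] t) ?F)) else 0)"
  proof (intro sum.cong refl)
    fix \<tau>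
    have "ip M (Z g [\<tau>] t) ?F = 0" if "\<tau> \<noteq> \<sigma>" "g \<in> X" for g
      using ip_Z_snoc[OF joint that(2) f, of "[]" w \<tau> \<sigma> t] that(1) by simp
    then show "sqrt (p \<tau>) *
        ((\<Sum>l<nx. A \<tau> $$ (k, l) * ip M (Z (x l) [\<tau>] t) ?F) + (\<Sum>l<m. B \<tau> k l * ip M (Z (e l) [\<tau>] t) ?F)) =
      (if \<tau> = \<sigma> then sqrt (p \<tau>) *
        ((\<Sum>l<nx. A \<tau> $$ (k, l) * ip M (Z (x l) [\<tau>] t) ?F) + (\<Sum>l<m. B \<tau> k l * ip M (Z (e l) [\<tau>] t) ?F)) else 0)"
      by simp
  qed
  finally show ?thesis by simp
qed

definition corr :: "(int \<Rightarrow> 'a \<Rightarrow> real) \<Rightarrow> 's list \<Rightarrow> int \<Rightarrow> real vec" where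
  "corr f w t = vec nx (\<lambda>k. ip M (x k t) (Z f w t))"

lemma corr_carrier [simp]: "corr f w t \<in> carrier_vec nx"
  by (simp add: corr_def)

lemma corr_shift: "f \<in> X \<Longrightarrow> corr f w t = corr f w s"
proof (unfold corr_def, rule eq_vecI)
  fix k assume "f \<in> X" "k < dim_vec (vec nx (\<lambda>k. ip M (x k s) (Z f w s)))"
  then show "vec nx (\<lambda>k. ip M (x k t) (Z f w t)) $ k = vec nx (\<lambda>k. ip M (x k s) (Z f w s)) $ k"
    using joint_shift[OF joint, of "x k" f "[]" t w s] by simp
qed simp

text \<open>
  For a transition outside \<open>E\<close> the correlations of the corresponding longer words vanish; this shows that the
  matrix side of the recursion vanishes as well.
\<close>
lemma A_corr_dead:
  assumes f: "f \<in> X" and dead: "(\<sigma>, \<tau>) \<notin> E"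
  shows "A \<tau> *\<^sub>v corr f (w @ [\<sigma>]) t = 0\<^sub>v nx"
proof (rule eq_vecI)
  fix i assume "i < dim_vec (0\<^sub>v nx :: real vec)"
  then have i: "i < nx" by simp
  let ?a = "\<lambda>l. ip M (Z (x l) [\<sigma>] t) (Z f (w @ [\<sigma>]) t)"
  let ?b = "\<lambda>l. ip M (Z (e l) [\<sigma>] t) (Z f (w @ [\<sigma>]) t)"
  have AA: "(\<Sum>k<nx. A \<tau> $$ (i, k) * A \<sigma> $$ (k, l)) = 0" if l: "l < nx" for l
  proof -
    have "(\<Sum>k<nx. A \<tau> $$ (i, k) * A \<sigma> $$ (k, l)) = (A \<tau> * A \<sigma>) $$ (i, l)"
      using A_carrier[of \<tau>] A_carrier[of \<sigma>] i l by (simp add: scalar_prod_def atLeast0LessThan)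
    then show ?thesis using dead_AA[OF dead] i l by simp
  qed
  have "(A \<tau> *\<^sub>v corr f (w @ [\<sigma>]) t) $ i = (\<Sum>k<nx. A \<tau> $$ (i, k) * ip M (x k t) (Z f (w @ [\<sigma>]) t))"
    using A_carrier[of \<tau>] i by (simp add: corr_def scalar_prod_def atLeast0LessThan)
  also have "\<dots> = (\<Sum>k<nx. A \<tau> $$ (i, k) * (sqrt (p \<sigma>) * ((\<Sum>l<nx. A \<sigma> $$ (k, l) * ?a l) + (\<Sum>l<m. B \<sigma> k l * ?b l))))"
    by (intro sum.cong refl) (simp add: ip_state_snoc[OF _ f])
  also have "\<dots> = sqrt (p \<sigma>) * ((\<Sum>k<nx. \<Sum>l<nx. A \<tau> $$ (i, k) * A \<sigma> $$ (k, l) * ?a l) +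
      (\<Sum>k<nx. \<Sum>l<m. A \<tau> $$ (i, k) * B \<sigma> k l * ?b l))"
    by (simp add: sum_distrib_left distrib_left sum.distrib ac_simps)
  also have "\<dots> = sqrt (p \<sigma>) * ((\<Sum>l<nx. (\<Sum>k<nx. A \<tau> $$ (i, k) * A \<sigma> $$ (k, l)) * ?a l) +
      (\<Sum>l<m. (\<Sum>k<nx. A \<tau> $$ (i, k) * B \<sigma> k l) * ?b l))"
    by (subst (1 2) sum.swap) (simp add: sum_distrib_right)
  also have "\<dots> = 0" using AA dead_AB[OF dead i] by simp
  finally show "(A \<tau> *\<^sub>v corr f (w @ [\<sigma>]) t) $ i = 0\<^sub>v nx $ i" using i by simp
qed (use A_carrier[of \<tau>] in simp)

lemma corr_dead: "w \<noteq> [] \<Longrightarrow> w \<notin> L \<Longrightarrow> corr f w t = 0\<^sub>v nx"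
  unfolding corr_def by (intro eq_vecI) (auto intro!: ip_AE_zero_right Z_dead)

lemma corr_snoc:
  assumes f: "f \<in> X" and w: "w \<noteq> []"
  shows "corr f (w @ [\<sigma>]) t = sqrt (p \<sigma>) \<cdot>\<^sub>v (A \<sigma> *\<^sub>v corr f w (t - 1))"
proof (cases "w @ [\<sigma>] \<in> L")
  case True
  show ?thesis
  proof (rule eq_vecI)
    fix k assume "k < dim_vec (sqrt (p \<sigma>) \<cdot>\<^sub>v (A \<sigma> *\<^sub>v corr f w (t - 1)))"
    then have k: "k < nx" using A_carrier[of \<sigma>] by simp
    have red: "ip M (Z g [\<sigma>] t) (Z f (w @ [\<sigma>]) t) = ip M (g (t - 1)) (Z f w (t - 1))" if "g \<in> X" for g
      using ip_Z_snoc[OF joint that f, of "[]" w \<sigma> \<sigma> t] w True by simp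
    have "corr f (w @ [\<sigma>]) t $ k = sqrt (p \<sigma>) * (\<Sum>l<nx. A \<sigma> $$ (k, l) * ip M (x l (t - 1)) (Z f w (t - 1)))"
      using k by (simp add: corr_def ip_state_snoc[OF k f] red noise_orthogonal_past[OF _ f w])
    also have "\<dots> = (sqrt (p \<sigma>) \<cdot>\<^sub>v (A \<sigma> *\<^sub>v corr f w (t - 1))) $ k"
      using k A_carrier[of \<sigma>] by (simp add: corr_def scalar_prod_def atLeast0LessThan)
    finally show "corr f (w @ [\<sigma>]) t $ k = (sqrt (p \<sigma>) \<cdot>\<^sub>v (A \<sigma> *\<^sub>v corr f w (t - 1))) $ k" .
  qed (use A_carrier[of \<sigma>] in \<open>simp add: corr_def\<close>)
next
  case False
  have "A \<sigma> *\<^sub>v corr f w (t - 1) = 0\<^sub>v nx"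
  proof (cases "w \<in> L")
    case True
    then have "(last w, \<sigma>) \<notin> E" using False w by (simp add: admissible_words_snoc)
    then show ?thesis using A_corr_dead[OF f, of "last w" \<sigma> "butlast w"] w by simp
  next
    case False
    then show ?thesis by (simp add: corr_dead[OF w] mult_mat_vec_zero[OF A_carrier])
  qed
  then show ?thesis using False by (auto intro!: eq_vecI simp: corr_dead)
qed

lemma corr_word:
  assumes f: "f \<in> X"
  shows "corr f (\<sigma> # w) t = sqrt (p_word p w) \<cdot>\<^sub>v (mat_word nx A w *\<^sub>v corr f [\<sigma>] s)"
proof (induction w arbitrary: t rule: rev_induct)
  case Nil
  show ?case using corr_shift[OF f] by simp
next
  case (snoc \<tau> w)
  have W: "mat_word nx A w \<in> carrier_mat nx nx" for w by (rule mat_word_carrier) (rule A_carrier)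
  have "corr f ((\<sigma> # w) @ [\<tau>]) t = sqrt (p \<tau>) \<cdot>\<^sub>v (A \<tau> *\<^sub>v corr f (\<sigma> # w) (t - 1))"
    by (rule corr_snoc[OF f]) simp
  also have "\<dots> = sqrt (p \<tau>) \<cdot>\<^sub>v (sqrt (p_word p w) \<cdot>\<^sub>v (A \<tau> *\<^sub>v (mat_word nx A w *\<^sub>v corr f [\<sigma>] s)))"
    unfolding snoc by (simp add: mult_mat_vec[OF A_carrier mult_mat_vec_carrier[OF W corr_carrier]])
  also have "A \<tau> *\<^sub>v (mat_word nx A w *\<^sub>v corr f [\<sigma>] s) = mat_word nx A (w @ [\<tau>]) *\<^sub>v corr f [\<sigma>] s"
  proof -
    have "mat_word nx A (w @ [\<tau>]) = A \<tau> * mat_word nx A w"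
      using mat_word_append[of A nx w "[\<tau>]", OF A_carrier] A_carrier[of \<tau>] by simp
    then show ?thesis using assoc_mult_mat_vec[OF A_carrier W corr_carrier] by simp
  qed
  finally show ?case by (simp add: smult_smult_assoc real_sqrt_mult mult.commute)
qed

subsection \<open>Families obeying the word recursion\<close>

text \<open>
  Families of random variables, indexed by words, whose correlations with the state obey the recursion along
  suffixes. The property is closed under linear combinations and under prepending a letter, so it
  passes from noise words to the innovations.
\<close>
definition word_recursive :: "('s list \<Rightarrow> int \<Rightarrow> 'a \<Rightarrow> real) \<Rightarrow> bool" where
  "word_recursive \<Phi> \<longleftrightarrow> (\<forall>q t. square_integrable M (\<Phi> q t)) \<and>
    (\<forall>q w t s. \<forall>k<nx. q \<noteq> [] \<longrightarrow> ip M (x k t) (\<Phi> (q @ w) t) =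
      sqrt (p_word p w) * (\<Sum>l<nx. mat_word nx A w $$ (k, l) * ip M (x l s) (\<Phi> q s)))"

lemma mat_word_nx [simp]: "mat_word nx A w \<in> carrier_mat nx nx"
  by (rule mat_word_carrier) (rule A_carrier)

lemma word_recursive_Z:
  assumes f: "f \<in> X"
  shows "word_recursive (Z f)"
  unfolding word_recursive_def
proof (intro conjI allI impI)
  show "square_integrable M (Z f q t)" for q t by (rule sq_X[OF f])
  fix q w t s k assume k: "k < nx" and "q \<noteq> ([] :: 's list)"
  then obtain \<sigma> v where q: "q = \<sigma> # v" by (cases q) auto
  have c: "corr f [\<sigma>] 0 \<in> carrier_vec nx" by simp
  have "corr f (q @ w) t = sqrt (p_word p (v @ w)) \<cdot>\<^sub>v (mat_word nx A (v @ w) *\<^sub>v corr f [\<sigma>] 0)"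
    using corr_word[OF f, of \<sigma> "v @ w" t 0] q by simp
  also have "\<dots> = sqrt (p_word p w) \<cdot>\<^sub>v
      (mat_word nx A w *\<^sub>v (sqrt (p_word p v) \<cdot>\<^sub>v (mat_word nx A v *\<^sub>v corr f [\<sigma>] 0)))"
    using mat_word_append_vec[of A nx "corr f [\<sigma>] 0" w v, OF A_carrier c]
    by (simp add: mult_mat_vec[OF mat_word_nx mult_mat_vec_carrier[OF mat_word_nx c]]
        smult_smult_assoc real_sqrt_mult mult.commute)
  also have "\<dots> = sqrt (p_word p w) \<cdot>\<^sub>v (mat_word nx A w *\<^sub>v corr f q s)"
    using corr_word[OF f, of \<sigma> v s 0] q by simp
  finally have "corr f (q @ w) t $ k = (sqrt (p_word p w) \<cdot>\<^sub>v (mat_word nx A w *\<^sub>v corr f q s)) $ k"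
    by simp
  then show "ip M (x k t) (Z f (q @ w) t) =
      sqrt (p_word p w) * (\<Sum>l<nx. mat_word nx A w $$ (k, l) * ip M (x l s) (Z f q s))"
    using k carrier_matD[OF mat_word_nx, of w] by (simp add: corr_def scalar_prod_def atLeast0LessThan)
qed

lemma word_recursive_Cons: "word_recursive \<Phi> \<Longrightarrow> word_recursive (\<lambda>q. \<Phi> (\<sigma> # q))"
  unfolding word_recursive_def by (auto simp flip: append_Cons)

lemma word_recursive_sum:
  assumes "\<And>i. i \<in> I \<Longrightarrow> word_recursive (\<Phi> i)"
  shows "word_recursive (\<lambda>q t \<omega>. \<Sum>i\<in>I. c i * \<Phi> i q t \<omega>)"
  unfolding word_recursive_def
proof (intro conjI allI impI)
  have sq: "square_integrable M (\<Phi> i q t)" if "i \<in> I" for i q t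
    using assms[OF that] by (simp add: word_recursive_def)
  then show "square_integrable M (\<lambda>\<omega>. \<Sum>i\<in>I. c i * \<Phi> i q t \<omega>)" for q t
    by (rule sq_int_lincomb)
  fix q w t s k assume k: "k < nx" and q: "q \<noteq> ([] :: 's list)"
  have "ip M (x k t) (\<lambda>\<omega>. \<Sum>i\<in>I. c i * \<Phi> i (q @ w) t \<omega>) = (\<Sum>i\<in>I. c i * ip M (x k t) (\<Phi> i (q @ w) t))"
    using k by (intro ip_lincomb_right sq sq_X') auto
  also have "\<dots> = (\<Sum>i\<in>I. c i * (sqrt (p_word p w) * (\<Sum>l<nx. mat_word nx A w $$ (k, l) * ip M (x l s) (\<Phi> i q s))))"
    using assms k q unfolding word_recursive_def by (intro sum.cong refl arg_cong[of _ _ "(*) _"]) blast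
  also have "\<dots> = sqrt (p_word p w) * (\<Sum>i\<in>I. \<Sum>l<nx. mat_word nx A w $$ (k, l) * (c i * ip M (x l s) (\<Phi> i q s)))"
    by (simp add: sum_distrib_left ac_simps)
  also have "(\<Sum>i\<in>I. \<Sum>l<nx. mat_word nx A w $$ (k, l) * (c i * ip M (x l s) (\<Phi> i q s))) =
      (\<Sum>l<nx. mat_word nx A w $$ (k, l) * (\<Sum>i\<in>I. c i * ip M (x l s) (\<Phi> i q s)))"
    by (subst sum.swap) (simp add: sum_distrib_left)
  also have "\<dots> = (\<Sum>l<nx. mat_word nx A w $$ (k, l) * ip M (x l s) (\<lambda>\<omega>. \<Sum>i\<in>I. c i * \<Phi> i q s \<omega>))"
  proof (intro sum.cong refl arg_cong[of _ _ "(*) _"])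
    fix l assume "l \<in> {..<nx}"
    then show "(\<Sum>i\<in>I. c i * ip M (x l s) (\<Phi> i q s)) = ip M (x l s) (\<lambda>\<omega>. \<Sum>i\<in>I. c i * \<Phi> i q s \<omega>)"
      by (intro ip_lincomb_right[symmetric] sq sq_X') auto
  qed
  finally show "ip M (x k t) (\<lambda>\<omega>. \<Sum>i\<in>I. c i * \<Phi> i (q @ w) t \<omega>) =
    sqrt (p_word p w) * (\<Sum>l<nx. mat_word nx A w $$ (k, l) * ip M (x l s) (\<lambda>\<omega>. \<Sum>i\<in>I. c i * \<Phi> i q s \<omega>))" .
qed

lemma word_recursive_add:
  assumes "word_recursive \<Phi>" "word_recursive \<Psi>"
  shows "word_recursive (\<lambda>q t \<omega>. \<Phi> q t \<omega> + \<Psi> q t \<omega>)"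
  using word_recursive_sum[of UNIV "\<lambda>b. if b then \<Phi> else \<Psi>" "\<lambda>_. 1"] assms
  by (simp add: UNIV_bool add.commute)

lemma word_recursive_innovation:
  assumes J: "J \<subseteq> {..<m}"
  shows "k < nx \<Longrightarrow> word_recursive (\<lambda>q t. innovation J N q t k)"
proof (induction N arbitrary: k)
  case 0
  show ?case by (simp add: word_recursive_def)
next
  case (Suc N)
  have "word_recursive (\<lambda>q t. innovation J N (\<sigma> # q) t l)" if "l < nx" for \<sigma> l
    using word_recursive_Cons[OF Suc.IH[OF that], of \<sigma>] by simp
  moreover have "word_recursive (\<lambda>q t. Z (e l) (\<sigma> # q) t)" if "l \<in> J" for l \<sigma>
    using J that by (intro word_recursive_Cons[OF word_recursive_Z, of "e l", simplified]) auto
  ultimately show ?case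
    unfolding innov.simps
    by (intro word_recursive_sum[where I = UNIV] word_recursive_add word_recursive_sum) auto
qed

subsection \<open>Convergence of the innovations\<close>

lemma innovation_split:
  assumes "J \<subseteq> {..<m}"
  shows "innovation {..<m} N q t k \<omega> = innovation J N q t k \<omega> + innovation ({..<m} - J) N q t k \<omega>"
  using innov_Un[of J "{..<m} - J" mu p nx A B e N q t k \<omega>] assms finite_subset[OF assms]
  by (simp add: Un_absorb1)

lemma ip_state_split:
  assumes J: "J \<subseteq> {..<m}" and f: "square_integrable M f"
    and o: "\<And>l q. l \<in> {..<m} - J \<Longrightarrow> q \<noteq> [] \<Longrightarrow> ip M f (Z (e l) q t) = 0" and k: "k < nx"
  shows "ip M f (Z (x k) q t) = ip M f (innovation J N q t k) + ip M f (residual N q t k)"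
proof -
  have sq: "square_integrable M (innovation J N q t k)" "square_integrable M (innovation ({..<m} - J) N q t k)"
    "square_integrable M (residual N q t k)"
    using J k by (auto intro!: sq_innovation sq_residual)
  have "ip M f (Z (x k) q t) =
      ip M f (\<lambda>\<omega>. (innovation J N q t k \<omega> + innovation ({..<m} - J) N q t k \<omega>) + residual N q t k \<omega>)"
    using state_decomposition[OF k, of q t N] unfolding innovation_split[OF J]
    by (intro ip_cong_AE sq_int_measurable f sq_x k sq_int_add sq) auto
  also have "\<dots> = ip M f (innovation J N q t k) + ip M f (innovation ({..<m} - J) N q t k) + ip M f (residual N q t k)"
    using sq f by (simp add: ip_add_right sq_int_add)
  also have "ip M f (innovation ({..<m} - J) N q t k) = 0"
    using k o by (intro ip_innovation_zero[OF _ f]) auto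
  finally show ?thesis by simp
qed

lemma ip_innovation_disjoint:
  assumes J: "J \<subseteq> {..<m}" "J' \<subseteq> {..<m}"
    and orth: "\<And>k l w v. k \<in> J \<Longrightarrow> l \<in> J' \<Longrightarrow> ip M (Z (e k) w t) (Z (e l) v t) = 0"
    and "k < nx" "l < nx"
  shows "ip M (innovation J N q t k) (innovation J' N' q' t l) = 0"
proof (rule ip_innovation_zero[OF J(2) sq_innovation[OF J(1) \<open>k < nx\<close>] _ \<open>l < nx\<close>])
  fix l v assume l: "l \<in> J'"
  have "ip M (Z (e l) v t) (innovation J N q t k) = 0"
  proof (rule ip_innovation_zero[OF J(1) _ _ \<open>k < nx\<close>])
    show "square_integrable M (Z (e l) v t)" using l J by (auto intro: sq_e)
    show "ip M (Z (e l) v t) (Z (e i) w t) = 0" if "i \<in> J" for i w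
      using orth[OF that l] by (simp add: ip_commute)
  qed
  then show "ip M (innovation J N q t k) (Z (e l) v t) = 0" by (simp add: ip_commute)
qed

text \<open>
  Differences of full innovations are differences of residuals, and the innovations from \<open>J\<close> and
  from the remaining noise are orthogonal; by Pythagoras the part from \<open>J\<close> is Cauchy in mean square.
\<close>
lemma convergent_ip_innovation:
  assumes J: "J \<subseteq> {..<m}"
    and orth: "\<And>k l w v. k \<in> J \<Longrightarrow> l \<in> {..<m} - J \<Longrightarrow> ip M (Z (e k) w t) (Z (e l) v t) = 0"
    and k: "k < nx" and q: "q \<noteq> []" and f: "square_integrable M f"
  shows "convergent (\<lambda>N. ip M f (innovation J N q t k))"
proof -
  let ?I = "\<lambda>N. innovation J N q t k" and ?I' = "\<lambda>N. innovation ({..<m} - J) N q t k"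
    and ?R = "\<lambda>N. residual N q t k"
  have sq: "square_integrable M (?I N)" "square_integrable M (?I' N)" "square_integrable M (?R N)" for N
    using k J by (auto intro!: sq_innovation sq_residual)
  \<comment> \<open>The factor 2 comes from $\|a - b\|^2 \le 2\|a\|^2 + 2\|b\|^2$.\<close>
  define c where "c N = sqrt (ip M f f) * sqrt (2 * ip M (?R N) (?R N))" for N
  have c: "c \<longlonglongrightarrow> 0"
    unfolding c_def
    using tendsto_mult_right_zero[OF tendsto_real_sqrt[OF tendsto_mult_right_zero[OF residual_tendsto_zero[OF k q]], simplified]]
    by blast
  have diff: "\<bar>ip M f (?I N) - ip M f (?I N')\<bar> \<le> c N + c N'" for N N'
  proof -
    define d where "d \<omega> = ?I N \<omega> - ?I N' \<omega>" for \<omega>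
    define d' where "d' \<omega> = ?I' N \<omega> - ?I' N' \<omega>" for \<omega>
    have sqd: "square_integrable M d" "square_integrable M d'"
      unfolding d_def[abs_def] d'_def[abs_def] by (intro sq_int_diff sq)+
    have I0: "ip M (?I a) (?I' b) = 0" for a b
      using J k orth by (intro ip_innovation_disjoint) auto
    have dd': "ip M d d' = 0"
      unfolding d_def[abs_def] d'_def[abs_def]
      by (simp add: ip_diff_left ip_diff_right sq_int_diff sq I0)
    define r where "r \<omega> = ?R N' \<omega> - ?R N \<omega>" for \<omega>
    have sqr: "square_integrable M r" unfolding r_def[abs_def] by (intro sq_int_diff sq)
    have eq: "AE \<omega> in M. r \<omega> = d \<omega> + d' \<omega>"
      using state_decomposition[OF k, of q t N] state_decomposition[OF k, of q t N']
      by eventually_elim (simp add: r_def d_def d'_def innovation_split[OF J])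
    have "ip M r r = ip M (\<lambda>\<omega>. d \<omega> + d' \<omega>) (\<lambda>\<omega>. d \<omega> + d' \<omega>)"
      by (intro ip_cong_AE eq sq_int_measurable sqr sq_int_add sqd)
    also have "\<dots> = ip M d d + ip M d' d'"
      using sqd dd' by (simp add: ip_add_left ip_add_right sq_int_add ip_commute[of M d' d])
    finally have "ip M d d \<le> ip M r r" using ip_nonneg[of M d'] by simp
    also have "\<dots> \<le> 2 * ip M (?R N) (?R N) + 2 * ip M (?R N') (?R N')"
    proof -
      have "0 \<le> ip M (\<lambda>\<omega>. ?R N \<omega> + ?R N' \<omega>) (\<lambda>\<omega>. ?R N \<omega> + ?R N' \<omega>)" by (rule ip_nonneg)
      then show ?thesis unfolding r_def[abs_def]
        using sq(3) by (simp add: ip_diff_left ip_diff_right ip_add_left ip_add_right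
            sq_int_add sq_int_diff ip_commute[of M "?R N'" "?R N"])
    qed
    finally have "sqrt (ip M d d) \<le> sqrt (2 * ip M (?R N) (?R N)) + sqrt (2 * ip M (?R N') (?R N'))"
      using sqrt_add_le_add_sqrt[of "2 * ip M (?R N) (?R N)" "2 * ip M (?R N') (?R N')"]
        real_sqrt_le_mono[of "ip M d d"] ip_nonneg
      by (smt (verit) mult_nonneg_nonneg)
    then have "sqrt (ip M f f) * sqrt (ip M d d) \<le> c N + c N'"
      unfolding c_def distrib_left[symmetric] by (rule mult_left_mono) (simp add: ip_nonneg)
    moreover have "ip M f (?I N) - ip M f (?I N') = ip M f d"
      unfolding d_def[abs_def] by (simp add: ip_diff_right sq f)
    ultimately show ?thesis using ip_Cauchy_Schwarz[OF f sqd(1)] by simp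
  qed
  have "Cauchy (\<lambda>N. ip M f (?I N))"
  proof (rule CauchyI)
    fix \<epsilon> :: real assume "0 < \<epsilon>"
    then obtain N0 where N0: "\<And>N. N \<ge> N0 \<Longrightarrow> \<bar>c N\<bar> < \<epsilon> / 2"
      using LIMSEQ_D[OF c, of "\<epsilon> / 2"] by auto
    show "\<exists>N0. \<forall>N\<ge>N0. \<forall>N'\<ge>N0. norm (ip M f (?I N) - ip M f (?I N')) < \<epsilon>"
    proof (intro exI allI impI)
      fix N N' assume "N0 \<le> N" "N0 \<le> N'"
      then show "norm (ip M f (?I N) - ip M f (?I N')) < \<epsilon>"
        using diff[of N N'] N0[of N] N0[of N'] unfolding real_norm_def by linarith
    qed
  qed
  then show ?thesis by (simp add: Cauchy_convergent_iff)
qed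

subsection \<open>Output correlations\<close>

lemma output_Z:
  assumes "\<And>t. AE \<omega> in M. y t \<omega> = (\<Sum>l<nx. c l * x l t \<omega>) + (\<Sum>l<m. d l * e l t \<omega>)"
  shows "AE \<omega> in M. Z y q t \<omega> = (\<Sum>l<nx. c l * Z (x l) q t \<omega>) + (\<Sum>l<m. d l * Z (e l) q t \<omega>)"
  using assms[of "t - int (length q)"]
  by eventually_elim (simp add: zs_def distrib_left sum_distrib_left mult.left_commute)

lemma ip_output_Z:
  assumes y: "\<And>t. AE \<omega> in M. y t \<omega> = (\<Sum>l<nx. c l * x l t \<omega>) + (\<Sum>l<m. d l * e l t \<omega>)"
    and meas: "\<And>t. y t \<in> borel_measurable M"
    and f: "square_integrable M f"
  shows "ip M f (Z y q t) = (\<Sum>l<nx. c l * ip M f (Z (x l) q t)) + (\<Sum>l<m. d l * ip M f (Z (e l) q t))"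
proof -
  have sq: "square_integrable M (\<lambda>\<omega>. \<Sum>l<nx. c l * Z (x l) q t \<omega>)"
    "square_integrable M (\<lambda>\<omega>. \<Sum>l<m. d l * Z (e l) q t \<omega>)"
    by (auto intro!: sq_int_lincomb sq_x sq_e)
  have "ip M f (Z y q t) = ip M f (\<lambda>\<omega>. (\<Sum>l<nx. c l * Z (x l) q t \<omega>) + (\<Sum>l<m. d l * Z (e l) q t \<omega>))"
    by (intro ip_cong_AE output_Z y sq_int_measurable[OF f] zs_measurable mu_measurable meas
        sq_int_measurable[OF sq_int_add[OF sq]]) auto
  also have "\<dots> = (\<Sum>l<nx. c l * ip M f (Z (x l) q t)) + (\<Sum>l<m. d l * ip M f (Z (e l) q t))"
    unfolding ip_add_right[OF sq f]
    by (intro arg_cong2[of _ _ _ _ "(+)"] ip_lincomb_right f) (auto intro!: sq_x sq_e)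
  finally show ?thesis .
qed

lemma output_square_integrable:
  assumes y: "\<And>t. AE \<omega> in M. y t \<omega> = (\<Sum>l<nx. c l * x l t \<omega>) + (\<Sum>l<m. d l * e l t \<omega>)"
    and meas: "\<And>t. y t \<in> borel_measurable M"
  shows "square_integrable M (Z y q t)"
proof (rule sq_int_cong_AE[OF _ output_Z[OF y]])
  show "square_integrable M (\<lambda>\<omega>. (\<Sum>l<nx. c l * Z (x l) q t \<omega>) + (\<Sum>l<m. d l * Z (e l) q t \<omega>))"
    by (intro sq_int_add sq_int_lincomb sq_x sq_e) auto
qed (intro zs_measurable mu_measurable meas)

text \<open>
  Let $V_N$ be the part of the output that is driven by \<open>J\<close>, truncated at depth \<open>N\<close>. On the one hand
  $E[y^s V_N]$ tends to $E[y^s z^y]$, because \<open>ys\<close> is orthogonal to the other noise and the residual vanishes. On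
  the other hand \<open>ys\<close> may be replaced by \<open>y\<close> against $V_N$, and $E[y V_N]$ has the required form with
  $g_N = E[x V_N]$ in place of \<open>g\<close>, since the depth \<open>N\<close> is the same for all words. Let \<open>N\<close> tend to infinity.
\<close>
lemma output_correlation_factorization:
  assumes y: "\<And>i t. i < ny \<Longrightarrow> AE \<omega> in M. y i t \<omega> =
      (\<Sum>l<nx. C $$ (i, l) * x l t \<omega>) + (\<Sum>l<m. D i l * e l t \<omega>)"
    and meas: "\<And>i t. i < ny \<Longrightarrow> y i t \<in> borel_measurable M"
    and J: "J \<subseteq> {..<m}"
    and orth: "\<And>k l w v t. k \<in> J \<Longrightarrow> l \<in> {..<m} - J \<Longrightarrow> ip M (Z (e k) w t) (Z (e l) v t) = 0"
    and sqs: "\<And>i t. i < ny \<Longrightarrow> square_integrable M (ys i t)"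
    and ys_det: "\<And>i l q t. i < ny \<Longrightarrow> l \<in> {..<m} - J \<Longrightarrow> ip M (ys i t) (Z (e l) q t) = 0"
    and ys_y: "\<And>i l q t. i < ny \<Longrightarrow> l \<in> J \<Longrightarrow> q \<noteq> [] \<Longrightarrow>
      ip M (ys i t) (Z (e l) q t) = ip M (y i t) (Z (e l) q t)"
    and j: "j < ny"
  obtains g where "g \<in> carrier_vec nx"
    "\<And>i w t. i < ny \<Longrightarrow> ip M (ys i t) (Z (y j) (\<sigma> # w) t) =
      sqrt (p_word p w) * (\<Sum>k<nx. C $$ (i, k) * (mat_word nx A w *\<^sub>v g) $ k)"
proof -
  let ?J' = "{..<m} - J"
  define V where "V N q t \<omega> = (\<Sum>k<nx. C $$ (j, k) * innovation J N q t k \<omega>) + (\<Sum>l\<in>J. D j l * Z (e l) q t \<omega>)"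
    for N q t \<omega>
  have recV: "word_recursive (V N)" for N
    unfolding V_def[abs_def] using J
    by (intro word_recursive_add word_recursive_sum word_recursive_innovation word_recursive_Z) auto
  have sqV: "square_integrable M (V N q t)" for N q t
    using recV by (simp add: word_recursive_def)
  have ipV: "ip M f (V N q t) = (\<Sum>k<nx. C $$ (j, k) * ip M f (innovation J N q t k)) + (\<Sum>l\<in>J. D j l * ip M f (Z (e l) q t))"
    if f: "square_integrable M f" for f N q t
  proof -
    have sq: "square_integrable M (\<lambda>\<omega>. \<Sum>k<nx. C $$ (j, k) * innovation J N q t k \<omega>)"
      "square_integrable M (\<lambda>\<omega>. \<Sum>l\<in>J. D j l * Z (e l) q t \<omega>)"
      using J by (auto intro!: sq_int_lincomb sq_innovation sq_e)
    show ?thesis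
      unfolding V_def[abs_def] ip_add_right[OF sq f]
      by (intro arg_cong2[of _ _ _ _ "(+)"] ip_lincomb_right f) (use J in \<open>auto intro!: sq_innovation sq_e\<close>)
  qed
  have V0: "ip M f (V N q t) = 0"
    if f: "square_integrable M f" and o: "\<And>l q. l \<in> J \<Longrightarrow> q \<noteq> [] \<Longrightarrow> ip M f (Z (e l) q t) = 0" and q: "q \<noteq> []" for f N q t
  proof -
    have "ip M f (innovation J N q t k) = 0" if "k < nx" for k
      using that by (intro ip_innovation_zero[OF J f o]) auto
    then show ?thesis unfolding ipV[OF f] using o q by simp
  qed
  have limV: "(\<lambda>N. ip M f (V N q t)) \<longlonglongrightarrow> ip M f (Z (y j) q t)"
    if f: "square_integrable M f" and o: "\<And>l q. l \<in> ?J' \<Longrightarrow> ip M f (Z (e l) q t) = 0" and q: "q \<noteq> []" for f q t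
  proof -
    have xs: "ip M f (Z (x k) q t) = ip M f (innovation J N q t k) + ip M f (residual N q t k)" if k: "k < nx" for k N
      using o by (intro ip_state_split[OF J f _ k]) auto
    have "ip M f (Z (y j) q t) - (\<Sum>k<nx. C $$ (j, k) * ip M f (residual N q t k)) = ip M f (V N q t)" for N
    proof -
      have "(\<Sum>l<m. D j l * ip M f (Z (e l) q t)) = (\<Sum>l\<in>J. D j l * ip M f (Z (e l) q t))"
        using o J by (intro sum.mono_neutral_right) auto
      then show ?thesis
        unfolding ip_output_Z[OF y[OF j] meas[OF j] f] ipV[OF f]
        by (simp add: xs[of _ N] distrib_left sum.distrib)
    qed
    moreover have "(\<lambda>N. ip M f (Z (y j) q t) - (\<Sum>k<nx. C $$ (j, k) * ip M f (residual N q t k))) \<longlonglongrightarrow>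
        ip M f (Z (y j) q t) - (\<Sum>k<nx. C $$ (j, k) * 0)"
      by (intro tendsto_diff tendsto_const tendsto_sum tendsto_mult ip_residual_tendsto_zero q f) auto
    ultimately show ?thesis by simp
  qed
  have "convergent (\<lambda>N. ip M (x k 0) (V N [\<sigma>] 0))" if k: "k < nx" for k
  proof -
    have sqx: "square_integrable M (x k 0)" using k by (intro sq_X') auto
    have "convergent (\<lambda>N. (\<Sum>i<nx. C $$ (j, i) * ip M (x k 0) (innovation J N [\<sigma>] 0 i)) +
      (\<Sum>l\<in>J. D j l * ip M (x k 0) (Z (e l) [\<sigma>] 0)))"
      by (intro convergent_add convergent_sum convergent_mult convergent_const
          convergent_ip_innovation[OF J orth _ _ sqx]) auto
    then show ?thesis unfolding ipV[OF sqx] .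
  qed
  then have glim: "(\<lambda>N. ip M (x k 0) (V N [\<sigma>] 0)) \<longlonglongrightarrow> lim (\<lambda>N. ip M (x k 0) (V N [\<sigma>] 0))" if "k < nx" for k
    using that by (simp add: convergent_LIMSEQ_iff)
  define g where "g = vec nx (\<lambda>k. lim (\<lambda>N. ip M (x k 0) (V N [\<sigma>] 0)))"
  show ?thesis
  proof (rule that)
    show g: "g \<in> carrier_vec nx" by (simp add: g_def)
    fix i w t assume i: "i < ny"
    have sqy: "square_integrable M (y i t)"
      using output_square_integrable[OF y[OF i] meas[OF i], of "[]" t] by simp
    have e0: "ip M (e l t) (V N (\<sigma> # w) t) = 0" if l: "l < m" for l N
      using J l by (intro V0 noise_orthogonal_past sq_X') auto
    have "ip M (ys i t) (V N (\<sigma> # w) t) =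
        sqrt (p_word p w) * (\<Sum>k<nx. C $$ (i, k) * (\<Sum>l<nx. mat_word nx A w $$ (k, l) * ip M (x l 0) (V N [\<sigma>] 0)))" for N
    proof -
      have "ip M (\<lambda>\<omega>. ys i t \<omega> - y i t \<omega>) (V N (\<sigma> # w) t) = 0"
      proof (rule V0)
        show "square_integrable M (\<lambda>\<omega>. ys i t \<omega> - y i t \<omega>)" by (intro sq_int_diff sqs i sqy)
        fix l q assume l: "l \<in> J" "q \<noteq> ([] :: 's list)"
        have "square_integrable M (Z (e l) q t)" using l J by (intro sq_e) auto
        then show "ip M (\<lambda>\<omega>. ys i t \<omega> - y i t \<omega>) (Z (e l) q t) = 0"
          using ip_diff_left[OF sqs[OF i] sqy] ys_y[OF i l] by simp
      qed simp
      then have "ip M (ys i t) (V N (\<sigma> # w) t) = ip M (V N (\<sigma> # w) t) (Z (y i) [] t)"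
        using ip_diff_left[OF sqs[OF i] sqy sqV] by (simp add: ip_commute)
      also have "\<dots> = (\<Sum>k<nx. C $$ (i, k) * ip M (x k t) (V N ([\<sigma>] @ w) t))"
        unfolding ip_output_Z[OF y[OF i] meas[OF i] sqV]
        by (simp add: e0 ip_commute[of M "V N (\<sigma> # w) t"])
      also have "\<dots> = (\<Sum>k<nx. C $$ (i, k) * (sqrt (p_word p w) * (\<Sum>l<nx. mat_word nx A w $$ (k, l) * ip M (x l 0) (V N [\<sigma>] 0))))"
        using recV[of N] unfolding word_recursive_def by (intro sum.cong refl arg_cong[of _ _ "(*) _"]) blast
      finally show ?thesis by (simp add: sum_distrib_left mult.left_commute)
    qed
    moreover have "(\<lambda>N. sqrt (p_word p w) * (\<Sum>k<nx. C $$ (i, k) * (\<Sum>l<nx. mat_word nx A w $$ (k, l) * ip M (x l 0) (V N [\<sigma>] 0))))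
        \<longlonglongrightarrow> sqrt (p_word p w) * (\<Sum>k<nx. C $$ (i, k) * (\<Sum>l<nx. mat_word nx A w $$ (k, l) * g $ l))"
      by (intro tendsto_mult tendsto_const tendsto_sum) (auto simp: g_def intro!: glim)
    moreover have "(\<lambda>N. ip M (ys i t) (V N (\<sigma> # w) t)) \<longlonglongrightarrow> ip M (ys i t) (Z (y j) (\<sigma> # w) t)"
      by (intro limV sqs i ys_det) auto
    ultimately have "ip M (ys i t) (Z (y j) (\<sigma> # w) t) =
        sqrt (p_word p w) * (\<Sum>k<nx. C $$ (i, k) * (\<Sum>l<nx. mat_word nx A w $$ (k, l) * g $ l))"
      using LIMSEQ_unique by simp
    also have "\<dots> = sqrt (p_word p w) * (\<Sum>k<nx. C $$ (i, k) * (mat_word nx A w *\<^sub>v g) $ k)"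
      using g carrier_matD[OF mat_word_nx, of w]
      by (intro arg_cong[of _ _ "(*) _"] sum.cong refl) (simp add: scalar_prod_def atLeast0LessThan)
    finally show "ip M (ys i t) (Z (y j) (\<sigma> # w) t) =
      sqrt (p_word p w) * (\<Sum>k<nx. C $$ (i, k) * (mat_word nx A w *\<^sub>v g) $ k)" .
  qed
qed

text \<open>
  Both states have the same innovations from the common noise components; the remaining innovations are
  orthogonal to \<open>f\<close> and both residuals vanish in the limit.
\<close>
lemma ip_state_eq_ip_stochastic_state:
  assumes sub: "state_process M mu E p nx m' A B' x' e'" and m': "m' \<le> m"
    and B': "\<And>\<sigma> k l. k < nx \<Longrightarrow> l < m' \<Longrightarrow> B' \<sigma> k l = B \<sigma> k l" and e': "\<And>l t \<omega>. l < m' \<Longrightarrow> \<omega> \<in> space M \<Longrightarrow> e' l t \<omega> = e l t \<omega>"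
    and f: "square_integrable M f" and o: "\<And>l q. l \<in> {m'..<m} \<Longrightarrow> q \<noteq> [] \<Longrightarrow> ip M f (Z (e l) q t) = 0"
    and k: "k < nx" and q: "q \<noteq> []"
  shows "ip M f (Z (x k) q t) = ip M f (Z (x' k) q t)"
proof -
  interpret s: state_process M mu E p nx m' A B' x' e' by (rule sub)
  have "ip M f (Z (x k) q t) - ip M f (Z (x' k) q t) = ip M f (residual N q t k) - ip M f (s.residual N q t k)" for N
  proof -
    have sq: "square_integrable M (innovation {..<m'} N q t k)" "square_integrable M (s.residual N q t k)"
      using m' k by (auto intro!: sq_innovation s.sq_residual)
    have same: "s.innovation {..<m'} N q t k \<omega> = innovation {..<m'} N q t k \<omega>" if "\<omega> \<in> space M" for \<omega>
      using k B' e' that by (intro innov_cong) auto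
    have 1: "ip M f (Z (x k) q t) = ip M f (innovation {..<m'} N q t k) + ip M f (residual N q t k)"
      using m' o by (intro ip_state_split[OF _ f _ k]) auto
    have "ip M f (Z (x' k) q t) = ip M f (\<lambda>\<omega>. innovation {..<m'} N q t k \<omega> + s.residual N q t k \<omega>)"
    proof (intro ip_cong_AE sq_int_measurable f s.sq_x k sq_int_add sq)
      show "AE \<omega> in M. Z (x' k) q t \<omega> = innovation {..<m'} N q t k \<omega> + s.residual N q t k \<omega>"
        using s.state_decomposition[OF k, of q t N] AE_space by eventually_elim (simp add: same)
    qed simp
    also have "\<dots> = ip M f (innovation {..<m'} N q t k) + ip M f (s.residual N q t k)"
      using sq f by (simp add: ip_add_right)
    finally show ?thesis using 1 by simp
  qed
  moreover have "(\<lambda>N. ip M f (residual N q t k) - ip M f (s.residual N q t k)) \<longlonglongrightarrow> 0 - 0"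
    by (intro tendsto_diff ip_residual_tendsto_zero s.ip_residual_tendsto_zero k q f)
  ultimately have "(\<lambda>N::nat. ip M f (Z (x k) q t) - ip M f (Z (x' k) q t)) \<longlonglongrightarrow> 0" by simp
  then show ?thesis by (simp add: LIMSEQ_const_iff)
qed

text \<open>
  The present noise is orthogonal to the past, so only the state contributes to the first
  factor.
\<close>
lemma output_autocorrelation:
  assumes y: "\<And>i t. i < ny \<Longrightarrow> AE \<omega> in M. y i t \<omega> =
      (\<Sum>l<nx. C $$ (i, l) * x l t \<omega>) + (\<Sum>l<m. D i l * e l t \<omega>)"
    and meas: "\<And>i t. i < ny \<Longrightarrow> y i t \<in> borel_measurable M"
    and ij: "i < ny" "j < ny"
  shows "ip M (y i t) (Z (y j) (\<sigma> # w) t) = sqrt (p_word p w) *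
    (\<Sum>k<nx. C $$ (i, k) * (mat_word nx A w *\<^sub>v vec nx (\<lambda>k. ip M (x k s) (Z (y j) [\<sigma>] s))) $ k)"
proof -
  have sqy: "square_integrable M (Z (y i) q t)" if "i < ny" for i q t
    using output_square_integrable[OF y[OF that] meas[OF that]] .
  have exp: "ip M f (Z (y j) q t) = (\<Sum>l<nx. C $$ (j, l) * ip M f (Z (x l) q t)) + (\<Sum>l<m. D j l * ip M f (Z (e l) q t))"
    if "square_integrable M f" for f q t
    by (rule ip_output_Z[OF y[OF ij(2)] meas[OF ij(2)] that])
  have ex: "ip M (x k t) (Z (y j) (\<sigma> # w) t) =
     sqrt (p_word p w) * (\<Sum>l<nx. mat_word nx A w $$ (k, l) * ip M (x l s) (Z (y j) [\<sigma>] s))" if k: "k < nx" for k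
  proof -
    have rec: "word_recursive (\<lambda>q t \<omega>. (\<Sum>l<nx. C $$ (j, l) * Z (x l) q t \<omega>) + (\<Sum>l<m. D j l * Z (e l) q t \<omega>))"
      by (intro word_recursive_add word_recursive_sum word_recursive_Z) auto
    have eq: "ip M (x k t) (Z (y j) q t) = ip M (x k t) (\<lambda>\<omega>. (\<Sum>l<nx. C $$ (j, l) * Z (x l) q t \<omega>) + (\<Sum>l<m. D j l * Z (e l) q t \<omega>))"
      if "k < nx" for k q t
    proof (intro ip_cong_AE output_Z[OF y[OF ij(2)]])
      show "(\<lambda>\<omega>. (\<Sum>l<nx. C $$ (j, l) * Z (x l) q t \<omega>) + (\<Sum>l<m. D j l * Z (e l) q t \<omega>)) \<in> borel_measurable M"
        using rec unfolding word_recursive_def by (blast intro: sq_int_measurable)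
      show "Z (y j) q t \<in> borel_measurable M" by (rule sq_int_measurable[OF sqy[OF ij(2)]])
      show "x k t \<in> borel_measurable M" "x k t \<in> borel_measurable M"
        using that by (auto intro!: sq_int_measurable sq_X')
    qed simp
    have "ip M (x k t) (\<lambda>\<omega>. (\<Sum>l<nx. C $$ (j, l) * Z (x l) ([\<sigma>] @ w) t \<omega>) + (\<Sum>l<m. D j l * Z (e l) ([\<sigma>] @ w) t \<omega>)) =
      sqrt (p_word p w) * (\<Sum>l<nx. mat_word nx A w $$ (k, l) * ip M (x l s)
        (\<lambda>\<omega>. (\<Sum>l<nx. C $$ (j, l) * Z (x l) [\<sigma>] s \<omega>) + (\<Sum>l<m. D j l * Z (e l) [\<sigma>] s \<omega>)))"
      using rec k unfolding word_recursive_def by blast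
    then show ?thesis using k by (simp add: eq)
  qed
  have e0: "ip M (e l t) (Z (y j) (\<sigma> # w) t) = 0" if l: "l < m" for l
  proof -
    have sq: "square_integrable M (e l t)" using l by (intro sq_X') auto
    show ?thesis unfolding exp[OF sq] using l by (simp add: noise_orthogonal_past)
  qed
  have "ip M (y i t) (Z (y j) (\<sigma> # w) t) = ip M (Z (y j) (\<sigma> # w) t) (Z (y i) [] t)"
    by (simp add: ip_commute)
  also have "\<dots> = (\<Sum>k<nx. C $$ (i, k) * ip M (x k t) (Z (y j) (\<sigma> # w) t))"
    unfolding ip_output_Z[OF y[OF ij(1)] meas[OF ij(1)] sqy[OF ij(2)]] by (simp add: ip_commute e0)
  also have "\<dots> = sqrt (p_word p w) * (\<Sum>k<nx. C $$ (i, k) *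
      (mat_word nx A w *\<^sub>v vec nx (\<lambda>k. ip M (x k s) (Z (y j) [\<sigma>] s))) $ k)"
    using carrier_matD[OF mat_word_nx, of w]
    by (simp add: ex scalar_prod_def atLeast0LessThan sum_distrib_left mult.left_commute)
  finally show ?thesis .
qed

text \<open>
  The case of one letter, where the recursion does not apply: second moments of state and noise remain.
\<close>
lemma ip_state_output_letter:
  assumes y: "\<And>t. AE \<omega> in M. y t \<omega> = (\<Sum>l<nx. c l * x l t \<omega>) + (\<Sum>l<m. d l * e l t \<omega>)"
    and meas: "\<And>t. y t \<in> borel_measurable M" and k: "k < nx"
  shows "ip M (x k t) (Z y [\<sigma>] t) = sqrt (p \<sigma>) *
    ((\<Sum>l<nx. \<Sum>l'<nx. A \<sigma> $$ (k, l) * c l' * ip M (Z (x l) [\<sigma>] t) (Z (x l') [\<sigma>] t)) +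
     (\<Sum>l<m. \<Sum>l'<m. B \<sigma> k l * d l' * ip M (Z (e l) [\<sigma>] t) (Z (e l') [\<sigma>] t)))"
proof -
  have sqx: "square_integrable M (x k t)" using k by (intro sq_X') auto
  have 1: "ip M (x k t) (Z (x l') [\<sigma>] t) = sqrt (p \<sigma>) * (\<Sum>l<nx. A \<sigma> $$ (k, l) * ip M (Z (x l) [\<sigma>] t) (Z (x l') [\<sigma>] t))"
    if "l' < nx" for l'
    using ip_state_snoc[OF k, of "x l'" t "[]" \<sigma>] that state_noise_letter[OF that]
    by (simp add: ip_commute[of M "Z (e _) _ _"])
  have 2: "ip M (x k t) (Z (e l') [\<sigma>] t) = sqrt (p \<sigma>) * (\<Sum>l<m. B \<sigma> k l * ip M (Z (e l) [\<sigma>] t) (Z (e l') [\<sigma>] t))"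
    if "l' < m" for l'
    using ip_state_snoc[OF k, of "e l'" t "[]" \<sigma>] that state_noise_letter by simp
  have "ip M (x k t) (Z y [\<sigma>] t) =
    (\<Sum>l'<nx. c l' * (sqrt (p \<sigma>) * (\<Sum>l<nx. A \<sigma> $$ (k, l) * ip M (Z (x l) [\<sigma>] t) (Z (x l') [\<sigma>] t)))) +
    (\<Sum>l'<m. d l' * (sqrt (p \<sigma>) * (\<Sum>l<m. B \<sigma> k l * ip M (Z (e l) [\<sigma>] t) (Z (e l') [\<sigma>] t))))"
    unfolding ip_output_Z[OF y meas sqx] by (simp add: 1 2)
  also have "\<dots> = sqrt (p \<sigma>) *
    ((\<Sum>l'<nx. \<Sum>l<nx. A \<sigma> $$ (k, l) * c l' * ip M (Z (x l) [\<sigma>] t) (Z (x l') [\<sigma>] t)) +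
     (\<Sum>l'<m. \<Sum>l<m. B \<sigma> k l * d l' * ip M (Z (e l) [\<sigma>] t) (Z (e l') [\<sigma>] t)))"
    by (simp add: sum_distrib_left distrib_left ac_simps)
  finally show ?thesis by (subst (1 2) sum.swap)
qed

end

section \<open>Switched systems and their state processes\<close>

abbreviation coord :: "'a process \<Rightarrow> nat \<Rightarrow> int \<Rightarrow> 'a \<Rightarrow> real" where
  "coord r k \<equiv> \<lambda>t \<omega>. r t \<omega> $ k"

lemma vector_process_carrier:
  "vector_process M n r \<Longrightarrow> \<omega> \<in> space M \<Longrightarrow> r t \<omega> \<in> carrier_vec n"
  by (simp add: vector_process_def)

lemma vector_process_dim:
  "vector_process M n r \<Longrightarrow> \<omega> \<in> space M \<Longrightarrow> dim_vec (r t \<omega>) = n"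
  by (simp add: vector_process_def)

lemma z_proc_component:
  assumes "vector_process M n r" "i < n" "\<omega> \<in> space M"
  shows "z_proc mu p r w t \<omega> $ i = zs mu p (coord r i) w t \<omega>"
  using vector_process_carrier[OF assms(1,3), of "t - int (length w)"] assms(2)
  by (simp add: z_proc_def zs_def)

lemma E_outer_carrier [simp]: "E_outer M n m X Y \<in> carrier_mat n m"
  by (simp add: E_outer_def)

lemma E_outer_index:
  "i < n \<Longrightarrow> j < m \<Longrightarrow> E_outer M n m X Y $$ (i, j) = ip M (\<lambda>\<omega>. X \<omega> $ i) (\<lambda>\<omega>. Y \<omega> $ j)"
  by (simp add: E_outer_def ip_def)

lemma E_outer_z_proc_index:
  assumes r: "vector_process M n r" and q: "vector_process M m q" and ij: "i < n" "j < m"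
  shows "E_outer M n m (z_proc mu p r w t) (z_proc mu p q v t) $$ (i, j) =
    ip M (zs mu p (coord r i) w t) (zs mu p (coord q j) v t)"
  unfolding E_outer_index[OF ij]
  by (rule ip_cong) (auto simp: z_proc_component[OF r ij(1)] z_proc_component[OF q ij(2)])

lemma vector_process_stack:
  assumes r: "vector_process M n r" and q: "vector_process M m q"
  shows "vector_process M (n + m) (stack r q)"
    and "\<omega> \<in> space M \<Longrightarrow> i < n \<Longrightarrow> stack r q t \<omega> $ i = r t \<omega> $ i"
    and "\<omega> \<in> space M \<Longrightarrow> n \<le> i \<Longrightarrow> i < n + m \<Longrightarrow> stack r q t \<omega> $ i = q t \<omega> $ (i - n)"
proof -
  show l: "stack r q t \<omega> $ i = r t \<omega> $ i" if "\<omega> \<in> space M" "i < n" for t \<omega> i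
    using vector_process_carrier[OF r that(1), of t] vector_process_carrier[OF q that(1), of t] that(2)
    by (simp add: stack_def)
  show h: "stack r q t \<omega> $ i = q t \<omega> $ (i - n)" if "\<omega> \<in> space M" "n \<le> i" "i < n + m" for t \<omega> i
    using vector_process_carrier[OF r that(1), of t] vector_process_carrier[OF q that(1), of t] that(2,3)
    by (simp add: stack_def)
  have "(\<lambda>\<omega>. stack r q t \<omega> $ i) \<in> borel_measurable M" if i: "i < n + m" for i t
  proof (cases "i < n")
    case True
    then have "(\<lambda>\<omega>. r t \<omega> $ i) \<in> borel_measurable M" using r by (simp add: vector_process_def)
    then show ?thesis by (rule measurable_cong[THEN iffD1, rotated]) (simp add: l True)
  next
    case False
    then have "(\<lambda>\<omega>. q t \<omega> $ (i - n)) \<in> borel_measurable M" using q i by (simp add: vector_process_def)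
    then show ?thesis by (rule measurable_cong[THEN iffD1, rotated]) (use False i h in auto)
  qed
  then show "vector_process M (n + m) (stack r q)"
    using r q by (auto simp: vector_process_def stack_def)
qed

context switching
begin

lemma joint_of_ZMWSSI:
  assumes r: "ZMWSSI M mu p n r"
    and X: "\<And>f. f \<in> X \<Longrightarrow> \<exists>i<n. \<forall>t. \<forall>\<omega>\<in>space M. f t \<omega> = r t \<omega> $ i"
  shows "joint X"
proof -
  have vp: "vector_process M n r" using r by (simp add: ZMWSSI_def)
  let ?Y = "components n r \<union> (\<Union>w\<in>{w. w \<noteq> []}. components n (z_proc mu p r w))"
  have wss: "jointly_wss M ?Y" using r by (simp add: ZMWSSI_def Let_def)
  have wss_sq: "square_integrable M (F t)" if "F \<in> ?Y" for F t
    using wss[unfolded jointly_wss_def, THEN conjunct1, rule_format, OF that] .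
  have wss_shift: "ip M (F (s + k)) (G (t + k)) = ip M (F s) (G t)" if "F \<in> ?Y" "G \<in> ?Y" for F G s t k
    using wss[unfolded jointly_wss_def, THEN conjunct2, THEN conjunct2, rule_format, OF that, of s k t]
    by (simp add: ip_def)
  have rep: "\<exists>F\<in>?Y. \<forall>t. \<forall>\<omega>\<in>space M. Z f w t \<omega> = F t \<omega>" if f: "f \<in> X" for f w
  proof -
    obtain i where i: "i < n" "\<And>t \<omega>. \<omega> \<in> space M \<Longrightarrow> f t \<omega> = r t \<omega> $ i" using X[OF f] by blast
    show ?thesis
    proof (cases "w = []")
      case True
      show ?thesis
      proof (rule bexI)
        show "coord r i \<in> ?Y" using i(1) by (auto simp: components_def)
        show "\<forall>t. \<forall>\<omega>\<in>space M. Z f w t \<omega> = r t \<omega> $ i" using i(2) True by simp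
      qed
    next
      case False
      show ?thesis
      proof (rule bexI)
        show "(\<lambda>t \<omega>. z_proc mu p r w t \<omega> $ i) \<in> ?Y"
          using i(1) False by (auto simp: components_def)
        show "\<forall>t. \<forall>\<omega>\<in>space M. Z f w t \<omega> = z_proc mu p r w t \<omega> $ i"
          using z_proc_component[OF vp i(1), of _ mu p w] i(2) by (simp add: zs_def)
      qed
    qed
  qed
  show ?thesis
    unfolding joint_def
  proof (intro conjI allI ballI)
    fix t
    have "sets (gen_sigma M {f k | f k. f \<in> X \<and> k \<le> t}) \<subseteq>
        sets (gen_sigma M {\<lambda>\<omega>. r k \<omega> $ i | k i. k \<le> t \<and> i < n})"
    proof (rule gen_sigma_mono)
      fix h assume "h \<in> {f k | f k. f \<in> X \<and> k \<le> t}"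
      then obtain f k where h: "h = f k" "f \<in> X" "k \<le> t" by blast
      obtain i where i: "i < n" "\<And>t \<omega>. \<omega> \<in> space M \<Longrightarrow> f t \<omega> = r t \<omega> $ i" using X[OF h(2)] by blast
      show "\<exists>g\<in>{\<lambda>\<omega>. r k \<omega> $ i | k i. k \<le> t \<and> i < n}. \<forall>\<omega>\<in>space M. h \<omega> = g \<omega>"
        by (rule bexI[of _ "\<lambda>\<omega>. r k \<omega> $ i"]) (use h i in auto)
    qed
    moreover have "cond_indep M (gen_sigma M {\<lambda>\<omega>. r k \<omega> $ i | k i. k \<le> t \<and> i < n})
        (mu_future M mu t) (mu_past M mu t)"
      using r by (simp add: ZMWSSI_def)
    ultimately show "cond_indep M (gen_sigma M {f k | f k. f \<in> X \<and> k \<le> t}) (mu_future M mu t) (mu_past M mu t)"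
      unfolding cond_indep_def by (meson subsetD)
  next
    fix f w t assume f: "f \<in> X"
    from rep[OF f, of w] obtain F where F: "F \<in> ?Y" "\<forall>t. \<forall>\<omega>\<in>space M. Z f w t \<omega> = F t \<omega>" ..
    show "square_integrable M (Z f w t)"
      using sq_int_cong[of M "Z f w t" "F t"] F(2) wss_sq[OF F(1)] by simp
  next
    fix f g w v s t k assume f: "f \<in> X" and g: "g \<in> X"
    from rep[OF f, of w] obtain F where F: "F \<in> ?Y" "\<forall>t. \<forall>\<omega>\<in>space M. Z f w t \<omega> = F t \<omega>" ..
    from rep[OF g, of v] obtain G where G: "G \<in> ?Y" "\<forall>t. \<forall>\<omega>\<in>space M. Z g v t \<omega> = G t \<omega>" ..
    have "ip M (Z f w s) (Z g v t) = ip M (F s) (G t)" for s t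
      by (rule ip_cong) (use F(2) G(2) in simp_all)
    then show "ip M (Z f w (s + k)) (Z g v (t + k)) = ip M (Z f w s) (Z g v t)"
      using wss_shift[OF F(1) G(1)] by simp
  qed
qed

text \<open>Relates words of one letter to the weighted covariances.\<close>
lemma ip_Z_letter:
  "ip M (Z f [\<sigma>] (t + 1)) (Z g [\<sigma>] (t + 1)) = 1 / p \<sigma> * ip M (f t) (\<lambda>\<omega>. (mu \<sigma> t \<omega>)\<^sup>2 * g t \<omega>)"
proof -
  have "sqrt (p \<sigma>) * sqrt (p \<sigma>) = p \<sigma>" using p_pos[of \<sigma>] by (simp del: p_pos)
  then have "Z f [\<sigma>] (t + 1) \<omega> * Z g [\<sigma>] (t + 1) \<omega> = 1 / p \<sigma> * (f t \<omega> * ((mu \<sigma> t \<omega>)\<^sup>2 * g t \<omega>))" for \<omega>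
    by (simp add: zs_def power2_eq_square)
  then show ?thesis unfolding ip_def by simp
qed

lemma state_process_of_vectors:
  assumes x: "vector_process M nx x" and om: "vector_process M m om"
    and A: "\<And>\<sigma>. A \<sigma> \<in> carrier_mat nx nx" and B: "\<And>\<sigma>. B \<sigma> \<in> carrier_mat nx m"
    and state: "\<And>t. AE \<omega> in M. x (t + 1) \<omega> =
      vec nx (\<lambda>i. \<Sum>\<sigma>\<in>UNIV. ((A \<sigma> *\<^sub>v x t \<omega> + B \<sigma> *\<^sub>v om t \<omega>) $ i) * mu \<sigma> t \<omega>)"
    and white: "white_noise M mu E p m om"
    and stationary: "ZMWSSI M mu p (nx + m) (stack x om)"
    and letter: "\<And>\<sigma> t. E_outer M nx m (z_proc mu p x [\<sigma>] t) (z_proc mu p om [\<sigma>] t) = 0\<^sub>m nx m"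
    and word: "\<And>w t. w \<noteq> [] \<Longrightarrow> E_outer M nx m (z_proc mu p x w t) (om t) = 0\<^sub>m nx m"
    and stable: "stable p nx A"
    and dead_A: "\<And>\<sigma>1 \<sigma>2. (\<sigma>1, \<sigma>2) \<notin> E \<Longrightarrow> A \<sigma>2 * A \<sigma>1 = 0\<^sub>m nx nx"
    and dead_B: "\<And>\<sigma>1 \<sigma>2 t. (\<sigma>1, \<sigma>2) \<notin> E \<Longrightarrow>
      A \<sigma>2 * B \<sigma>1 * E_outer M m m (z_proc mu p om [\<sigma>1] t) (z_proc mu p om [\<sigma>1] t) = 0\<^sub>m nx m"
  shows "state_process M mu E p nx m A (\<lambda>\<sigma> k l. B \<sigma> $$ (k, l)) (coord x) (coord om)"
proof unfold_locales
  show "joint (coord x ` {..<nx} \<union> coord om ` {..<m})"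
  proof (rule joint_of_ZMWSSI[OF stationary])
    fix f assume "f \<in> coord x ` {..<nx} \<union> coord om ` {..<m}"
    then consider k where "k < nx" "f = coord x k" | l where "l < m" "f = coord om l"
      by auto
    then show "\<exists>i<nx + m. \<forall>t. \<forall>\<omega>\<in>space M. f t \<omega> = stack x om t \<omega> $ i"
    proof cases
      case 1
      then show ?thesis by (intro exI[of _ k]) (simp add: vector_process_stack(2)[OF x om])
    next
      case 2
      then show ?thesis by (intro exI[of _ "nx + l"]) (simp add: vector_process_stack(3)[OF x om])
    qed
  qed
  show "A \<sigma> \<in> carrier_mat nx nx" for \<sigma> by (rule A)
  show "stable p nx A" by (rule stable)
  show "(\<sigma>, \<tau>) \<notin> E \<Longrightarrow> A \<tau> * A \<sigma> = 0\<^sub>m nx nx" for \<sigma> \<tau> by (rule dead_A)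
  show "AE \<omega> in M. x (t + 1) \<omega> $ k = (\<Sum>\<sigma>\<in>UNIV. ((\<Sum>l<nx. A \<sigma> $$ (k, l) * x t \<omega> $ l) +
      (\<Sum>l<m. B \<sigma> $$ (k, l) * om t \<omega> $ l)) * mu \<sigma> t \<omega>)" if k: "k < nx" for k t
    using state[of t] AE_space
  proof eventually_elim
    case (elim \<omega>)
    have c: "x t \<omega> \<in> carrier_vec nx" "om t \<omega> \<in> carrier_vec m"
      using vector_process_carrier[OF x elim(2)] vector_process_carrier[OF om elim(2)] by auto
    have "(A \<sigma> *\<^sub>v x t \<omega> + B \<sigma> *\<^sub>v om t \<omega>) $ k =
        (\<Sum>l<nx. A \<sigma> $$ (k, l) * x t \<omega> $ l) + (\<Sum>l<m. B \<sigma> $$ (k, l) * om t \<omega> $ l)" for \<sigma>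
      using c carrier_matD[OF A] carrier_matD[OF B] k by (simp add: scalar_prod_def atLeast0LessThan)
    then show ?case using elim(1) k by simp
  qed
  show "ip M (Z (coord om k) w t) (Z (coord om l) v t) = 0"
    if kl: "k < m" "l < m" and wv: "w \<noteq> []" "v \<noteq> []" "w \<noteq> v" for k l w v t
  proof -
    obtain \<sigma> v' where v: "v = \<sigma> # v'" using wv(2) by (cases v) auto
    have "E_outer M m m (z_proc mu p om w t) (z_proc mu p om v t) = 0\<^sub>m m m"
      using white wv unfolding white_noise_def v by blast
    then show ?thesis using E_outer_z_proc_index[OF om om kl, of mu p w t v] kl by simp
  qed
  show "ip M (Z (coord x k) [\<sigma>] t) (Z (coord om l) [\<sigma>] t) = 0"
    if kl: "k < nx" "l < m" for k l \<sigma> t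
    using E_outer_z_proc_index[OF x om kl, of mu p "[\<sigma>]" t "[\<sigma>]"] kl by (simp add: letter)
  show "ip M (Z (coord x k) w t) (\<lambda>\<omega>. om t \<omega> $ l) = 0"
    if kl: "k < nx" "l < m" and w: "w \<noteq> []" for k l w t
  proof -
    have "ip M (Z (coord x k) w t) (\<lambda>\<omega>. om t \<omega> $ l) =
        E_outer M nx m (z_proc mu p x w t) (om t) $$ (k, l)"
      unfolding E_outer_index[OF kl] by (rule ip_cong) (simp_all add: z_proc_component[OF x kl(1)])
    then show ?thesis using word[OF w] kl by simp
  qed
  show "(\<Sum>k<nx. A \<tau> $$ (i, k) * B \<sigma> $$ (k, l)) = 0"
    if dead: "(\<sigma>, \<tau>) \<notin> E" and i: "i < nx" and l: "l < m" for \<sigma> \<tau> i l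
  proof -
    let ?Q = "E_outer M m m (z_proc mu p om [\<sigma>] 0) (z_proc mu p om [\<sigma>] 0)"
    have "invertible_mat ?Q" using white unfolding white_noise_def by blast
    then obtain Q' where Q': "?Q * Q' = 1\<^sub>m m" "Q' * ?Q = 1\<^sub>m (dim_row Q')"
      unfolding invertible_mat_def inverts_mat_def by (auto simp: E_outer_def)
    have Qc: "Q' \<in> carrier_mat m m"
    proof (rule carrier_matI)
      show "dim_col Q' = m" using arg_cong[OF Q'(1), of dim_col] by simp
      show "dim_row Q' = m" using arg_cong[OF Q'(2), of dim_col] by (simp add: E_outer_def)
    qed
    have AB: "A \<tau> * B \<sigma> \<in> carrier_mat nx m" by (rule mult_carrier_mat[OF A B])
    have "A \<tau> * B \<sigma> = (A \<tau> * B \<sigma>) * (?Q * Q')" unfolding Q'(1) by (rule right_mult_one_mat[OF AB, symmetric])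
    also have "\<dots> = A \<tau> * B \<sigma> * ?Q * Q'" by (rule assoc_mult_mat[OF AB E_outer_carrier Qc, symmetric])
    also have "\<dots> = 0\<^sub>m nx m" unfolding dead_B[OF dead] using Qc by simp
    finally have "(A \<tau> * B \<sigma>) $$ (i, l) = 0" using i l by simp
    then show ?thesis
      using carrier_matD[OF A] carrier_matD[OF B] i l by (simp add: scalar_prod_def atLeast0LessThan)
  qed
qed

lemma append_cols_mult:
  fixes K B :: "real mat"
  assumes K: "K \<in> carrier_mat n nv" and B: "B \<in> carrier_mat n nu"
  shows append_cols_carrier: "append_cols K B \<in> carrier_mat n (nv + nu)"
    and append_cols_index: "i < n \<Longrightarrow> l < nv + nu \<Longrightarrow>
      append_cols K B $$ (i, l) = (if l < nv then K $$ (i, l) else B $$ (i, l - nv))"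
    and append_cols_mult_vec: "a \<in> carrier_vec nv \<Longrightarrow> b \<in> carrier_vec nu \<Longrightarrow>
      append_cols K B *\<^sub>v (a @\<^sub>v b) = K *\<^sub>v a + B *\<^sub>v b"
proof -
  show c: "append_cols K B \<in> carrier_mat n (nv + nu)"
    using K B by (auto simp: append_cols_def)
  show ix: "append_cols K B $$ (i, l) = (if l < nv then K $$ (i, l) else B $$ (i, l - nv))"
    if "i < n" "l < nv + nu" for i l
    using K B that by (auto simp: append_cols_def)
  show "append_cols K B *\<^sub>v (a @\<^sub>v b) = K *\<^sub>v a + B *\<^sub>v b"
    if ab: "a \<in> carrier_vec nv" "b \<in> carrier_vec nu"
  proof (rule eq_vecI)
    fix i assume "i < dim_vec (K *\<^sub>v a + B *\<^sub>v b)"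
    then have i: "i < n" using K B by simp
    have "row (append_cols K B) i = row K i @\<^sub>v row B i"
      using K B c i by (intro eq_vecI) (auto simp: ix)
    then show "(append_cols K B *\<^sub>v (a @\<^sub>v b)) $ i = (K *\<^sub>v a + B *\<^sub>v b) $ i"
      using K B ab c i by (simp add: scalar_prod_append[OF row_carrier_vec row_carrier_vec ab])
  qed (use K B c in simp)
qed

end

text \<open>
  White noise leaves open only equal words. These reduce to their first letter, and the pair of empty words
  reduces to pairs of letters by lifting.
\<close>
lemma (in state_process) noise_blocks_orthogonal:
  assumes kl: "k < m" "l < m" and letter: "\<And>\<sigma> t. ip M (Z (e k) [\<sigma>] t) (Z (e l) [\<sigma>] t) = 0"
  shows "ip M (Z (e k) w t) (Z (e l) v t) = 0"
proof -
  have X: "e k \<in> X" "e l \<in> X" using kl by auto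
  consider "w = []" "v = []" | "w = []" "v \<noteq> []" | "w \<noteq> []" "v = []"
    | "w \<noteq> []" "v \<noteq> []" "w \<noteq> v" | "w \<noteq> []" "w = v" by blast
  then show ?thesis
  proof cases
    case 1
    obtain \<alpha> where \<alpha>: "AE \<omega> in M. Z f w t \<omega> = (\<Sum>\<sigma>\<in>UNIV. \<alpha> \<sigma> * Z f (w @ [\<sigma>]) (t + 1) \<omega>)" for f w t
      using obtain_lift by blast
    have "ip M (Z (e k) [] t) (Z (e l) [] t) =
       ip M (\<lambda>\<omega>. \<Sum>\<sigma>\<in>UNIV. \<alpha> \<sigma> * Z (e k) ([] @ [\<sigma>]) (t + 1) \<omega>) (\<lambda>\<omega>. \<Sum>\<sigma>\<in>UNIV. \<alpha> \<sigma> * Z (e l) ([] @ [\<sigma>]) (t + 1) \<omega>)"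
      by (intro ip_cong_AE \<alpha> sq_int_measurable sq_int_lincomb sq_e kl)
    also have "\<dots> = 0"
    proof -
      have "ip M (Z (e k) [\<sigma>] (t + 1)) (Z (e l) [\<tau>] (t + 1)) = 0" for \<sigma> \<tau>
        using letter ip_Z_same_length[OF joint X, of "[\<sigma>]" "[\<tau>]" "t + 1"] by (cases "\<sigma> = \<tau>") auto
      then show ?thesis using kl by (subst ip_lincomb2) (auto intro!: sq_e)
    qed
    finally show ?thesis using 1 by simp
  next
    case 2
    then show ?thesis using noise_orthogonal_past[OF kl(1) X(2), of v t] by simp
  next
    case 3
    then show ?thesis using noise_orthogonal_past[OF kl(2) X(1), of w t] by (simp add: ip_commute)
  next
    case 4
    then show ?thesis by (intro white kl)
  next
    case 5
    then obtain \<sigma> w' where w: "w = \<sigma> # w'" by (cases w) auto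
    then show ?thesis
      using ip_Z_same_word[OF joint X, of \<sigma> w' t 0] 5 letter by simp
  qed
qed

context switching
begin

lemma sGLSS_carriers:
  assumes "sGLSS_with_state M mu E p ny nu y u S x"
  shows "Amat S \<sigma> \<in> carrier_mat (xdim S) (xdim S)" "Kmat S \<sigma> \<in> carrier_mat (xdim S) (vdim S)"
    "Bmat S \<sigma> \<in> carrier_mat (xdim S) nu" "Cmat S \<in> carrier_mat ny (xdim S)"
    "Dmat S \<in> carrier_mat ny nu" "Fmat S \<in> carrier_mat ny (vdim S)"
    "vector_process M (vdim S) (noise S)" "vector_process M (xdim S) x"
  using assms[unfolded sGLSS_with_state_def Let_def] by blast+

lemma sGLSS_state_process:
  fixes S :: "('a, 's) sGLSS"
  assumes S: "sGLSS_with_state M mu E p ny nu y u S x" and u: "vector_process M nu u"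
  defines "nv \<equiv> vdim S"
  shows sGLSS_is_state_process: "state_process M mu E p (xdim S) (nv + nu) (Amat S)
      (\<lambda>\<sigma> k l. append_cols (Kmat S \<sigma>) (Bmat S \<sigma>) $$ (k, l))
      (coord x) (\<lambda>l t \<omega>. stack (noise S) u t \<omega> $ l)"
    and sGLSS_output: "i < ny \<Longrightarrow> AE \<omega> in M. y t \<omega> $ i = (\<Sum>l<xdim S. Cmat S $$ (i, l) * x t \<omega> $ l) +
      (\<Sum>l<nv + nu. (if l < nv then Fmat S $$ (i, l) else Dmat S $$ (i, l - nv)) * stack (noise S) u t \<omega> $ l)"
    and sGLSS_noise_blocks: "k < nv \<Longrightarrow> l \<in> {nv..<nv + nu} \<Longrightarrow>
      ip M (Z (\<lambda>t \<omega>. stack (noise S) u t \<omega> $ k) w t) (Z (\<lambda>t \<omega>. stack (noise S) u t \<omega> $ l) v t) = 0"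
proof -
  let ?om = "stack (noise S) u" and ?AC = "\<lambda>\<sigma>. append_cols (Kmat S \<sigma>) (Bmat S \<sigma>)"
  note S' = S[unfolded sGLSS_with_state_def Let_def, folded nv_def]
  note A = sGLSS_carriers(1)[OF S] and K = sGLSS_carriers(2)[OF S, folded nv_def]
    and B = sGLSS_carriers(3)[OF S] and C = sGLSS_carriers(4)[OF S] and D = sGLSS_carriers(5)[OF S]
    and F = sGLSS_carriers(6)[OF S, folded nv_def] and v = sGLSS_carriers(7)[OF S, folded nv_def]
    and x = sGLSS_carriers(8)[OF S]
  have state: "AE \<omega> in M. x (t + 1) \<omega> = vec (xdim S) (\<lambda>i. \<Sum>\<sigma>\<in>UNIV.
      ((Amat S \<sigma> *\<^sub>v x t \<omega> + Bmat S \<sigma> *\<^sub>v u t \<omega> + Kmat S \<sigma> *\<^sub>v noise S t \<omega>) $ i) * mu \<sigma> t \<omega>)"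
    and out: "AE \<omega> in M. y t \<omega> = Cmat S *\<^sub>v x t \<omega> + Dmat S *\<^sub>v u t \<omega> + Fmat S *\<^sub>v noise S t \<omega>" for t
    using S' by blast+
  have om: "vector_process M (nv + nu) ?om" by (rule vector_process_stack(1)[OF v u])
  have AC: "?AC \<sigma> \<in> carrier_mat (xdim S) (nv + nu)" for \<sigma> by (rule append_cols_carrier[OF K B])
  show proc: "state_process M mu E p (xdim S) (nv + nu) (Amat S) (\<lambda>\<sigma> k l. ?AC \<sigma> $$ (k, l))
      (coord x) (coord ?om)"
  proof (rule state_process_of_vectors[OF x om A AC])
    show "AE \<omega> in M. x (t + 1) \<omega> = vec (xdim S) (\<lambda>i. \<Sum>\<sigma>\<in>UNIV.
        ((Amat S \<sigma> *\<^sub>v x t \<omega> + ?AC \<sigma> *\<^sub>v ?om t \<omega>) $ i) * mu \<sigma> t \<omega>)" for t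
      using state[of t] AE_space
    proof eventually_elim
      case (elim \<omega>)
      have c: "x t \<omega> \<in> carrier_vec (xdim S)" "u t \<omega> \<in> carrier_vec nu" "noise S t \<omega> \<in> carrier_vec nv"
        using vector_process_carrier[OF x elim(2)] vector_process_carrier[OF u elim(2)]
          vector_process_carrier[OF v elim(2)] by auto
      have "?AC \<sigma> *\<^sub>v ?om t \<omega> = Kmat S \<sigma> *\<^sub>v noise S t \<omega> + Bmat S \<sigma> *\<^sub>v u t \<omega>" for \<sigma>
        unfolding stack_def by (rule append_cols_mult_vec[OF K B c(3,2)])
      then have "(Amat S \<sigma> *\<^sub>v x t \<omega> + Bmat S \<sigma> *\<^sub>v u t \<omega> + Kmat S \<sigma> *\<^sub>v noise S t \<omega>) $ i =
          (Amat S \<sigma> *\<^sub>v x t \<omega> + ?AC \<sigma> *\<^sub>v ?om t \<omega>) $ i" if "i < xdim S" for \<sigma> i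
        using that carrier_matD[OF A] carrier_matD[OF B] carrier_matD[OF K] by simp
      then show ?case unfolding elim(1) by (intro eq_vecI) simp_all
    qed
  qed (use S' in blast)+
  show "AE \<omega> in M. y t \<omega> $ i = (\<Sum>l<xdim S. Cmat S $$ (i, l) * x t \<omega> $ l) +
      (\<Sum>l<nv + nu. (if l < nv then Fmat S $$ (i, l) else Dmat S $$ (i, l - nv)) * ?om t \<omega> $ l)"
    if i: "i < ny" for i t
    using out[of t] AE_space
  proof eventually_elim
    case (elim \<omega>)
    have c: "x t \<omega> \<in> carrier_vec (xdim S)" "u t \<omega> \<in> carrier_vec nu" "noise S t \<omega> \<in> carrier_vec nv"
      using vector_process_carrier[OF x elim(2)] vector_process_carrier[OF u elim(2)]
        vector_process_carrier[OF v elim(2)] by auto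
    have om: "append_cols (Fmat S) (Dmat S) *\<^sub>v ?om t \<omega> = Fmat S *\<^sub>v noise S t \<omega> + Dmat S *\<^sub>v u t \<omega>"
      unfolding stack_def by (rule append_cols_mult_vec[OF F D c(3,2)])
    have "y t \<omega> $ i = (Cmat S *\<^sub>v x t \<omega>) $ i + (append_cols (Fmat S) (Dmat S) *\<^sub>v ?om t \<omega>) $ i"
      unfolding om elim(1) using i carrier_matD[OF C] carrier_matD[OF D] carrier_matD[OF F] by simp
    also have "(Cmat S *\<^sub>v x t \<omega>) $ i = (\<Sum>l<xdim S. Cmat S $$ (i, l) * x t \<omega> $ l)"
      using i c carrier_matD[OF C] by (simp add: scalar_prod_def atLeast0LessThan)
    also have "(append_cols (Fmat S) (Dmat S) *\<^sub>v ?om t \<omega>) $ i =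
        (\<Sum>l<nv + nu. append_cols (Fmat S) (Dmat S) $$ (i, l) * ?om t \<omega> $ l)"
      using i vector_process_carrier[OF \<open>vector_process M (nv + nu) ?om\<close> elim(2), of t]
        carrier_matD[OF append_cols_carrier[OF F D]]
      by (simp add: scalar_prod_def atLeast0LessThan)
    finally show ?case
      using i by (simp add: append_cols_index[OF F D] cong: if_cong)
  qed
  show "ip M (Z (coord ?om k) w t) (Z (coord ?om l) v t) = 0"
    if k: "k < nv" and l: "l \<in> {nv..<nv + nu}" for k l w v t
  proof (rule state_process.noise_blocks_orthogonal[OF proc])
    fix \<sigma> t
    have "ip M (Z (coord ?om k) [\<sigma>] (t - 1 + 1)) (Z (coord ?om l) [\<sigma>] (t - 1 + 1)) =
        1 / p \<sigma> * ip M (\<lambda>\<omega>. ?om (t - 1) \<omega> $ k) (\<lambda>\<omega>. (mu \<sigma> (t - 1) \<omega>)\<^sup>2 * ?om (t - 1) \<omega> $ l)"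
      by (rule ip_Z_letter)
    also have "ip M (\<lambda>\<omega>. ?om (t - 1) \<omega> $ k) (\<lambda>\<omega>. (mu \<sigma> (t - 1) \<omega>)\<^sup>2 * ?om (t - 1) \<omega> $ l) =
        ip M (\<lambda>\<omega>. noise S (t - 1) \<omega> $ k) (\<lambda>\<omega>. ((mu \<sigma> (t - 1) \<omega>)\<^sup>2 \<cdot>\<^sub>v u (t - 1) \<omega>) $ (l - nv))"
      using k l by (intro ip_cong) (auto simp: vector_process_stack[OF v u] vector_process_dim[OF u])
    also have "\<dots> = E_outer M nv nu (noise S (t - 1)) (\<lambda>\<omega>. (mu \<sigma> (t - 1) \<omega>)\<^sup>2 \<cdot>\<^sub>v u (t - 1) \<omega>) $$ (k, l - nv)"
      using k l by (subst E_outer_index) auto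
    also have "E_outer M nv nu (noise S (t - 1)) (\<lambda>\<omega>. (mu \<sigma> (t - 1) \<omega>)\<^sup>2 \<cdot>\<^sub>v u (t - 1) \<omega>) = 0\<^sub>m nv nu"
      using S' by blast
    finally show "ip M (Z (coord ?om k) [\<sigma>] t) (Z (coord ?om l) [\<sigma>] t) = 0"
      using k l by auto
  qed (use k l in auto)
qed

lemma asGLSS_state_process:
  fixes S :: "('a, 's) asGLSS"
  assumes S: "asGLSS_with_state M mu E p ny y S x"
  shows asGLSS_is_state_process: "state_process M mu E p (xdim S) (vdim S) (Amat S) (\<lambda>\<sigma> k l. Kmat S \<sigma> $$ (k, l))
      (coord x) (coord (noise S))"
    and asGLSS_output: "i < ny \<Longrightarrow> AE \<omega> in M. y t \<omega> $ i = (\<Sum>l<xdim S. Cmat S $$ (i, l) * x t \<omega> $ l) +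
      (\<Sum>l<vdim S. Fmat S $$ (i, l) * noise S t \<omega> $ l)"
    and asGLSS_input_matrix: "k < xdim S \<Longrightarrow> j < ny \<Longrightarrow> (\<And>t. (\<lambda>\<omega>. y t \<omega> $ j) \<in> borel_measurable M) \<Longrightarrow>
      ip M (\<lambda>\<omega>. x 1 \<omega> $ k) (Z (coord y j) [\<sigma>] 1) = G_mat M mu p S x \<sigma> $$ (k, j)"
    and asGLSS_input_matrix_carrier: "G_mat M mu p S x \<sigma> \<in> carrier_mat (xdim S) ny"
proof -
  let ?nx = "xdim S" and ?nv = "vdim S"
  note S' = S[unfolded asGLSS_with_state_def Let_def]
  have A: "Amat S \<sigma> \<in> carrier_mat ?nx ?nx" and K: "Kmat S \<sigma> \<in> carrier_mat ?nx ?nv" for \<sigma>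
    using S' by blast+
  have C: "Cmat S \<in> carrier_mat ny ?nx" and F: "Fmat S \<in> carrier_mat ny ?nv"
    and v: "vector_process M ?nv (noise S)" and x: "vector_process M ?nx x"
    and out: "AE \<omega> in M. y t \<omega> = Cmat S *\<^sub>v x t \<omega> + Fmat S *\<^sub>v noise S t \<omega>" for t
    using S' by blast+
  show proc: "state_process M mu E p ?nx ?nv (Amat S) (\<lambda>\<sigma> k l. Kmat S \<sigma> $$ (k, l))
      (coord x) (coord (noise S))"
    by (rule state_process_of_vectors[OF x v A K]) (use S' in blast)+
  show y: "AE \<omega> in M. y t \<omega> $ i = (\<Sum>l<?nx. Cmat S $$ (i, l) * x t \<omega> $ l) +
      (\<Sum>l<?nv. Fmat S $$ (i, l) * noise S t \<omega> $ l)" if i: "i < ny" for i t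
    using out[of t] AE_space
  proof eventually_elim
    case (elim \<omega>)
    then show ?case
      using i vector_process_carrier[OF x elim(2), of t] vector_process_carrier[OF v elim(2), of t]
        carrier_matD[OF C] carrier_matD[OF F]
      by (simp add: scalar_prod_def atLeast0LessThan)
  qed
  define P where "P = cov_weighted M mu ?nx x \<sigma> 0"
  define Q where "Q = cov_weighted M mu ?nv (noise S) \<sigma> 0"
  have PQ: "P \<in> carrier_mat ?nx ?nx" "Q \<in> carrier_mat ?nv ?nv"
    by (simp_all add: P_def Q_def cov_weighted_def)
  have G: "G_mat M mu p S x \<sigma> = (1 / sqrt (p \<sigma>)) \<cdot>\<^sub>m (Amat S \<sigma> * P * (Cmat S)\<^sup>T + Kmat S \<sigma> * Q * (Fmat S)\<^sup>T)"
    by (simp add: G_mat_def P_def Q_def)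
  show "G_mat M mu p S x \<sigma> \<in> carrier_mat ?nx ny"
    unfolding G using A K C F PQ by (intro smult_carrier_mat add_carrier_mat mult_carrier_mat) auto
  show "ip M (\<lambda>\<omega>. x 1 \<omega> $ k) (Z (coord y j) [\<sigma>] 1) = G_mat M mu p S x \<sigma> $$ (k, j)"
    if k: "k < ?nx" and j: "j < ny" and meas: "\<And>t. (\<lambda>\<omega>. y t \<omega> $ j) \<in> borel_measurable M"
  proof -
    have triple: "(N * R * W\<^sup>T) $$ (k, j) = (\<Sum>l<n. \<Sum>l'<n. N $$ (k, l) * W $$ (j, l') * R $$ (l, l'))"
      if "N \<in> carrier_mat ?nx n" "R \<in> carrier_mat n n" "W \<in> carrier_mat ny n" for N R W :: "real mat" and n
    proof -
      have WT: "W\<^sup>T \<in> carrier_mat n ny" using that by simp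
      have "(N * R * W\<^sup>T) $$ (k, j) = (N * (R * W\<^sup>T)) $$ (k, j)"
        by (simp only: assoc_mult_mat[OF that(1,2) WT])
      also have "\<dots> = (\<Sum>l<n. N $$ (k, l) * (\<Sum>l'<n. R $$ (l, l') * W $$ (j, l')))"
        using that k j by (simp add: scalar_prod_def atLeast0LessThan)
      finally show ?thesis by (simp add: sum_distrib_left ac_simps)
    qed
    have xx: "ip M (Z (coord x l) [\<sigma>] 1) (Z (coord x l') [\<sigma>] 1) = 1 / p \<sigma> * P $$ (l, l')"
      if l: "l < ?nx" "l' < ?nx" for l l'
    proof -
      have "ip M (\<lambda>\<omega>. x 0 \<omega> $ l) (\<lambda>\<omega>. (mu \<sigma> 0 \<omega>)\<^sup>2 * x 0 \<omega> $ l') = P $$ (l, l')"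
        unfolding P_def cov_weighted_def E_outer_index[OF l]
        using l by (intro ip_cong) (auto simp: vector_process_dim[OF x])
      then show ?thesis using ip_Z_letter[of "\<lambda>t \<omega>. x t \<omega> $ l" \<sigma> 0 "\<lambda>t \<omega>. x t \<omega> $ l'"] by simp
    qed
    have vv: "ip M (Z (coord (noise S) l) [\<sigma>] 1) (Z (coord (noise S) l') [\<sigma>] 1) = 1 / p \<sigma> * Q $$ (l, l')"
      if l: "l < ?nv" "l' < ?nv" for l l'
    proof -
      have "ip M (\<lambda>\<omega>. noise S 0 \<omega> $ l) (\<lambda>\<omega>. (mu \<sigma> 0 \<omega>)\<^sup>2 * noise S 0 \<omega> $ l') = Q $$ (l, l')"
        unfolding Q_def cov_weighted_def E_outer_index[OF l]
        using l by (intro ip_cong) (auto simp: vector_process_dim[OF v])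
      then show ?thesis using ip_Z_letter[of "\<lambda>t \<omega>. noise S t \<omega> $ l" \<sigma> 0 "\<lambda>t \<omega>. noise S t \<omega> $ l'"] by simp
    qed
    have "ip M (\<lambda>\<omega>. x 1 \<omega> $ k) (Z (coord y j) [\<sigma>] 1) = sqrt (p \<sigma>) *
      ((\<Sum>l<?nx. \<Sum>l'<?nx. Amat S \<sigma> $$ (k, l) * Cmat S $$ (j, l') * (1 / p \<sigma> * P $$ (l, l'))) +
       (\<Sum>l<?nv. \<Sum>l'<?nv. Kmat S \<sigma> $$ (k, l) * Fmat S $$ (j, l') * (1 / p \<sigma> * Q $$ (l, l'))))"
      unfolding state_process.ip_state_output_letter[OF proc y[OF j] meas k]
      by (simp add: xx vv)
    also have "\<dots> = sqrt (p \<sigma>) / p \<sigma> *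
      ((\<Sum>l<?nx. \<Sum>l'<?nx. Amat S \<sigma> $$ (k, l) * Cmat S $$ (j, l') * P $$ (l, l')) +
       (\<Sum>l<?nv. \<Sum>l'<?nv. Kmat S \<sigma> $$ (k, l) * Fmat S $$ (j, l') * Q $$ (l, l')))"
      by (simp only: mult.left_commute[of _ "1 / p \<sigma>"] sum_distrib_left[symmetric] distrib_left[symmetric]) simp
    also have "sqrt (p \<sigma>) / p \<sigma> = 1 / sqrt (p \<sigma>)"
      using p_pos[of \<sigma>] by (simp add: real_div_sqrt field_simps del: p_pos)
    also have "1 / sqrt (p \<sigma>) *
      ((\<Sum>l<?nx. \<Sum>l'<?nx. Amat S \<sigma> $$ (k, l) * Cmat S $$ (j, l') * P $$ (l, l')) +
       (\<Sum>l<?nv. \<Sum>l'<?nv. Kmat S \<sigma> $$ (k, l) * Fmat S $$ (j, l') * Q $$ (l, l'))) =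
       G_mat M mu p S x \<sigma> $$ (k, j)"
    proof -
      have "(Amat S \<sigma> * P * (Cmat S)\<^sup>T + Kmat S \<sigma> * Q * (Fmat S)\<^sup>T) $$ (k, j) =
          (Amat S \<sigma> * P * (Cmat S)\<^sup>T) $$ (k, j) + (Kmat S \<sigma> * Q * (Fmat S)\<^sup>T) $$ (k, j)"
        using k j carrier_matD[OF A] carrier_matD[OF K] carrier_matD[OF C] carrier_matD[OF F] by simp
      then show ?thesis
        unfolding G using k j carrier_matD[OF A] carrier_matD[OF K] carrier_matD[OF C] carrier_matD[OF F]
        by (simp add: triple[OF A PQ(1) C] triple[OF K PQ(2) F])
    qed
    finally show ?thesis .
  qed
qed

end

section \<open>Minimality\<close>

theorem corollary2:
  fixes M :: "'a measure"
    and mu :: "('a, 's::finite) switching"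
    and E :: "('s \<times> 's) set" and p :: "'s \<Rightarrow> real"
    and ny nu :: nat
    and y u yd ys xs :: "'a process"
    and S :: "('a, 's) sGLSS"
  assumes "prob_space M"
    and "admissible_switching M mu E p"
    and "white_noise M mu E p nu u"
    and "ZMWSSI M mu p (ny + nu) (stack y u)"
    and "vector_process M ny y"
    and "is_deterministic_component M mu p ny nu y u yd"
    and "ys = (\<lambda>t \<omega>. y t \<omega> - yd t \<omega>)"
    and "is_sGLSS M mu E p ny nu y u S"
    and "asGLSS_with_state M mu E p ny ys (stochastic_part S) xs"
    and "reachable M mu p (stochastic_part S) xs"
    and "observable (stochastic_part S)"
  shows "\<forall>S' :: ('a, 's) sGLSS. is_sGLSS M mu E p ny nu y u S' \<longrightarrow> xdim S \<le> xdim S'"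
proof (intro allI impI)
  fix S' :: "('a, 's) sGLSS"
  assume "is_sGLSS M mu E p ny nu y u S'"
  then obtain x' where S': "sGLSS_with_state M mu E p ny nu y u S' x'" by (auto simp: is_sGLSS_def)
  obtain x where S: "sGLSS_with_state M mu E p ny nu y u S x" using assms(8) by (auto simp: is_sGLSS_def)
  interpret prob_space M by (rule assms(1))
  interpret switching M mu E p by unfold_locales (rule assms(2))
  have u: "vector_process M nu u" using assms(3) by (simp add: white_noise_def ZMWSSI_def)
  have y: "vector_process M ny y" by (rule assms(5))
  define Ss where "Ss = stochastic_part S"
  have Ss_simps: "xdim Ss = xdim S" "vdim Ss = vdim S" "Amat Ss = Amat S" "Kmat Ss = Kmat S" "Cmat Ss = Cmat S"
    "Fmat Ss = Fmat S" "noise Ss = noise S"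
    by (simp_all add: Ss_def stochastic_part_def)
  have Ss: "asGLSS_with_state M mu E p ny ys Ss xs" using assms(9) by (simp add: Ss_def)
  let ?yc = "coord y" and ?ysc = "\<lambda>i t \<omega>. ys t \<omega> $ i" and ?uc = "coord u"
    and ?ydc = "\<lambda>i t \<omega>. yd t \<omega> $ i"
  let ?nv = "vdim S" and ?nv' = "vdim S'"
  let ?om = "stack (noise S) u" and ?om' = "stack (noise S') u"
  interpret W: state_process M mu E p "xdim S" "?nv + nu" "Amat S"
    "\<lambda>\<sigma> k l. append_cols (Kmat S \<sigma>) (Bmat S \<sigma>) $$ (k, l)" "coord x" "coord ?om"
    by (rule sGLSS_is_state_process[OF S u])
  interpret W': state_process M mu E p "xdim S'" "?nv' + nu" "Amat S'"
    "\<lambda>\<sigma> k l. append_cols (Kmat S' \<sigma>) (Bmat S' \<sigma>) $$ (k, l)" "coord x'" "coord ?om'"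
    by (rule sGLSS_is_state_process[OF S' u])
  have Ws: "state_process M mu E p (xdim S) ?nv (Amat S) (\<lambda>\<sigma> k l. Kmat S \<sigma> $$ (k, l))
      (coord xs) (coord (noise S))"
    using asGLSS_is_state_process[OF Ss] unfolding Ss_simps .
  interpret Ws: state_process M mu E p "xdim S" ?nv "Amat S" "\<lambda>\<sigma> k l. Kmat S \<sigma> $$ (k, l)"
    "coord xs" "coord (noise S)"
    by (rule Ws)
  note v = sGLSS_carriers(7)[OF S] and v' = sGLSS_carriers(7)[OF S']
  note carr = sGLSS_carriers(1-4)[OF S] sGLSS_carriers(1,4)[OF S']
  have meas_y: "?yc i t \<in> borel_measurable M" if "i < ny" for i t
    using y that by (simp add: vector_process_def)
  have sq_y: "square_integrable M (?yc i t)" if "i < ny" for i t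
    using W.output_square_integrable[OF sGLSS_output[OF S u that] meas_y[OF that], of "[]" t] by simp
  define gens where "gens t = {\<lambda>\<omega>. s \<omega> $ j | s j. s \<in> {z_proc mu p u w t | w. w \<noteq> []} \<union> {u t} \<and> j < nu}" for t
  have proj: "\<forall>\<omega>\<in>space M. yd t \<omega> \<in> carrier_vec ny"
    "i < ny \<Longrightarrow> is_L2_projection M (L2_closed_span M (gens t)) (?yc i t) (?ydc i t)" for i t
    using assms(6) unfolding is_deterministic_component_def is_El_def gens_def by blast+
  have sq_yd: "square_integrable M (?ydc i t)" if "i < ny" for i t
    using proj(2)[OF that, of t] by (simp add: is_L2_projection_def L2_closed_span_def)
  have ys: "?ysc i t \<omega> = ?yc i t \<omega> - ?ydc i t \<omega>" if "i < ny" "\<omega> \<in> space M" for i t \<omega>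
  proof -
    have "dim_vec (yd t \<omega>) = ny" using proj(1)[of t] that(2) by auto
    then show ?thesis using that vector_process_dim[OF y that(2), of t] by (simp add: assms(7))
  qed
  have sq_ys: "square_integrable M (?ysc i t)" if "i < ny" for i t
    using sq_int_diff[OF sq_y sq_yd, OF that that, of t t] ys[OF that]
    by (subst sq_int_cong[of M _ "\<lambda>\<omega>. ?yc i t \<omega> - ?ydc i t \<omega>"]) auto
  have meas_ys: "?ysc i t \<in> borel_measurable M" if "i < ny" for i t
    by (rule sq_int_measurable[OF sq_ys[OF that]])
  have ip_ys: "ip M (?ysc i t) f = ip M (?yc i t) f - ip M (?ydc i t) f"
    if "i < ny" "square_integrable M f" for i t f
  proof -
    have "ip M (?ysc i t) f = ip M (\<lambda>\<omega>. ?yc i t \<omega> - ?ydc i t \<omega>) f"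
      by (rule ip_cong) (simp_all add: ys[OF that(1)])
    then show ?thesis using ip_diff_left[OF sq_y sq_yd, OF that(1) that(1) that(2)] by simp
  qed

  have joint_u: "joint (?uc ` {..<nu})"
    by (rule joint_of_ZMWSSI[of nu u]) (use assms(3) in \<open>auto simp: white_noise_def\<close>)
  have gens: "\<exists>q. \<exists>j<nu. \<forall>\<omega>\<in>space M. f \<omega> = Z (?uc j) q t \<omega>" if "f \<in> gens t" for f t
  proof -
    from that obtain s j where f: "f = (\<lambda>\<omega>. s \<omega> $ j)" "j < nu" "s = u t \<or> (\<exists>w. w \<noteq> [] \<and> s = z_proc mu p u w t)"
      unfolding gens_def by blast
    show ?thesis
    proof (cases "s = u t")
      case True
      then show ?thesis using f by (intro exI[of _ "[]"] exI[of _ j]) simp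
    next
      case False
      then obtain w where "s = z_proc mu p u w t" using f by blast
      then show ?thesis using f(1,2)
        by (intro exI[of _ w] exI[of _ j]) (simp add: z_proc_component[OF u])
    qed
  qed
  have sq_u: "square_integrable M (Z (?uc j) q t)" if "j < nu" for j q t
    by (rule joint_square_integrable[OF joint_u]) (use that in simp)
  have sq_gens: "square_integrable M f" if f: "f \<in> gens t" for f t
  proof -
    obtain q j where "j < nu" "\<And>\<omega>. \<omega> \<in> space M \<Longrightarrow> f \<omega> = Z (?uc j) q t \<omega>" using gens[OF f] by blast
    then show ?thesis using sq_u by (subst sq_int_cong[of M f "Z (?uc j) q t"]) auto
  qed
  have ys_u: "ip M (?ysc i t) (Z (?uc j) q t) = 0" if "i < ny" "j < nu" for i j q t
  proof -
    define s where "s = (if q = [] then u t else z_proc mu p u q t)"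
    have s: "Z (?uc j) q t \<omega> = s \<omega> $ j" if "\<omega> \<in> space M" for \<omega>
      using z_proc_component[OF u \<open>j < nu\<close> that, of mu p q t] by (simp add: s_def)
    have "(\<lambda>\<omega>. s \<omega> $ j) \<in> gens t" unfolding gens_def s_def using that by auto
    then have mem: "(\<lambda>\<omega>. s \<omega> $ j) \<in> L2_closed_span M (gens t)"
      by (intro in_L2_closed_span sq_gens)
    have "ip M (\<lambda>\<omega>. ?yc i t \<omega> - ?ydc i t \<omega>) (\<lambda>\<omega>. s \<omega> $ j) = 0"
      using bspec[OF conjunct2[OF proj(2)[OF that(1), of t, unfolded is_L2_projection_def]] mem]
      by (simp add: ip_def)
    moreover have "ip M (?ysc i t) (Z (?uc j) q t) = ip M (\<lambda>\<omega>. ?yc i t \<omega> - ?ydc i t \<omega>) (\<lambda>\<omega>. s \<omega> $ j)"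
      by (rule ip_cong) (simp_all add: ys[OF that(1)] s)
    ultimately show ?thesis by simp
  qed
  have yd_orth: "ip M (?ydc i t) f = 0"
    if i: "i < ny" and f: "square_integrable M f" and o: "\<And>j q. j < nu \<Longrightarrow> ip M (Z (?uc j) q t) f = 0" for i t f
  proof (rule L2_closed_span_orthogonal[OF sq_gens _ f])
    show "?ydc i t \<in> L2_closed_span M (gens t)" using proj(2)[OF i, of t] by (simp add: is_L2_projection_def)
    fix g assume "g \<in> gens t"
    then obtain q j where "j < nu" "\<And>\<omega>. \<omega> \<in> space M \<Longrightarrow> g \<omega> = Z (?uc j) q t \<omega>" using gens by blast
    then show "ip M g f = 0" using o[of j q] ip_cong[of M g "Z (?uc j) q t" f f] by simp
  qed
  have om_u: "ip M f (Z (\<lambda>t \<omega>. stack v u t \<omega> $ l) q t) = ip M f (Z (?uc (l - n)) q t)"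
    if "vector_process M n v" "l \<in> {n..<n + nu}" for f v n l q t
    using that by (intro ip_cong) (auto simp: zs_def vector_process_stack(3)[OF _ u])

  \<comment> \<open>The recursion in the competitor, with the correlations of $y^s$ against $z^y$.\<close>
  have resp': "\<exists>h\<in>carrier_vec (xdim S'). \<forall>i<ny. \<forall>w. ip M (?ysc i 0) (Z (?yc j) (\<sigma> # w) 0) =
      sqrt (p_word p w) * (\<Sum>k<xdim S'. Cmat S' $$ (i, k) * (mat_word (xdim S') (Amat S') w *\<^sub>v h) $ k)"
    if j: "j < ny" for j \<sigma>
  proof -
    have det: "l \<in> {?nv'..<?nv' + nu}" if "l \<in> {..<?nv' + nu} - {..<?nv'}" for l
      using that by auto
    obtain h where "h \<in> carrier_vec (xdim S')"
      "\<And>i w t. i < ny \<Longrightarrow> ip M (?ysc i t) (Z (?yc j) (\<sigma> # w) t) =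
        sqrt (p_word p w) * (\<Sum>k<xdim S'. Cmat S' $$ (i, k) * (mat_word (xdim S') (Amat S') w *\<^sub>v h) $ k)"
    proof (rule W'.output_correlation_factorization[of ny ?yc "Cmat S'"
          "\<lambda>i l. if l < ?nv' then Fmat S' $$ (i, l) else Dmat S' $$ (i, l - ?nv')" "{..<?nv'}" ?ysc j \<sigma>])
      show "AE \<omega> in M. ?yc i t \<omega> = (\<Sum>l<xdim S'. Cmat S' $$ (i, l) * x' t \<omega> $ l) +
        (\<Sum>l<?nv' + nu. (if l < ?nv' then Fmat S' $$ (i, l) else Dmat S' $$ (i, l - ?nv')) * ?om' t \<omega> $ l)"
        if "i < ny" for i t by (rule sGLSS_output[OF S' u that])
      show "ip M (Z (coord ?om' k) w t) (Z (coord ?om' l) v t) = 0"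
        if "k \<in> {..<?nv'}" "l \<in> {..<?nv' + nu} - {..<?nv'}" for k l w v t
        using that det by (intro sGLSS_noise_blocks[OF S' u]) auto
      show "ip M (?ysc i t) (Z (coord ?om' l) q t) = 0"
        if "i < ny" "l \<in> {..<?nv' + nu} - {..<?nv'}" for i l q t
        unfolding om_u[OF v' det[OF that(2)]] using that by (intro ys_u) auto
      show "ip M (?ysc i t) (Z (coord ?om' l) q t) = ip M (?yc i t) (Z (coord ?om' l) q t)"
        if "i < ny" "l \<in> {..<?nv'}" for i l q t
      proof -
        have sq: "square_integrable M (Z (coord ?om' l) q t)" using that by (intro W'.sq_e) auto
        have "ip M (?ydc i t) (Z (coord ?om' l) q t) = 0"
        proof (rule yd_orth[OF that(1) sq])
          fix j r assume j: "j < nu"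
          have "ip M (Z (coord ?om' l) q t) (Z (coord ?om' (?nv' + j)) r t) = 0"
            using that j by (intro sGLSS_noise_blocks[OF S' u]) auto
          then show "ip M (Z (?uc j) r t) (Z (coord ?om' l) q t) = 0"
            using om_u[OF v', of "?nv' + j"] j by (simp add: ip_commute)
        qed
        then show ?thesis using ip_ys[OF that(1) sq] by simp
      qed
    qed (use j sq_ys meas_y in auto)
    then show ?thesis by blast
  qed

  \<comment> \<open>The same correlations in the given system: first \<open>x\<close> is replaced by \<open>xs\<close> and \<open>y\<close> by \<open>ys\<close>,
    then the recursion is applied to the stochastic part.\<close>
  have resp: "ip M (?ysc i 0) (Z (?yc j) (\<sigma> # w) 0) = sqrt (p_word p w) *
      (\<Sum>k<xdim S. Cmat S $$ (i, k) * (mat_word (xdim S) (Amat S) w *\<^sub>v col (G_mat M mu p Ss xs \<sigma>) j) $ k)"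
    if i: "i < ny" and j: "j < ny" for i j \<sigma> w
  proof -
    let ?q = "\<sigma> # w" and ?D = "\<lambda>l. if l < ?nv then Fmat S $$ (j, l) else Dmat S $$ (j, l - ?nv)"
    let ?f = "?ysc i 0"
    have sqf: "square_integrable M ?f" by (rule sq_ys[OF i])
    have det: "ip M ?f (Z (coord ?om l) q 0) = 0" if "l \<in> {?nv..<?nv + nu}" for l q
      unfolding om_u[OF v that] using that i by (intro ys_u) auto
    have ys_out: "AE \<omega> in M. ?ysc i t \<omega> = (\<Sum>l<xdim S. Cmat S $$ (i, l) * xs t \<omega> $ l) +
      (\<Sum>l<?nv. Fmat S $$ (i, l) * noise S t \<omega> $ l)" if "i < ny" for i t
      using asGLSS_output[OF Ss that, of t] unfolding Ss_simps .
    have "ip M ?f (Z (?yc j) ?q 0) = (\<Sum>l<xdim S. Cmat S $$ (j, l) * ip M ?f (Z (coord x l) ?q 0)) +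
        (\<Sum>l<?nv + nu. ?D l * ip M ?f (Z (coord ?om l) ?q 0))"
      by (rule W.ip_output_Z[OF sGLSS_output[OF S u j] meas_y[OF j] sqf])
    also have "(\<Sum>l<?nv + nu. ?D l * ip M ?f (Z (coord ?om l) ?q 0)) =
        (\<Sum>l<?nv. Fmat S $$ (j, l) * ip M ?f (Z (coord (noise S) l) ?q 0))"
    proof -
      have "(\<Sum>l<?nv + nu. ?D l * ip M ?f (Z (coord ?om l) ?q 0)) =
          (\<Sum>l<?nv. ?D l * ip M ?f (Z (coord ?om l) ?q 0))"
        using det by (intro sum.mono_neutral_right) auto
      also have "\<dots> = (\<Sum>l<?nv. Fmat S $$ (j, l) * ip M ?f (Z (coord (noise S) l) ?q 0))"
        by (intro sum.cong arg_cong2[of _ _ _ _ "(*)"] ip_cong) (auto simp: zs_def vector_process_stack(2)[OF v u])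
      finally show ?thesis .
    qed
    also have "(\<Sum>l<xdim S. Cmat S $$ (j, l) * ip M ?f (Z (coord x l) ?q 0)) =
        (\<Sum>l<xdim S. Cmat S $$ (j, l) * ip M ?f (Z (coord xs l) ?q 0))"
    proof (intro sum.cong refl arg_cong[of _ _ "(*) _"])
      fix k assume "k \<in> {..<xdim S}"
      then show "ip M ?f (Z (coord x k) ?q 0) = ip M ?f (Z (coord xs k) ?q 0)"
        using det
        by (intro W.ip_state_eq_ip_stochastic_state[OF Ws _ _ _ sqf])
           (auto simp: append_cols_index[OF carr(2) carr(3)] vector_process_stack(2)[OF v u])
    qed
    also have "(\<Sum>l<xdim S. Cmat S $$ (j, l) * ip M ?f (Z (coord xs l) ?q 0)) +
        (\<Sum>l<?nv. Fmat S $$ (j, l) * ip M ?f (Z (coord (noise S) l) ?q 0)) = ip M ?f (Z (?ysc j) ?q 0)"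
      by (rule Ws.ip_output_Z[OF ys_out[OF j] meas_ys[OF j] sqf, symmetric])
    also have "\<dots> = sqrt (p_word p w) * (\<Sum>k<xdim S. Cmat S $$ (i, k) * (mat_word (xdim S) (Amat S) w *\<^sub>v
        vec (xdim S) (\<lambda>k. ip M (\<lambda>\<omega>. xs 1 \<omega> $ k) (Z (?ysc j) [\<sigma>] 1))) $ k)"
        by (rule Ws.output_autocorrelation[of ny ?ysc "Cmat S" "\<lambda>i l. Fmat S $$ (i, l)", OF ys_out meas_ys i j])
    also have "vec (xdim S) (\<lambda>k. ip M (\<lambda>\<omega>. xs 1 \<omega> $ k) (Z (?ysc j) [\<sigma>] 1)) = col (G_mat M mu p Ss xs \<sigma>) j"
      using asGLSS_input_matrix[OF Ss _ j meas_ys[OF j]] asGLSS_input_matrix_carrier[OF Ss, of \<sigma>] j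
      unfolding Ss_simps by (intro eq_vecI) auto
    finally show ?thesis .
  qed

  show "xdim S \<le> xdim S'"
  proof (rule dim_le_of_common_responses[where C = "Cmat S" and A = "Amat S" and C' = "Cmat S'" and A' = "Amat S'"
        and G = "G_mat M mu p Ss xs"])
    show "G_mat M mu p Ss xs \<sigma> \<in> carrier_mat (xdim S) ny" for \<sigma>
      using asGLSS_input_matrix_carrier[OF Ss] unfolding Ss_simps .
    show "LinearCombinations.module.span class_ring (module_vec TYPE(real) (xdim S))
      (\<Union>w \<sigma>. set (cols (mat_word (xdim S) (Amat S) w * G_mat M mu p Ss xs \<sigma>))) = carrier_vec (xdim S)"
      using assms(10) unfolding reachable_def Ss_def[symmetric] Ss_simps .
    show "(\<Inter>w. mat_kernel (Cmat S * mat_word (xdim S) (Amat S) w)) = {0\<^sub>v (xdim S)}"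
      using assms(11) unfolding observable_def Ss_def[symmetric] Ss_simps .
    fix \<sigma> j assume j: "j < ny"
    obtain h where h: "h \<in> carrier_vec (xdim S')" "\<And>i w. i < ny \<Longrightarrow> ip M (?ysc i 0) (Z (?yc j) (\<sigma> # w) 0) =
      sqrt (p_word p w) * (\<Sum>k<xdim S'. Cmat S' $$ (i, k) * (mat_word (xdim S') (Amat S') w *\<^sub>v h) $ k)"
      using resp'[OF j, of \<sigma>] by blast
    have "Cmat S *\<^sub>v (mat_word (xdim S) (Amat S) w *\<^sub>v col (G_mat M mu p Ss xs \<sigma>) j) =
        Cmat S' *\<^sub>v (mat_word (xdim S') (Amat S') w *\<^sub>v h)" for w
    proof (rule eq_vecI)
      fix i assume "i < dim_vec (Cmat S' *\<^sub>v (mat_word (xdim S') (Amat S') w *\<^sub>v h))"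
      then have i: "i < ny" using carr by simp
      have "sqrt (p_word p w) \<noteq> 0" using p_word_pos[of w] by (simp del: p_word_pos)
      then have eq: "(\<Sum>k<xdim S. Cmat S $$ (i, k) * (mat_word (xdim S) (Amat S) w *\<^sub>v col (G_mat M mu p Ss xs \<sigma>) j) $ k) =
        (\<Sum>k<xdim S'. Cmat S' $$ (i, k) * (mat_word (xdim S') (Amat S') w *\<^sub>v h) $ k)"
        using resp[OF i j, of \<sigma> w] h(2)[OF i, of w] by simp
      have mv: "(C *\<^sub>v b) $ i = (\<Sum>k<n. C $$ (i, k) * b $ k)"
        if "C \<in> carrier_mat ny n" "b \<in> carrier_vec n" for C :: "real mat" and b n
        using that i by (simp add: scalar_prod_def atLeast0LessThan)
      have col: "col (G_mat M mu p Ss xs \<sigma>) j \<in> carrier_vec (xdim S)"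
        using carrier_matD(1)[OF asGLSS_input_matrix_carrier[OF Ss, of \<sigma>]] unfolding Ss_simps
        by (intro carrier_vecI) simp
      show "(Cmat S *\<^sub>v (mat_word (xdim S) (Amat S) w *\<^sub>v col (G_mat M mu p Ss xs \<sigma>) j)) $ i =
          (Cmat S' *\<^sub>v (mat_word (xdim S') (Amat S') w *\<^sub>v h)) $ i"
        unfolding mv[OF carr(4) mult_mat_vec_carrier[OF W.mat_word_nx col]]
          mv[OF carr(6) mult_mat_vec_carrier[OF W'.mat_word_nx h(1)]] by (rule eq)
    qed (use carr in simp)
    then show "\<exists>h\<in>carrier_vec (xdim S'). \<forall>w.
      Cmat S *\<^sub>v (mat_word (xdim S) (Amat S) w *\<^sub>v col (G_mat M mu p Ss xs \<sigma>) j) =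
      Cmat S' *\<^sub>v (mat_word (xdim S') (Amat S') w *\<^sub>v h)"
      using h(1) by blast
  qed (rule carr)+
qed

end
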